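(* Let $\mathcal{X}$ be a smooth compact orbifold with (nonempty) boundary $\partial\mathcal{X}$. Assume that the singular set of $\mathcal{X}$ has codimension greater than $1$. Then $\partial\mathcal{X}$ is not a smooth orbifold retract of $\mathcal{X}$.
   Context: Smooth means $C^\infty$. Orbifold with boundary. An $n$-dimensional smooth orbifold with boundary $\mathcal{X}$ consists of a paracompact Hausdorff space $X_{\mathcal{X}}$ (the underlying space) with the following local structure. For each $x\in X_{\mathcal{X}}$ and neighborhood $U$ of $x$ there are a neighborhood $U_x\subset U$ of $x$, a space $\tilde U_x$ diffeomorphic to $\mathbb{R}^n$ or to the closed upper half-space $\mathbb{R}^n_+$, a finite group $\Gamma_x$ acting smoothly and effectively on $\tilde U_x$ and fixing $0\in\tilde U_x$, and a homeomorphism $\phi_x:\tilde U_x/\Gamma_x\to U_x$ with $\phi_x(0)=x$. These satisfy: if $U_z\subset U_x$ is another such neighborhood with data $\tilde U_z,\Gamma_z,\phi_z$, there are a smooth embedding $\tilde\psi_{zx}:\tilde U_z\to\tilde U_x$ and an injective homomorphism $\theta_{zx}:\Gamma_z\to\Gamma_x$ such that $\tilde\psi_{zx}$ is $\theta_{zx}$-equivariant and covers the inclusion $U_z\subset U_x$. The pair $(\tilde U_x,\Gamma_x)$ is an orbifold chart at $x$, and $\Gamma_x$ the isotropy group of $x$. The boundary $\partial\mathcal{X}$ consists of those $x$ for which $\tilde U_x$ is diffeomorphic to $\mathbb{R}^n_+$ (with $x$ corresponding to $0\in\partial\mathbb{R}^n_+$); it is a smooth $(n-1)$-dimensional orbifold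 without boundary, with charts $(\partial\tilde U_x,\Gamma_x)$. Compact means the underlying space is compact. Here $\partial\mathcal{X}$ is assumed nonempty. Singular set. The singular set is the set of points with $\Gamma_x\neq\{e\}$. It is stratified: near a singular point $x$, the stratum through $x$ is the image in $U_x$ of the fixed point set of $\Gamma_x$ in $\tilde U_x$, and its dimension is that of the subspace of $T_0\tilde U_x\cong\mathbb{R}^n$ fixed by $\Gamma_x$. The singular set has codimension greater than $1$ if every singular stratum has dimension less than $n-1$. Complete orbifold map. A smooth complete orbifold map ${}_\star f=(f,\{\tilde f_x\},\{\Theta_{f,x}\}):\mathcal{X}\to\mathcal{P}$ consists of a continuous map $f:X_{\mathcal{X}}\to X_{\mathcal{P}}$ and, for each $x\in\mathcal{X}$, a group homomorphism $\Theta_{f,x}:\Gamma_x\to\Gamma_{f(x)}$ and a smooth $\Theta_{f,x}$-equivariant map $\tilde f_x:\tilde U_x\to\tilde V_{f(x)}$ covering $f|_{U_x}$, where $(\tilde U_x,\Gamma_x)$ and $(\tilde V_{f(x)},\Gamma_{f(x)})$ are orbifold charts at $x$ and $f(x)$. Two such maps are identified if for each $x$ the lifts agree as germs at $0\in\tilde U_x$ and the homomorphisms agree. Retract. $\partial\mathcal{X}$ is a smooth orbifold retract of $\mathcal{X}$ if there is a smooth complete orbifold map ${}_\star f:\mathcal{X}\to\partial\mathcal{X}$ with ${}_\star f|_{\partial\mathcal{X}}=\mathrm{Id}$, i.e. whose restriction to $\partial\mathcal{X}$ (restricting $f$ to $\partial\mathcal{X}$ and the lifts at boundary points to $\partial\tilde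 U_x$) is the identity complete orbifold map of $\partial\mathcal{X}$: identity underlying map, identity lifts and identity homomorphisms. *)

theory Defs
  imports "HOL-Analysis.Analysis" "HOL-Algebra.Group_Action"
begin

section \<open>Smooth maps on subsets of Euclidean spaces\<close>

text \<open>\<open>Ck_on k f S\<close>: \<open>f\<close> is of class \<open>C\<^sup>k\<close> on \<open>S\<close>; only meant for open sets \<open>S\<close>.\<close>

fun Ck_on :: "nat \<Rightarrow> ('a::euclidean_space \<Rightarrow> 'b::euclidean_space) \<Rightarrow> 'a set \<Rightarrow> bool" where
  "Ck_on 0 f S \<longleftrightarrow> continuous_on S f"
| "Ck_on (Suc k) f S \<longleftrightarrow>
     (\<forall>x\<in>S. f differentiable (at x)) \<and> (\<forall>v. Ck_on k (\<lambda>x. frechet_derivative f (at x) v) S)"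

text \<open>On a set that need not be open, such as a closed half-space, a map is smooth if near each
  point it extends to a smooth map on an open set of the ambient space.\<close>

definition smooth_on :: "'a::euclidean_space set \<Rightarrow> ('a \<Rightarrow> 'b::euclidean_space) \<Rightarrow> bool" where
  "smooth_on M f \<longleftrightarrow>
     (\<forall>x\<in>M. \<exists>N g. open N \<and> x \<in> N \<and> (\<forall>k. Ck_on k g N) \<and> (\<forall>y\<in>N \<inter> M. g y = f y))"

text \<open>Embeddings of charts are codimension-zero embeddings: diffeomorphisms onto relatively open
  subsets of the target.\<close>

definition smooth_embedding ::
  "'a::euclidean_space set \<Rightarrow> 'b::euclidean_space set \<Rightarrow> ('a \<Rightarrow> 'b) \<Rightarrow> bool" where
  "smooth_embedding M N \<psi> \<longleftrightarrow>
     \<psi> \<in> M \<rightarrow> N \<and> inj_on \<psi> M \<and> smooth_on M \<psi> \<and>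
     openin (top_of_set N) (\<psi> ` M) \<and> smooth_on (\<psi> ` M) (inv_into M \<psi>)"

definition paracompact_space :: "'p topology \<Rightarrow> bool" where
  "paracompact_space T \<longleftrightarrow>
     (\<forall>\<U>. (\<forall>U\<in>\<U>. openin T U) \<and> \<Union>\<U> = topspace T \<longrightarrow>
        (\<exists>\<V>. (\<forall>V\<in>\<V>. openin T V \<and> (\<exists>U\<in>\<U>. V \<subseteq> U)) \<and> \<Union>\<V> = topspace T \<and>
              locally_finite_in T \<V>))"

section \<open>Model spaces\<close>

text \<open>\<open>\<real>\<^sup>n\<close> is realised as any \<open>n\<close>-dimensional linear subspace of an ambient Euclidean space and
  \<open>\<real>\<^sup>n\<^sub>+\<close> as any closed half of such a subspace. This lets an orbifold and its boundary, which has one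
  dimension less, have their charts in one ambient type.\<close>

definition euclidean_model :: "nat \<Rightarrow> 'e::euclidean_space set \<Rightarrow> bool" where
  "euclidean_model n M \<longleftrightarrow> subspace M \<and> dim M = n"

definition halfspace_model :: "nat \<Rightarrow> 'e::euclidean_space set \<Rightarrow> bool" where
  "halfspace_model n M \<longleftrightarrow>
     (\<exists>S b. subspace S \<and> dim S = n \<and> b \<in> S \<and> b \<noteq> 0 \<and> M = {v \<in> S. 0 \<le> b \<bullet> v})"

section \<open>Orbifolds with boundary\<close>

record ('p, 'e, 'g) ochart =
  ccenter :: 'p
  cnbhd :: "'p set"
  cmodel :: "'e set"
  cgroup :: "'g monoid"
  caction :: "'g \<Rightarrow> 'e \<Rightarrow> 'e"
  cproj :: "'e \<Rightarrow> 'p"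

text \<open>\<open>cproj c\<close> is the composite of the quotient map \<open>\<tilde>U \<rightarrow> \<tilde>U/\<Gamma>\<close> with the homeomorphism
  \<open>\<phi> : \<tilde>U/\<Gamma> \<rightarrow> U\<close>: it is a quotient map onto \<open>U\<close> whose fibres are the orbits of \<open>\<Gamma>\<close>. The library's
  \<open>faithful_action\<close> is an effective action, by bijections that are \<open>undefined\<close> outside
  the model.\<close>

definition chart_on :: "nat \<Rightarrow> 'p topology \<Rightarrow> ('p, 'e::euclidean_space, 'g) ochart \<Rightarrow> bool" where
  "chart_on n T c \<longleftrightarrow>
     openin T (cnbhd c) \<and> ccenter c \<in> cnbhd c \<and>
     (euclidean_model n (cmodel c) \<or> halfspace_model n (cmodel c)) \<and>
     finite (carrier (cgroup c)) \<and>
     faithful_action (cgroup c) (cmodel c) (caction c) \<and>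
     (\<forall>g\<in>carrier (cgroup c). smooth_on (cmodel c) (caction c g) \<and> caction c g 0 = 0) \<and>
     quotient_map (top_of_set (cmodel c)) (subtopology T (cnbhd c)) (cproj c) \<and>
     (\<forall>y\<in>cmodel c. \<forall>z\<in>cmodel c.
        cproj c y = cproj c z \<longleftrightarrow> z \<in> orbit (cgroup c) (caction c) y) \<and>
     cproj c 0 = ccenter c"

definition chart_embeds ::
  "('p, 'e::euclidean_space, 'g) ochart \<Rightarrow> ('p, 'e, 'g) ochart \<Rightarrow> bool" where
  "chart_embeds a c \<longleftrightarrow>
     (\<exists>\<psi> \<theta>. smooth_embedding (cmodel a) (cmodel c) \<psi> \<and>
        \<theta> \<in> hom (cgroup a) (cgroup c) \<and> inj_on \<theta> (carrier (cgroup a)) \<and>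
        (\<forall>g\<in>carrier (cgroup a). \<forall>y\<in>cmodel a. \<psi> (caction a g y) = caction c (\<theta> g) (\<psi> y)) \<and>
        (\<forall>y\<in>cmodel a. cproj c (\<psi> y) = cproj a y))"

record ('p, 'e, 'g) orbifold =
  ospace :: "'p topology"
  oatlas :: "('p, 'e, 'g) ochart set"

definition orbifold_with_boundary ::
  "nat \<Rightarrow> ('p, 'e::euclidean_space, 'g) orbifold \<Rightarrow> bool" where
  "orbifold_with_boundary n X \<longleftrightarrow>
     Hausdorff_space (ospace X) \<and> paracompact_space (ospace X) \<and>
     (\<forall>c\<in>oatlas X. chart_on n (ospace X) c) \<and>
     (\<forall>x U. openin (ospace X) U \<and> x \<in> U \<longrightarrow> (\<exists>c\<in>oatlas X. ccenter c = x \<and> cnbhd c \<subseteq> U)) \<and>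
     (\<forall>a\<in>oatlas X. \<forall>c\<in>oatlas X. cnbhd a \<subseteq> cnbhd c \<longrightarrow> chart_embeds a c)"

text \<open>The atlas is not required to be maximal; an orbifold chart is any chart compatible
  with the atlas. In particular, restrictions of charts to smaller neighbourhoods are allowed.\<close>

definition orbifold_chart ::
  "nat \<Rightarrow> ('p, 'e::euclidean_space, 'g) orbifold \<Rightarrow> ('p, 'e, 'g) ochart \<Rightarrow> bool" where
  "orbifold_chart n X c \<longleftrightarrow>
     chart_on n (ospace X) c \<and>
     (\<forall>a\<in>oatlas X. (cnbhd a \<subseteq> cnbhd c \<longrightarrow> chart_embeds a c) \<and>
                     (cnbhd c \<subseteq> cnbhd a \<longrightarrow> chart_embeds c a))"

definition boundary_points ::
  "nat \<Rightarrow> ('p, 'e::euclidean_space, 'g) orbifold \<Rightarrow> 'p set" where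
  "boundary_points n X = {x. \<exists>c\<in>oatlas X. ccenter c = x \<and> halfspace_model n (cmodel c)}"

text \<open>For a half-space model \<open>{v \<in> S. 0 \<le> b \<bullet> v}\<close>, \<open>rel_frontier\<close> is the bounding hyperplane
  \<open>{v \<in> S. b \<bullet> v = 0}\<close> of \<open>S\<close>.\<close>

definition boundary_chart ::
  "nat \<Rightarrow> ('p, 'e::euclidean_space, 'g) orbifold \<Rightarrow> ('p, 'e, 'g) ochart \<Rightarrow> ('p, 'e, 'g) ochart" where
  "boundary_chart n X c =
     \<lparr>ccenter = ccenter c,
      cnbhd = cnbhd c \<inter> boundary_points n X,
      cmodel = rel_frontier (cmodel c),
      cgroup = cgroup c,
      caction = (\<lambda>g. restrict (caction c g) (rel_frontier (cmodel c))),
      cproj = cproj c\<rparr>"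

definition boundary ::
  "nat \<Rightarrow> ('p, 'e::euclidean_space, 'g) orbifold \<Rightarrow> ('p, 'e, 'g) orbifold" where
  "boundary n X =
     \<lparr>ospace = subtopology (ospace X) (boundary_points n X),
      oatlas = boundary_chart n X ` {c \<in> oatlas X. halfspace_model n (cmodel c)}\<rparr>"

section \<open>The singular set\<close>

definition singular_set :: "('p, 'e, 'g) orbifold \<Rightarrow> 'p set" where
  "singular_set X =
     {x. \<exists>c\<in>oatlas X. ccenter c = x \<and> carrier (cgroup c) \<noteq> {\<one>\<^bsub>cgroup c\<^esub>}}"

text \<open>The dimension of the subspace of \<open>T\<^sub>0 \<tilde>U = span \<tilde>U\<close> fixed by the linearised action of \<open>\<Gamma>\<close>.
  The derivative at 0 within the model is determined on this span, also for a half-space.\<close>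

definition stratum_dim :: "('p, 'e::euclidean_space, 'g) ochart \<Rightarrow> nat" where
  "stratum_dim c =
     dim {v \<in> span (cmodel c). \<forall>g\<in>carrier (cgroup c).
            frechet_derivative (caction c g) (at 0 within cmodel c) v = v}"

definition singular_codim_gt_1 ::
  "nat \<Rightarrow> ('p, 'e::euclidean_space, 'g) orbifold \<Rightarrow> bool" where
  "singular_codim_gt_1 n X \<longleftrightarrow>
     (\<forall>x\<in>singular_set X. \<forall>c\<in>oatlas X. ccenter c = x \<longrightarrow> int (stratum_dim c) < int n - 1)"

section \<open>Complete orbifold maps\<close>

record ('p, 'e, 'g, 'q, 'f, 'h) omap =
  under :: "'p \<Rightarrow> 'q"
  src_chart :: "'p \<Rightarrow> ('p, 'e, 'g) ochart"
  tgt_chart :: "'p \<Rightarrow> ('q, 'f, 'h) ochart"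
  lift_at :: "'p \<Rightarrow> 'e \<Rightarrow> 'f"
  hom_at :: "'p \<Rightarrow> 'g \<Rightarrow> 'h"

definition smooth_complete_map ::
  "nat \<Rightarrow> ('p, 'e::euclidean_space, 'g) orbifold \<Rightarrow> nat \<Rightarrow> ('q, 'f::euclidean_space, 'h) orbifold \<Rightarrow>
   ('p, 'e, 'g, 'q, 'f, 'h) omap \<Rightarrow> bool" where
  "smooth_complete_map n X m P F \<longleftrightarrow>
     continuous_map (ospace X) (ospace P) (under F) \<and>
     (\<forall>x\<in>topspace (ospace X).
        let c = src_chart F x; d = tgt_chart F x; h = lift_at F x; \<Theta> = hom_at F x in
          orbifold_chart n X c \<and> ccenter c = x \<and>
          orbifold_chart m P d \<and> ccenter d = under F x \<and>
          \<Theta> \<in> hom (cgroup c) (cgroup d) \<and>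
          h \<in> cmodel c \<rightarrow> cmodel d \<and> smooth_on (cmodel c) h \<and>
          (\<forall>g\<in>carrier (cgroup c). \<forall>y\<in>cmodel c. h (caction c g y) = caction d (\<Theta> g) (h y)) \<and>
          (\<forall>y\<in>cmodel c. cproj d (h y) = under F (cproj c y)))"

text \<open>Identification of complete orbifold maps: equal underlying maps, equal germs of lifts at 0
  and equal homomorphisms.\<close>

definition same_complete_map ::
  "('p, 'e::euclidean_space, 'g) orbifold \<Rightarrow> ('p, 'e, 'g, 'q, 'f, 'h) omap \<Rightarrow>
   ('p, 'e, 'g, 'q, 'f, 'h) omap \<Rightarrow> bool" where
  "same_complete_map X F G \<longleftrightarrow>
     (\<forall>x\<in>topspace (ospace X).
        under F x = under G x \<and>
        src_chart F x = src_chart G x \<and>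
        (\<forall>\<^sub>F y in nhds 0. y \<in> cmodel (src_chart F x) \<longrightarrow> lift_at F x y = lift_at G x y) \<and>
        (\<forall>g\<in>carrier (cgroup (src_chart F x)). hom_at F x g = hom_at G x g))"

text \<open>The identity complete map expressed in the charts \<open>e x\<close> at the points \<open>x\<close>.\<close>

definition identity_map ::
  "('p \<Rightarrow> ('p, 'e, 'g) ochart) \<Rightarrow> ('p, 'e, 'g, 'p, 'e, 'g) omap" where
  "identity_map e =
     \<lparr>under = (\<lambda>x. x), src_chart = e, tgt_chart = e, lift_at = (\<lambda>x y. y), hom_at = (\<lambda>x g. g)\<rparr>"

definition restrict_to_boundary ::
  "nat \<Rightarrow> ('p, 'e::euclidean_space, 'g) orbifold \<Rightarrow> ('p, 'e, 'g, 'q, 'f, 'h) omap \<Rightarrow>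
   ('p, 'e, 'g, 'q, 'f, 'h) omap" where
  "restrict_to_boundary n X F = F\<lparr>src_chart := (\<lambda>x. boundary_chart n X (src_chart F x))\<rparr>"

definition boundary_is_smooth_retract ::
  "nat \<Rightarrow> ('p, 'e::euclidean_space, 'g) orbifold \<Rightarrow> bool" where
  "boundary_is_smooth_retract n X \<longleftrightarrow>
     (\<exists>F. smooth_complete_map n X (n - 1) (boundary n X) F \<and>
          (\<exists>e. same_complete_map (boundary n X) (restrict_to_boundary n X F) (identity_map e)))"

end

theory Submission
  imports Defs
begin

text \<open>
  Let \<open>f\<close> be a retraction. Since the strata of the singular set have dimension less than \<open>n - 1\<close>, its
  image is a null set in the boundary, so some boundary point \<open>p\<close> has a fibre of regular points; this
  fibre meets the boundary only in \<open>p\<close>. Near \<open>p\<close> choose boundary coordinates \<open>\<phi>\<close> of \<open>f\<close>, and a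
  function \<open>\<rho> \<ge> 0\<close> on \<open>X\<close> that is a finite sum of bump functions supported in charts off the boundary,
  is positive on the fibre except in a small collar at \<open>p\<close>, and increases along the fibre in that
  collar. For small \<open>q\<close> and \<open>t > 0\<close> the system \<open>\<phi> = q\<close>, \<open>\<rho> = t\<close> then has exactly one solution.

  Adding the bumps one at a time, starting from \<open>\<rho> = 0\<close> where there is no solution, shows that for
  almost all \<open>(q, t)\<close> the number of solutions is even: a single bump changes \<open>(\<phi>, \<rho>)\<close> only in a compact
  subset of one chart, where the degree modulo two does not change. Working one chart at a time makes
  orientability irrelevant, and as \<open>(\<phi>, \<rho>)\<close> is a map between spaces of equal dimension, the easy case of
  Sard's theorem suffices.
\<close>

section \<open>Continuously differentiable maps\<close>

text \<open>The bound on the codimension is a matter of dimension: a stratum of dimension less than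
  \<open>n - 1\<close> has null image in the \<open>(n - 1)\<close>-dimensional boundary under any
  Lipschitz map, whereas a reflection hypersurface could cover it.

  The point \<open>p\<close> is not chosen as a regular value, so away from \<open>p\<close> its
  fibre need not be a curve and may be any compact set. The classical count of the endpoints of a
  compact curve is therefore replaced by a count of solutions of \<open>\<phi> = q\<close>,
  \<open>\<rho> = t\<close>. Of the fibre outside the collar only compactness is used:
  \<open>\<rho>\<close> is bounded below there, so a small \<open>t\<close> is met only inside the
  collar, where \<open>\<rho>\<close> is an explicit formula that can be solved for the height above
  the boundary.

  The local invariance of the number of solutions comes from an integral: if a map on an open subset
  of Euclidean space is altered only on a compact set, the integral of its Jacobian determinant over
  that set does not change. Localised near a regular value, this integral becomes a sum of signs.
  All maps are treated as \<open>C1\<close>, so that squares of positive parts can serve as bump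
  functions.\<close>

definition C1_on :: "('a::euclidean_space \<Rightarrow> 'b::euclidean_space) \<Rightarrow> 'a set \<Rightarrow> bool" where
  "C1_on f U \<longleftrightarrow>
     (\<exists>f'. (\<forall>x\<in>U. (f has_derivative blinfun_apply (f' x)) (at x)) \<and> continuous_on U f')"

lemma C1_onI:
  assumes "\<And>x. x \<in> U \<Longrightarrow> (f has_derivative f' x) (at x)"
    and "\<And>i. i \<in> Basis \<Longrightarrow> continuous_on U (\<lambda>x. f' x i)"
  shows "C1_on f U"
proof -
  have b: "blinfun_apply (Blinfun (f' x)) = f' x" if "x \<in> U" for x
    using assms(1)[OF that] by (simp add: bounded_linear_Blinfun_apply has_derivative_bounded_linear)
  have "continuous_on U (\<lambda>x. Blinfun (f' x))"
  proof (rule continuous_on_blinfun_componentwise)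
    fix i :: 'a assume "i \<in> Basis"
    then have "continuous_on U (\<lambda>x. f' x i)" by (rule assms(2))
    then show "continuous_on U (\<lambda>x. blinfun_apply (Blinfun (f' x)) i)"
      using b by (simp cong: continuous_on_cong)
  qed
  then show ?thesis unfolding C1_on_def using assms(1) b by (intro exI[of _ "\<lambda>x. Blinfun (f' x)"]) auto
qed

lemma C1_on_subset: "C1_on f U \<Longrightarrow> V \<subseteq> U \<Longrightarrow> C1_on f V"
  unfolding C1_on_def by (meson continuous_on_subset subsetD)

lemma C1_on_imp_differentiable: "C1_on f U \<Longrightarrow> x \<in> U \<Longrightarrow> f differentiable (at x)"
  unfolding C1_on_def differentiable_def by blast

lemma C1_on_imp_continuous_on: "C1_on f U \<Longrightarrow> continuous_on U f"
  by (meson C1_on_imp_differentiable differentiable_at_imp_differentiable_on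
      differentiable_imp_continuous_on)

lemma C1_on_cong:
  assumes "open U" and "\<And>x. x \<in> U \<Longrightarrow> f x = g x" and "C1_on f U"
  shows "C1_on g U"
proof -
  obtain f' where f': "\<forall>x\<in>U. (f has_derivative blinfun_apply (f' x)) (at x)" "continuous_on U f'"
    using assms(3) unfolding C1_on_def by blast
  have "(g has_derivative blinfun_apply (f' x)) (at x)" if "x \<in> U" for x
    using has_derivative_transform_within_open[of f "f' x" x UNIV U g] f'(1) that assms(1,2) by auto
  with f'(2) show ?thesis unfolding C1_on_def by blast
qed

text \<open>The derivative is unique, so all local derivatives are restrictions of one function, the
  bundled Frechet derivative \<open>F\<close>; continuity of the derivative thus becomes a local
  question.\<close>

lemma C1_on_localI:
  assumes "\<And>x. x \<in> U \<Longrightarrow> \<exists>N. open N \<and> x \<in> N \<and> C1_on f N"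
  shows "C1_on f U"
proof -
  define F where "F x = Blinfun (frechet_derivative f (at x))" for x
  have *: "\<exists>N. open N \<and> x \<in> N \<and> (\<forall>y\<in>N. (f has_derivative blinfun_apply (F y)) (at y)) \<and> continuous_on N F"
    if xU: "x \<in> U" for x
  proof -
    obtain N f' where N: "open N" "x \<in> N" and d: "\<forall>y\<in>N. (f has_derivative blinfun_apply (f' y)) (at y)"
      and c: "continuous_on N f'"
      using assms[OF xU] unfolding C1_on_def by blast
    have "F y = f' y" if "y \<in> N" for y
      unfolding F_def using d that by (metis blinfun_apply_inverse frechet_derivative_at)
    with d c N have "\<forall>y\<in>N. (f has_derivative blinfun_apply (F y)) (at y)" "continuous_on N F"
      by (simp_all cong: continuous_on_cong)
    with N show ?thesis by blast
  qed
  have "continuous (at x) F" if "x \<in> U" for x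
    using *[OF that] continuous_on_eq_continuous_at by blast
  then have "continuous_on U F" by (simp add: continuous_at_imp_continuous_on)
  moreover have "\<forall>x\<in>U. (f has_derivative blinfun_apply (F x)) (at x)" using * by blast
  ultimately show ?thesis unfolding C1_on_def by blast
qed

lemma C1_on_compose:
  assumes "C1_on f U" and "C1_on g V" and "f ` U \<subseteq> V"
  shows "C1_on (\<lambda>x. g (f x)) U"
proof -
  obtain f' where f: "\<forall>x\<in>U. (f has_derivative blinfun_apply (f' x)) (at x)" "continuous_on U f'"
    using assms(1) unfolding C1_on_def by blast
  obtain g' where g: "\<forall>x\<in>V. (g has_derivative blinfun_apply (g' x)) (at x)" "continuous_on V g'"
    using assms(2) unfolding C1_on_def by blast
  have "continuous_on U (\<lambda>x. g' (f x))"
    by (rule continuous_on_compose2[OF g(2) C1_on_imp_continuous_on[OF assms(1)] assms(3)])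
  with f have "continuous_on U (\<lambda>x. g' (f x) o\<^sub>L f' x)"
    by (intro continuous_intros)
  moreover have "((\<lambda>x. g (f x)) has_derivative blinfun_apply (g' (f x) o\<^sub>L f' x)) (at x)"
    if "x \<in> U" for x
  proof -
    have "(f has_derivative blinfun_apply (f' x)) (at x)"
      "(g has_derivative blinfun_apply (g' (f x))) (at (f x))"
      using f(1) g(1) assms(3) that by blast+
    from has_derivative_compose[OF this] show ?thesis by (simp add: blinfun_compose.rep_eq o_def)
  qed
  ultimately show ?thesis
    unfolding C1_on_def by (intro exI[of _ "\<lambda>x. g' (f x) o\<^sub>L f' x"] conjI ballI)
qed

lemma C1_on_bounded_linear: "bounded_linear f \<Longrightarrow> C1_on f U"
  by (rule C1_onI[where f'="\<lambda>_. f"]) (simp_all add: bounded_linear_imp_has_derivative)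

lemma C1_on_linear: "linear f \<Longrightarrow> C1_on f U"
  by (simp add: C1_on_bounded_linear linear_conv_bounded_linear)

lemma C1_on_const: "C1_on (\<lambda>_. c) U"
  by (rule C1_onI[where f'="\<lambda>_ _. 0"]) auto

lemma C1_on_id: "C1_on (\<lambda>x. x) U"
  by (rule C1_on_bounded_linear) (rule bounded_linear_ident)

lemma C1_on_bilinear:
  assumes "bounded_bilinear m" and "C1_on f U" and "C1_on g U"
  shows "C1_on (\<lambda>x. m (f x) (g x)) U"
proof -
  interpret bounded_bilinear m by fact
  obtain f' where f: "\<forall>x\<in>U. (f has_derivative blinfun_apply (f' x)) (at x)" "continuous_on U f'"
    using assms(2) unfolding C1_on_def by blast
  obtain g' where g: "\<forall>x\<in>U. (g has_derivative blinfun_apply (g' x)) (at x)" "continuous_on U g'"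
    using assms(3) unfolding C1_on_def by blast
  show ?thesis
  proof (rule C1_onI)
    show "((\<lambda>x. m (f x) (g x)) has_derivative (\<lambda>h. m (f x) (g' x h) + m (f' x h) (g x))) (at x)"
      if "x \<in> U" for x using f g that by (intro FDERIV) auto
    show "continuous_on U (\<lambda>x. m (f x) (g' x i) + m (f' x i) (g x))" for i
      using f g C1_on_imp_continuous_on[OF assms(2)] C1_on_imp_continuous_on[OF assms(3)]
      by (intro continuous_intros continuous_on)
  qed
qed

lemmas C1_on_scaleR = C1_on_bilinear[OF bounded_bilinear_scaleR]
lemmas C1_on_inner = C1_on_bilinear[OF bounded_bilinear_inner]
lemmas C1_on_mult = C1_on_bilinear[OF bounded_bilinear_mult]

lemma C1_on_add:
  assumes "C1_on f U" and "C1_on g U" shows "C1_on (\<lambda>x. f x + g x) U"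
proof -
  obtain f' where f: "\<forall>x\<in>U. (f has_derivative blinfun_apply (f' x)) (at x)" "continuous_on U f'"
    using assms(1) unfolding C1_on_def by blast
  obtain g' where g: "\<forall>x\<in>U. (g has_derivative blinfun_apply (g' x)) (at x)" "continuous_on U g'"
    using assms(2) unfolding C1_on_def by blast
  show ?thesis
    by (rule C1_onI[where f'="\<lambda>x h. f' x h + g' x h"])
      (use f g in \<open>auto intro!: derivative_intros continuous_intros\<close>)
qed

lemma C1_on_minus: "C1_on f U \<Longrightarrow> C1_on (\<lambda>x. - f x) U"
  by (rule C1_on_compose[of f U uminus UNIV])
    (simp_all add: C1_on_bounded_linear bounded_linear_minus bounded_linear_ident)

lemma C1_on_diff:
  "C1_on f U \<Longrightarrow> C1_on g U \<Longrightarrow> C1_on (\<lambda>x. f x - g x) U"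
  using C1_on_add[of f U "\<lambda>x. - g x"] C1_on_minus[of g U] by simp

lemma C1_on_sum:
  "(\<And>i. i \<in> I \<Longrightarrow> C1_on (f i) U) \<Longrightarrow> C1_on (\<lambda>x. \<Sum>i\<in>I. f i x) U"
  by (induction I rule: infinite_finite_induct) (auto intro: C1_on_const C1_on_add)

lemma C1_on_linear_compose:
  "linear L \<Longrightarrow> C1_on f U \<Longrightarrow> C1_on (\<lambda>x. L (f x)) U"
  by (rule C1_on_compose[where V=UNIV]) (simp_all add: C1_on_linear)

text \<open>The square of the positive part is the simplest \<open>C1\<close> function that vanishes
  exactly on a half-line. It is the profile of all bumps, and on its positive side it has the square
  root as explicit inverse.\<close>

definition ramp_sq :: "real \<Rightarrow> real" where "ramp_sq t = (max 0 t)\<^sup>2"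

lemma ramp_sq_simps [simp]:
  "t \<le> 0 \<Longrightarrow> ramp_sq t = 0" "0 \<le> t \<Longrightarrow> ramp_sq t = t\<^sup>2" "0 \<le> ramp_sq t"
  "0 < ramp_sq t \<longleftrightarrow> 0 < t" "ramp_sq t = 0 \<longleftrightarrow> t \<le> 0"
  by (auto simp: ramp_sq_def max_def)

lemma has_real_derivative_ramp_sq:
  "(ramp_sq has_real_derivative 2 * max 0 t) (at t)"
proof -
  consider "t < 0" | "t = 0" | "t > 0" by linarith
  then show ?thesis
  proof cases
    case 1
    have "((\<lambda>_. 0) has_real_derivative 0) (at t)" by simp
    then have "(ramp_sq has_real_derivative 0) (at t)"
      by (rule has_field_derivative_transform_within_open[of _ _ _ "{..<0}"]) (use 1 in auto)
    with 1 show ?thesis by simp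
  next
    case 2
    have "((\<lambda>h. (ramp_sq (0 + h) - ramp_sq 0) / h) \<longlongrightarrow> 0) (at 0)"
    proof (rule Lim_null_comparison[where g="\<lambda>h. \<bar>h\<bar>"])
      show "\<forall>\<^sub>F h in at 0. norm ((ramp_sq (0 + h) - ramp_sq 0) / h) \<le> \<bar>h\<bar>"
        by (rule always_eventually) (auto simp: ramp_sq_def max_def power2_eq_square)
    qed (auto intro!: tendsto_eq_intros)
    with 2 show ?thesis by (simp add: DERIV_def)
  next
    case 3
    have "((\<lambda>t. t\<^sup>2) has_real_derivative 2 * t) (at t)" by (auto intro!: derivative_eq_intros)
    then have "(ramp_sq has_real_derivative 2 * t) (at t)"
      by (rule has_field_derivative_transform_within_open[of _ _ _ "{0<..}"]) (use 3 in auto)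
    with 3 show ?thesis by simp
  qed
qed

lemma C1_on_ramp_sq: "C1_on ramp_sq U"
  by (rule C1_onI[where f'="\<lambda>t h. 2 * max 0 t * h"])
    (auto intro!: continuous_intros simp: has_real_derivative_ramp_sq[unfolded has_field_derivative_def])

lemma C1_on_ramp_sq_compose: "C1_on f U \<Longrightarrow> C1_on (\<lambda>x. ramp_sq (f x)) U"
  by (rule C1_on_compose[where V=UNIV]) (simp_all add: C1_on_ramp_sq)

text \<open>Mean value inequality for \<open>f\<close> minus its linearisation at \<open>x\<close>,
  whose derivative is small near \<open>x\<close> by continuity of the derivative. This is strict
  differentiability: it compares the values at any two points near \<open>x\<close>, and not just
  with \<open>f x\<close>.\<close>

lemma C1_on_strict:
  assumes f: "C1_on f U" and U: "open U" "x \<in> U"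
  obtains f' where "(f has_derivative f') (at x)"
    and "\<And>e. 0 < e \<Longrightarrow> \<exists>d>0. ball x d \<subseteq> U \<and>
           (\<forall>y\<in>ball x d. \<forall>z\<in>ball x d. norm (f y - f z - f' (y - z)) \<le> e * norm (y - z))"
proof -
  obtain f' where f': "\<And>x. x\<in>U \<Longrightarrow> (f has_derivative blinfun_apply (f' x)) (at x)" "continuous_on U f'"
    using f unfolding C1_on_def by blast
  show ?thesis
  proof (rule that[OF f'(1)[OF U(2)]])
    fix e :: real assume "0 < e"
    obtain d where d: "d > 0" "ball x d \<subseteq> U" using U openE by blast
    have "continuous (at x) f'" using f'(2) U continuous_on_eq_continuous_at by blast
    then obtain d' where d': "d' > 0" "\<And>y. dist y x < d' \<Longrightarrow> dist (f' y) (f' x) < e"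
      using \<open>0 < e\<close> unfolding continuous_at_eps_delta by blast
    define r where "r = min d d'"
    have "norm (f y - f z - blinfun_apply (f' x) (y - z)) \<le> e * norm (y - z)"
      if "y \<in> ball x r" "z \<in> ball x r" for y z
    proof -
      have "norm ((\<lambda>y. f y - blinfun_apply (f' x) y) y - (\<lambda>y. f y - blinfun_apply (f' x) y) z) \<le> e * norm (y - z)"
      proof (rule differentiable_bound[of "ball x r" _ "\<lambda>y. blinfun_apply (f' y - f' x)"])
        show "((\<lambda>y. f y - blinfun_apply (f' x) y) has_derivative blinfun_apply (f' w - f' x)) (at w within ball x r)"
          if "w \<in> ball x r" for w
        proof -
          have "w \<in> U" using that d unfolding r_def by auto
          then have "((\<lambda>y. f y - blinfun_apply (f' x) y) has_derivative (\<lambda>h. blinfun_apply (f' w) h - blinfun_apply (f' x) h)) (at w)"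
            by (intro derivative_intros f'(1)) (auto intro: bounded_linear_imp_has_derivative blinfun.bounded_linear_right)
          moreover have "(\<lambda>h. blinfun_apply (f' w) h - blinfun_apply (f' x) h) = blinfun_apply (f' w - f' x)"
            by (auto simp: blinfun.diff_left)
          ultimately show ?thesis by (simp add: has_derivative_at_withinI)
        qed
        show "onorm (blinfun_apply (f' w - f' x)) \<le> e" if "w \<in> ball x r" for w
          using d'(2)[of w] that unfolding r_def by (auto simp: dist_norm norm_blinfun.rep_eq norm_minus_commute dist_commute)
      qed (use that in auto)
      then show ?thesis by (simp add: blinfun.diff_right algebra_simps)
    qed
    moreover have "0 < r" "ball x r \<subseteq> U" using d d' unfolding r_def by auto
    ultimately show "\<exists>d>0. ball x d \<subseteq> U \<and> (\<forall>y\<in>ball x d. \<forall>z\<in>ball x d.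
      norm (f y - f z - blinfun_apply (f' x) (y - z)) \<le> e * norm (y - z))" by blast
  qed
qed

text \<open>The one-point \<open>C1\<close> version of \<open>smooth_on\<close>. At a frontier point
  of a half-space the values of a map give no two-sided derivative, so the map is handled through a
  local extension, which is not unique.\<close>

definition C1_near :: "'a::euclidean_space set \<Rightarrow> ('a \<Rightarrow> 'b::euclidean_space) \<Rightarrow> 'a \<Rightarrow> bool" where
  "C1_near M f x \<longleftrightarrow> (\<exists>N g. open N \<and> x \<in> N \<and> C1_on g N \<and> (\<forall>y\<in>N \<inter> M. g y = f y))"

lemma C1_nearI: "open N \<Longrightarrow> x \<in> N \<Longrightarrow> C1_on g N \<Longrightarrow> (\<And>y. y \<in> N \<Longrightarrow> y \<in> M \<Longrightarrow> g y = f y) \<Longrightarrow> C1_near M f x"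
  unfolding C1_near_def by blast

lemma C1_near_mono:
  assumes "C1_near M f x" and "open N" and "x \<in> N" and "\<And>y. y \<in> N \<Longrightarrow> y \<in> M' \<Longrightarrow> y \<in> M \<and> f y = g y"
  shows "C1_near M' g x"
proof -
  obtain N' h where "open N'" "x \<in> N'" "C1_on h N'" "\<forall>y\<in>N' \<inter> M. h y = f y"
    using assms(1) unfolding C1_near_def by blast
  then show ?thesis using assms(2-4)
    by (intro C1_nearI[of "N \<inter> N'" x h]) (auto intro: C1_on_subset)
qed

lemma smooth_on_imp_C1_near:
  assumes "smooth_on M f" and "x \<in> M" shows "C1_near M f x"
proof -
  obtain N g where N: "open N" "x \<in> N" "\<forall>k. Ck_on k g N" "\<forall>y\<in>N \<inter> M. g y = f y"
    using assms unfolding smooth_on_def by blast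
  have "Ck_on (Suc 0) g N" using N by blast
  then have "C1_on g N"
    by (intro C1_onI[where f'="\<lambda>x. frechet_derivative g (at x)"]) (auto simp: frechet_derivative_works)
  with N show ?thesis unfolding C1_near_def by blast
qed

lemma C1_near_imp_continuous_on:
  assumes "\<And>x. x \<in> M \<Longrightarrow> C1_near M f x" shows "continuous_on M f"
proof -
  have "continuous (at x within M) f" if x: "x \<in> M" for x
  proof -
    obtain N g where N: "open N" "x \<in> N" "C1_on g N" "\<forall>y\<in>N \<inter> M. g y = f y"
      using assms x unfolding C1_near_def by blast
    have "continuous (at x within M) g"
      using C1_on_imp_continuous_on[OF N(3)] N continuous_on_eq_continuous_at continuous_at_imp_continuous_at_within by blast
    moreover obtain d where "d > 0" "ball x d \<subseteq> N" using N openE by blast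
    ultimately show ?thesis using N x
      by (intro continuous_transform_within[of x M g d f]) (auto simp: dist_commute subset_iff)
  qed
  then show ?thesis by (simp add: continuous_on_eq_continuous_within)
qed

lemma smooth_on_imp_continuous_on: "smooth_on M f \<Longrightarrow> continuous_on M f"
  by (simp add: C1_near_imp_continuous_on smooth_on_imp_C1_near)

lemma C1_near_compose:
  assumes "C1_near M f x" and "C1_near M' g (f x)" and "x \<in> M"
    and "open N" "x \<in> N" "\<And>y. y \<in> N \<Longrightarrow> y \<in> M \<Longrightarrow> f y \<in> M'"
  shows "C1_near M (\<lambda>y. g (f y)) x"
proof -
  obtain A h where A: "open A" "x \<in> A" "C1_on h A" "\<forall>y\<in>A \<inter> M. h y = f y"
    using assms(1) unfolding C1_near_def by blast
  obtain B k where B: "open B" "f x \<in> B" "C1_on k B" "\<forall>y\<in>B \<inter> M'. k y = g y"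
    using assms(2) unfolding C1_near_def by blast
  define V where "V = A \<inter> h -` B \<inter> N"
  have "open V" unfolding V_def
    using A B assms(4) C1_on_imp_continuous_on continuous_open_preimage by blast
  moreover have "x \<in> V" unfolding V_def using A B assms(3,5) by auto
  moreover have "C1_on (\<lambda>y. k (h y)) V"
    by (rule C1_on_compose[OF C1_on_subset[OF A(3)] B(3)]) (auto simp: V_def)
  ultimately show ?thesis
    by (rule C1_nearI) (use A B assms(6) in \<open>auto simp: V_def\<close>)
qed

lemma C1_near_compose_C1:
  assumes "C1_near M f x" and "C1_on g UNIV"
  shows "C1_near M (\<lambda>y. g (f y)) x"
proof -
  obtain A h where A: "open A" "x \<in> A" "C1_on h A" "\<forall>y\<in>A \<inter> M. h y = f y"
    using assms(1) unfolding C1_near_def by blast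
  show ?thesis
    by (rule C1_nearI[OF A(1,2) C1_on_compose[OF A(3) assms(2)]]) (use A in auto)
qed

lemma C1_near_add:
  assumes "C1_near M f x" and "C1_near M g x"
  shows "C1_near M (\<lambda>y. f y + g y) x"
proof -
  obtain A h where A: "open A" "x \<in> A" "C1_on h A" "\<forall>y\<in>A \<inter> M. h y = f y"
    using assms(1) unfolding C1_near_def by blast
  obtain B k where B: "open B" "x \<in> B" "C1_on k B" "\<forall>y\<in>B \<inter> M. k y = g y"
    using assms(2) unfolding C1_near_def by blast
  show ?thesis
    by (rule C1_nearI[of "A \<inter> B" x "\<lambda>y. h y + k y"]) (use A B in \<open>auto intro: C1_on_add C1_on_subset\<close>)
qed

lemma C1_near_const: "C1_near M (\<lambda>_. c) x"
  by (rule C1_nearI[of UNIV _ "\<lambda>_. c"]) (auto simp: C1_on_const)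

lemma C1_near_scaleR_const: "C1_near M f x \<Longrightarrow> C1_near M (\<lambda>y. f y *\<^sub>R c) x"
  by (rule C1_near_compose_C1[where g="\<lambda>r. r *\<^sub>R c"])
    (simp_all add: C1_on_bounded_linear bounded_linear_scaleR_left)

section \<open>Degree modulo two\<close>

text \<open>The sum of the principal \<open>k\<close>-by-\<open>k\<close> minors of
  \<open>A\<close>: \<open>T\<close> is the set of rows taken from \<open>A\<close>, the other rows
  come from the identity. It is written out over permutations so that its continuity in the entries
  is immediate.\<close>

definition minor_coeff :: "real^'n^'n \<Rightarrow> nat \<Rightarrow> real" where
  "minor_coeff A k = (\<Sum>p\<in>{p. p permutes (UNIV::'n set)}. of_int (sign p) *
     (\<Sum>T\<in>{T. T \<in> Pow UNIV \<and> card T = k}. (\<Prod>i\<in>T. A $ i $ p i) * (\<Prod>i\<in>UNIV - T. mat 1 $ i $ p i)))"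

lemma det_one_plus_eq_poly:
  fixes A :: "real^'n^'n"
  shows "det (mat 1 + s *\<^sub>R A) = (\<Sum>k\<le>CARD('n). minor_coeff A k * s ^ k)"
proof -
  let ?P = "{p. p permutes (UNIV::'n set)}"
  let ?f = "\<lambda>p T. (\<Prod>i\<in>T. A $ i $ p i) * (\<Prod>i\<in>UNIV - T. mat 1 $ i $ p i)"
  have prod: "(\<Prod>i\<in>UNIV. (mat 1 + s *\<^sub>R A) $ i $ p i)
      = (\<Sum>k\<le>CARD('n). s ^ k * (\<Sum>T\<in>{T. T \<in> Pow UNIV \<and> card T = k}. ?f p T))" for p
  proof -
    have "(\<Prod>i\<in>UNIV. (mat 1 + s *\<^sub>R A) $ i $ p i) = (\<Prod>i\<in>UNIV. s * A $ i $ p i + mat 1 $ i $ p i)"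
      by (simp add: add.commute)
    also have "\<dots> = (\<Sum>T\<in>Pow UNIV. (\<Prod>i\<in>T. s * A $ i $ p i) * (\<Prod>i\<in>UNIV - T. mat 1 $ i $ p i))"
      by (rule prod_add) simp
    also have "\<dots> = (\<Sum>T\<in>Pow UNIV. s ^ card T * ?f p T)"
      by (simp add: prod.distrib mult.assoc)
    also have "\<dots> = (\<Sum>k\<le>CARD('n). \<Sum>T\<in>{T. T \<in> Pow UNIV \<and> card T = k}. s ^ card T * ?f p T)"
      by (rule sum.group[symmetric]) (auto intro: card_mono)
    also have "\<dots> = (\<Sum>k\<le>CARD('n). s ^ k * (\<Sum>T\<in>{T. T \<in> Pow UNIV \<and> card T = k}. ?f p T))"
      by (simp add: sum_distrib_left)
    finally show ?thesis .
  qed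
  have "det (mat 1 + s *\<^sub>R A) = (\<Sum>p\<in>?P. \<Sum>k\<le>CARD('n). of_int (sign p) *
      (s ^ k * (\<Sum>T\<in>{T. T \<in> Pow UNIV \<and> card T = k}. ?f p T)))"
    unfolding det_def prod by (simp add: sum_distrib_left)
  also have "\<dots> = (\<Sum>k\<le>CARD('n). minor_coeff A k * s ^ k)"
    unfolding minor_coeff_def sum_distrib_right
    by (subst sum.swap) (simp add: mult.commute mult.left_commute)
  finally show ?thesis .
qed

lemma minor_coeff_top: "minor_coeff A CARD('n) = det (A::real^'n^'n)"
proof -
  have "{T. T \<in> Pow (UNIV::'n set) \<and> card T = CARD('n)} = {UNIV}"
    using card_subset_eq[of "UNIV::'n set"] by auto
  then show ?thesis unfolding minor_coeff_def det_def by simp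
qed

lemma continuous_on_matrix_entry:
  fixes f' :: "'a::topological_space \<Rightarrow> (real^'n) \<Rightarrow>\<^sub>L (real^'m)"
  assumes "continuous_on U f'"
  shows "continuous_on U (\<lambda>x. matrix (blinfun_apply (f' x)) $ i $ j)"
  unfolding matrix_def using assms by (auto intro!: continuous_intros)

lemma continuous_on_minor_coeff:
  fixes f' :: "'a::topological_space \<Rightarrow> (real^'n) \<Rightarrow>\<^sub>L (real^'n)"
  assumes "continuous_on U f'"
  shows "continuous_on U (\<lambda>x. minor_coeff (matrix (blinfun_apply (f' x))) k)"
  unfolding minor_coeff_def
  by (intro continuous_intros continuous_on_matrix_entry assms)

lemma continuous_on_det_matrix:
  fixes f' :: "'a::topological_space \<Rightarrow> (real^'n) \<Rightarrow>\<^sub>L (real^'n)"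
  assumes "continuous_on U f'"
  shows "continuous_on U (\<lambda>x. det (matrix (blinfun_apply (f' x))))"
  using continuous_on_minor_coeff[OF assms, of "CARD('n)"] by (simp add: minor_coeff_top)

text \<open>The determinant is \<open>1\<close> at \<open>s = 0\<close> and continuous, so if it
  were not positive it would vanish for some \<open>t\<close> between \<open>0\<close> and
  \<open>s\<close>. A kernel vector then satisfies \<open>v = - t A v\<close>, which contradicts
  \<open>s * K < 1\<close>.\<close>

lemma det_one_plus_pos:
  fixes A :: "real^'n^'n"
  assumes "\<And>v. norm (A *v v) \<le> K * norm v" and "0 \<le> s" and "s * K < 1"
  shows "0 < det (mat 1 + s *\<^sub>R A)"
proof (rule ccontr)
  assume neg: "\<not> 0 < det (mat 1 + s *\<^sub>R A)"
  have K: "0 \<le> K" using assms(1)[of "axis undefined 1"] order_trans[OF norm_ge_zero] by (simp add: norm_axis_1)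
  have "continuous_on {0..s} (\<lambda>t. det (mat 1 + t *\<^sub>R A))"
    unfolding det_one_plus_eq_poly by (intro continuous_intros)
  then have "\<exists>t\<ge>0. t \<le> s \<and> det (mat 1 + t *\<^sub>R A) = 0"
    using neg assms(2) by (intro IVT2') (auto simp: det_I)
  then obtain t where t: "0 \<le> t" "t \<le> s" "det (mat 1 + t *\<^sub>R A) = 0" by blast
  then have "\<not> invertible (mat 1 + t *\<^sub>R A)" by (simp add: invertible_det_nz)
  then obtain v where v: "(mat 1 + t *\<^sub>R A) *v v = 0" "v \<noteq> 0"
    by (meson invertible_left_inverse matrix_left_invertible_ker)
  then have "v = - (t *\<^sub>R (A *v v))"
    by (simp add: matrix_vector_mult_add_rdistrib scaleR_matrix_vector_assoc eq_neg_iff_add_eq_0)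
  then have "norm v = t * norm (A *v v)" using t(1) by (metis abs_of_nonneg norm_minus_cancel norm_scaleR)
  also have "\<dots> \<le> t * (K * norm v)" using assms(1) t(1) by (intro mult_left_mono)
  also have "\<dots> \<le> s * (K * norm v)" using t K by (intro mult_right_mono) auto
  also have "\<dots> < norm v" using assms(3) v(2) by (simp flip: mult.assoc)
  finally show False by simp
qed

lemma absolutely_integrable_on_compact:
  fixes f :: "'a::euclidean_space \<Rightarrow> 'b::euclidean_space"
  assumes "compact S" and "continuous_on S f"
  shows "f absolutely_integrable_on S"
proof -
  have "integrable lborel (\<lambda>x. indicator S x *\<^sub>R f x)"
    by (rule borel_integrable_compact[OF assms])
  then show ?thesis
    unfolding set_integrable_def by (subst integrable_completion) (auto dest: borel_measurable_integrable)
qed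

text \<open>For small \<open>s\<close> the map \<open>id + s g\<close> permutes a large ball, so \<open>\<integral> det (I + s Dg)\<close> does not depend
  on \<open>s\<close>. Being a polynomial in \<open>s\<close>, it has vanishing top coefficient.\<close>

lemma integral_det_compact_support:
  fixes g :: "real^'n::{finite,wellorder} \<Rightarrow> real^'n::_"
  assumes der: "\<And>x. (g has_derivative blinfun_apply (g' x)) (at x)" and cont: "continuous_on UNIV g'"
    and zero: "\<And>x. r \<le> norm x \<Longrightarrow> g x = 0" and "0 < r"
  shows "integral (cball 0 r) (\<lambda>x. det (matrix (blinfun_apply (g' x)))) = 0"
proof -
  define B where "B = cball (0::real^'n::_) r"
  have cB: "compact B" unfolding B_def by simp
  have "bounded (g' ` B)"
    using cB cont by (meson compact_continuous_image compact_imp_bounded continuous_on_subset subset_UNIV)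
  then obtain K0 where K0: "\<And>x. x \<in> B \<Longrightarrow> norm (g' x) \<le> K0" unfolding bounded_iff by blast
  \<comment> \<open>The maximum with \<open>1\<close> keeps \<open>K\<close> positive, so that
    \<open>0 < s < 1/K\<close> is a nonempty range of parameters.\<close>
  define K where "K = max K0 1"
  have K: "norm (g' x) \<le> K" for x
  proof (cases "x \<in> B")
    case False
    have "((\<lambda>_. 0) has_derivative blinfun_apply (g' x)) (at x)"
      by (rule has_derivative_transform_within_open[of g "blinfun_apply (g' x)" x UNIV "- B"])
        (use False cB zero der in \<open>auto simp: B_def compact_imp_closed\<close>)
    then have "blinfun_apply (g' x) = (\<lambda>_. 0)" by (metis has_derivative_const has_derivative_unique)
    then have "g' x = 0" by (auto intro: blinfun_eqI)
    then show ?thesis unfolding K_def by simp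
  qed (use K0 K_def in force)
  have "0 < K" unfolding K_def by simp
  have lip: "norm (g x - g y) \<le> K * norm (x - y)" for x y
    by (rule differentiable_bound[of UNIV g "\<lambda>x. blinfun_apply (g' x)"])
      (use der K in \<open>auto simp: norm_blinfun.rep_eq\<close>)
  define c where "c k = integral B (\<lambda>x. minor_coeff (matrix (blinfun_apply (g' x))) k)" for k
  have vol: "(\<Sum>k\<le>CARD('n). c k * s ^ k) = measure lebesgue B" if s: "0 < s" "s * K < 1" for s
  proof -
    define \<Phi> where "\<Phi> x = x + s *\<^sub>R g x" for x
    have shrink: "norm (s *\<^sub>R g x - s *\<^sub>R g y) < norm (x - y)" if "x \<noteq> y" for x y
    proof -
      have "norm (s *\<^sub>R g x - s *\<^sub>R g y) = s * norm (g x - g y)"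
        using s(1) by (simp flip: scaleR_diff_right)
      also have "\<dots> \<le> s * (K * norm (x - y))" using lip s(1) by (intro mult_left_mono) auto
      also have "\<dots> < norm (x - y)" using s(2) that by (simp flip: mult.assoc)
      finally show ?thesis .
    qed
    have inj: "inj \<Phi>"
    proof (rule injI, rule ccontr)
      fix x y assume "\<Phi> x = \<Phi> y" "x \<noteq> y"
      then have "x - y = s *\<^sub>R g y - s *\<^sub>R g x" unfolding \<Phi>_def by (simp add: algebra_simps)
      then show False using shrink[OF \<open>x \<noteq> y\<close>] by (simp add: norm_minus_commute)
    qed
    have surj: "\<exists>x. \<Phi> x = y" for y
    proof -
      \<comment> \<open>A preimage of \<open>y\<close> is a fixed point of the map sending
        \<open>x\<close> to \<open>y - s g x\<close>, a contraction with factor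
        \<open>s * K\<close>.\<close>
      have "\<exists>!x. y - s *\<^sub>R g x = x"
      proof (rule banach_fix_type[of "s * K"], goal_cases)
        case 3
        have "dist (y - s *\<^sub>R g u) (y - s *\<^sub>R g v) \<le> s * K * dist u v" for u v
        proof -
          have "norm (s *\<^sub>R g v - s *\<^sub>R g u) = s * norm (g v - g u)"
            using s(1) by (simp flip: scaleR_diff_right)
          also have "\<dots> \<le> s * (K * norm (v - u))" using lip s(1) by (intro mult_left_mono) auto
          finally show ?thesis by (simp add: dist_norm norm_minus_commute mult.assoc)
        qed
        then show ?case by blast
      qed (use s \<open>0 < K\<close> in auto)
      then obtain x where "y - s *\<^sub>R g x = x" by blast
      then show ?thesis unfolding \<Phi>_def by (metis diff_add_cancel)
    qed
    have out: "\<Phi> x = x" if "x \<notin> B" for x using zero that unfolding \<Phi>_def B_def by auto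
    \<comment> \<open>\<open>\<Phi>\<close> is a bijection of the whole space and the identity off
      \<open>B\<close>, hence it permutes \<open>B\<close>, and the image of \<open>B\<close> has
      the same volume for each such \<open>s\<close>.\<close>
    have im: "\<Phi> ` B = B"
    proof
      show "\<Phi> ` B \<subseteq> B" using out inj injD by fastforce
      show "B \<subseteq> \<Phi> ` B"
      proof
        fix y assume y: "y \<in> B"
        obtain x where x: "\<Phi> x = y" using surj by blast
        then have "x \<in> B" using out[of x] y by fastforce
        then show "y \<in> \<Phi> ` B" using x by blast
      qed
    qed
    have dPhi: "(\<Phi> has_derivative (\<lambda>h. h + s *\<^sub>R blinfun_apply (g' x) h)) (at x within B)" for x
      unfolding \<Phi>_def by (intro derivative_intros has_derivative_at_withinI[OF der])
    have mat: "matrix (\<lambda>h. h + s *\<^sub>R blinfun_apply (g' x) h) = mat 1 + s *\<^sub>R matrix (blinfun_apply (g' x))" for x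
      by (auto simp: matrix_def mat_def vec_eq_iff axis_def)
    have pos: "0 < det (mat 1 + s *\<^sub>R matrix (blinfun_apply (g' x)))" for x
    proof (rule det_one_plus_pos[where K=K])
      show "norm (matrix (blinfun_apply (g' x)) *v v) \<le> K * norm v" for v
      proof -
        have "norm (blinfun_apply (g' x) v) \<le> norm (g' x) * norm v" by (rule norm_blinfun)
        also have "\<dots> \<le> K * norm v" using K by (intro mult_right_mono) auto
        finally show ?thesis by (simp add: matrix_works bounded_linear.linear[OF blinfun.bounded_linear_right])
      qed
    qed (use s in auto)
    have ci: "(\<lambda>x. minor_coeff (matrix (blinfun_apply (g' x))) k) integrable_on B" for k
      using cont by (intro set_lebesgue_integral_eq_integral(1) absolutely_integrable_on_compact cB
          continuous_on_minor_coeff) (auto intro: continuous_on_subset)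
    have eq: "\<bar>det (matrix (\<lambda>h. h + s *\<^sub>R blinfun_apply (g' x) h))\<bar>
        = (\<Sum>k\<le>CARD('n). minor_coeff (matrix (blinfun_apply (g' x))) k * s ^ k)" for x
      unfolding mat using pos[of x] det_one_plus_eq_poly by (metis abs_of_pos)
    have "measure lebesgue (\<Phi> ` B) = integral B (\<lambda>x. \<bar>det (matrix (\<lambda>h. h + s *\<^sub>R blinfun_apply (g' x) h))\<bar>)"
      by (rule measure_differentiable_image_eq[OF _ dPhi])
        (use cB inj ci in \<open>auto simp: eq inj_on_def lmeasurable_compact fmeasurableD intro!: integrable_sum integrable_on_mult_left\<close>)
    also have "\<dots> = (\<Sum>k\<le>CARD('n). c k * s ^ k)"
      unfolding eq c_def using ci by (subst integral_sum) (auto intro: integrable_on_mult_left)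
    finally show ?thesis unfolding im by simp
  qed
  have "c CARD('n) = 0"
  proof (rule ccontr)
    assume nz: "c CARD('n) \<noteq> 0"
    \<comment> \<open>The volume is moved into the constant coefficient, so that \<open>d\<close> is
      a polynomial vanishing on a whole interval. As \<open>CARD('n)\<close> is not
      \<open>0\<close>, its top coefficient is still that of \<open>c\<close>.\<close>
    define d where "d k = (if k = 0 then c 0 - measure lebesgue B else c k)" for k
    have "d CARD('n) \<noteq> 0" using nz unfolding d_def by simp
    then have "finite {s. (\<Sum>k\<le>CARD('n). d k * s ^ k) = 0}"
      unfolding polyfun_finite_roots by blast
    moreover have "{0<..<1/K} \<subseteq> {s. (\<Sum>k\<le>CARD('n). d k * s ^ k) = 0}"
    proof clarsimp
      fix s assume s: "0 < s" "s < 1 / K"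
      have "(\<Sum>k\<le>CARD('n). d k * s ^ k) = (\<Sum>k\<le>CARD('n). c k * s ^ k) - (\<Sum>k\<le>CARD('n). if k = 0 then measure lebesgue B else 0)"
        unfolding sum_subtractf[symmetric] by (rule sum.cong) (auto simp: d_def algebra_simps)
      also have "\<dots> = 0" using vol[of s] s \<open>0 < K\<close> by (simp add: field_simps)
      finally show "(\<Sum>k\<le>CARD('n). d k * s ^ k) = 0" .
    qed
    ultimately have "finite {0<..<1/K}" using finite_subset by blast
    then show False using \<open>0 < K\<close> by (simp add: infinite_Ioo)
  qed
  then show ?thesis unfolding c_def B_def by (simp add: minor_coeff_top)
qed

lemma compact_finite_ball_cover:
  fixes L :: "'a::euclidean_space set"
  assumes "compact L" "open U" "L \<subseteq> U"
  obtains r D where "\<And>x. x \<in> L \<Longrightarrow> 0 < r x" "\<And>x. x \<in> L \<Longrightarrow> cball x (r x) \<subseteq> U"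
    "D \<subseteq> L" "finite D" "L \<subseteq> (\<Union>x\<in>D. ball x (r x))"
proof -
  have "\<forall>x\<in>L. \<exists>r>0. cball x r \<subseteq> U" using assms(2,3) by (meson open_contains_cball subsetD)
  then obtain r where r: "\<And>x. x \<in> L \<Longrightarrow> 0 < r x" "\<And>x. x \<in> L \<Longrightarrow> cball x (r x) \<subseteq> U" by metis
  have "L \<subseteq> (\<Union>x\<in>L. ball x (r x))" using r by auto
  then obtain D where D: "D \<subseteq> L" "finite D" "L \<subseteq> (\<Union>x\<in>D. ball x (r x))"
    using compactE_image[OF assms(1), of L "\<lambda>x. ball x (r x)"] by auto
  with r show ?thesis by (rule that)
qed

text \<open>A sum \<open>h\<close> of bumps over finitely many balls is positive on \<open>L\<close>
  and zero off their union. Composing it with a profile that is constant beyond a level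
  \<open>\<delta>\<close> makes it equal to \<open>1\<close> on an open neighbourhood of
  \<open>L\<close>, so that cutting off changes no derivative at points of \<open>L\<close>,
  frontier points included.\<close>

lemma compact_C1_cutoff:
  fixes L :: "'a::euclidean_space set"
  assumes "compact L" "open U" "L \<subseteq> U"
  obtains \<eta> :: "'a \<Rightarrow> real" and V K where "C1_on \<eta> UNIV" "open V" "L \<subseteq> V" "\<And>x. x \<in> V \<Longrightarrow> \<eta> x = 1"
    "compact K" "K \<subseteq> U" "\<And>x. x \<notin> K \<Longrightarrow> \<eta> x = 0"
proof (cases "L = {}")
  case True
  then show ?thesis by (intro that[of "\<lambda>_. 0" "{}" "{}"]) (auto simp: C1_on_const)
next
  case False
  obtain r D where r: "\<And>x. x \<in> L \<Longrightarrow> 0 < r x" "\<And>x. x \<in> L \<Longrightarrow> cball x (r x) \<subseteq> U"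
    and D: "D \<subseteq> L" "finite D" "L \<subseteq> (\<Union>x\<in>D. ball x (r x))"
    by (rule compact_finite_ball_cover[OF assms]) (rule that)
  define h where "h y = (\<Sum>x\<in>D. ramp_sq ((r x)\<^sup>2 - (y - x) \<bullet> (y - x)))" for y
  have C1h: "C1_on h S" for S
    unfolding h_def by (intro C1_on_sum C1_on_ramp_sq_compose C1_on_diff C1_on_inner C1_on_const C1_on_id)
  have term_pos: "0 < (r x)\<^sup>2 - (y - x) \<bullet> (y - x) \<longleftrightarrow> y \<in> ball x (r x)" if "x \<in> D" for x y
  proof -
    have "(y - x) \<bullet> (y - x) < (r x)\<^sup>2 \<longleftrightarrow> norm (y - x) < r x"
      unfolding dot_square_norm using r(1)[of x] D(1) that
      by (meson less_imp_le norm_ge_zero power2_less_imp_less power_strict_mono subsetD zero_less_numeral)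
    then show ?thesis by (simp add: dist_norm norm_minus_commute)
  qed
  have hpos: "0 < h y" if yL: "y \<in> L" for y
  proof -
    obtain x where "x \<in> D" "y \<in> ball x (r x)" using yL D(3) by blast
    then show ?thesis unfolding h_def
      by (intro sum_pos2[OF D(2)]) (use term_pos in auto)
  qed
  obtain y0 where y0: "y0 \<in> L" "\<And>y. y \<in> L \<Longrightarrow> h y0 \<le> h y"
    using continuous_attains_inf[OF assms(1) False C1_on_imp_continuous_on[OF C1h]] by blast
  \<comment> \<open>Half of the minimum of \<open>h\<close> on \<open>L\<close>: then
    \<open>L\<close> lies inside the open set where \<open>\<delta> < h\<close>.\<close>
  define \<delta> where "\<delta> = h y0 / 2"
  have \<delta>: "0 < \<delta>" "\<And>y. y \<in> L \<Longrightarrow> \<delta> < h y" using hpos[OF y0(1)] y0(2) unfolding \<delta>_def by force+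
  show ?thesis
  proof (rule that[of "\<lambda>y. 1 - ramp_sq (1 - h y * (1 / \<delta>))" "{y. \<delta> < h y}" "\<Union>x\<in>D. cball x (r x)"])
    show "C1_on (\<lambda>y. 1 - ramp_sq (1 - h y * (1 / \<delta>))) UNIV"
      by (intro C1_on_diff C1_on_const C1_on_ramp_sq_compose C1_on_mult C1h)
    show "open {y. \<delta> < h y}"
      using C1_on_imp_continuous_on[OF C1h[of UNIV]] by (intro open_Collect_less) auto
    show "1 - ramp_sq (1 - h x * (1 / \<delta>)) = 1" if "x \<in> {y. \<delta> < h y}" for x
      using that \<delta>(1) by (simp add: field_simps)
    show "1 - ramp_sq (1 - h x * (1 / \<delta>)) = 0" if "x \<notin> (\<Union>x\<in>D. cball x (r x))" for x
    proof -
      have "h x = 0" unfolding h_def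
      proof (rule sum.neutral, rule ballI)
        fix z assume "z \<in> D"
        then have "x \<notin> ball z (r z)" using that by auto
        then show "ramp_sq ((r z)\<^sup>2 - (x - z) \<bullet> (x - z)) = 0" using term_pos[OF \<open>z \<in> D\<close>, of x] by simp
      qed
      then show ?thesis by simp
    qed
    show "compact (\<Union>x\<in>D. cball x (r x))" using D(2) by (intro compact_UN) auto
    show "(\<Union>x\<in>D. cball x (r x)) \<subseteq> U" using D(1) r(2) by blast
  qed (use \<delta> in auto)
qed

lemma has_derivative_eq_on_open:
  assumes "(f has_derivative f') (at x)" "(g has_derivative g') (at x)" "open N" "x \<in> N"
    and "\<And>y. y \<in> N \<Longrightarrow> f y = g y"
  shows "f' = g'"
  using has_derivative_transform_within_open[of f f' x UNIV N g] assms has_derivative_unique by blast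

text \<open>After multiplication by a cutoff that is \<open>1\<close> near \<open>L\<close>, both
  maps have compact support, and their determinant integrals over a large ball vanish. Off
  \<open>L\<close> the cut maps agree on an open set, so the integrands agree there, and the parts
  over \<open>L\<close> must agree too.\<close>

lemma integral_det_eq:
  fixes G H :: "real^'n::{finite,wellorder} \<Rightarrow> real^'n::_"
  assumes U: "open U" and L: "compact L" "L \<subseteq> U"
    and G: "\<And>x. x \<in> U \<Longrightarrow> (G has_derivative blinfun_apply (G' x)) (at x)" "continuous_on U G'"
    and H: "\<And>x. x \<in> U \<Longrightarrow> (H has_derivative blinfun_apply (H' x)) (at x)" "continuous_on U H'"
    and eq: "\<And>x. x \<in> U \<Longrightarrow> x \<notin> L \<Longrightarrow> G x = H x"
  shows "integral L (\<lambda>x. det (matrix (blinfun_apply (G' x)))) = integral L (\<lambda>x. det (matrix (blinfun_apply (H' x))))"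
proof -
  obtain \<eta> :: "real^'n::_ \<Rightarrow> real" and V K where \<eta>: "C1_on \<eta> UNIV" "open V" "L \<subseteq> V" "\<And>x. x \<in> V \<Longrightarrow> \<eta> x = 1"
    and K: "compact K" "K \<subseteq> U" "\<And>x. x \<notin> K \<Longrightarrow> \<eta> x = 0"
    using compact_C1_cutoff[OF L(1) U L(2)] by metis
  define cut where "cut F x = (if x \<in> U then \<eta> x *\<^sub>R F x else 0)" for F :: "real^'n::_ \<Rightarrow> real^'n::_" and x
  have cut: "C1_on (cut F) UNIV" if F: "C1_on F U" for F
  proof (rule C1_on_localI)
    fix x :: "real^'n::_"
    show "\<exists>N. open N \<and> x \<in> N \<and> C1_on (cut F) N"
    proof (cases "x \<in> U")
      case True
      have "C1_on (cut F) U"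
        by (rule C1_on_cong[OF U _ C1_on_scaleR[OF C1_on_subset[OF \<eta>(1)] F]]) (auto simp: cut_def)
      with True U show ?thesis by blast
    next
      case False
      have "C1_on (cut F) (- K)"
        by (rule C1_on_cong[OF _ _ C1_on_const[of 0]]) (use K in \<open>auto simp: cut_def compact_imp_closed\<close>)
      with False K show ?thesis by (intro exI[of _ "- K"]) (auto simp: compact_imp_closed)
    qed
  qed
  have "C1_on G U" "C1_on H U" using G H unfolding C1_on_def by blast+
  then obtain g h where g: "\<And>x. (cut G has_derivative blinfun_apply (g x)) (at x)" "continuous_on UNIV g"
    and h: "\<And>x. (cut H has_derivative blinfun_apply (h x)) (at x)" "continuous_on UNIV h"
    using cut unfolding C1_on_def by (metis UNIV_I)
  obtain r where r: "0 < r" "K \<subseteq> ball 0 r"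
    using bounded_subset_ballD[OF compact_imp_bounded[OF K(1)]] by blast
  have zero: "cut F x = 0" if "r \<le> norm x" for F x
  proof -
    have "x \<notin> K" using that r(2) by (auto dest: subsetD)
    then show ?thesis by (simp add: cut_def K(3))
  qed
  have LK: "L \<subseteq> cball 0 r"
  proof
    fix x assume "x \<in> L"
    then have "x \<in> K" using \<eta>(3,4) K(3)[of x] by force
    then show "x \<in> cball 0 r" using r by auto
  qed
  let ?d = "\<lambda>A. det (matrix (blinfun_apply A))"
  have I0: "integral (cball 0 r) (\<lambda>x. ?d (g x)) = 0" "integral (cball 0 r) (\<lambda>x. ?d (h x)) = 0"
    using integral_det_compact_support[OF g zero r(1)] integral_det_compact_support[OF h zero r(1)] by auto
  have off: "blinfun_apply (g x) = blinfun_apply (h x)" if "x \<notin> L" for x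
    by (rule has_derivative_eq_on_open[OF g(1) h(1), of "- L"]) (use that L eq in \<open>auto simp: cut_def compact_imp_closed\<close>)
  have on: "blinfun_apply (g x) = blinfun_apply (G' x)" "blinfun_apply (h x) = blinfun_apply (H' x)" if "x \<in> L" for x
    by (rule has_derivative_eq_on_open[OF g(1) G(1), of _ "U \<inter> V"] has_derivative_eq_on_open[OF h(1) H(1), of _ "U \<inter> V"];
        use that L \<eta> U in \<open>auto simp: cut_def\<close>)+
  have int: "(\<lambda>x. ?d (A x)) integrable_on S" if "compact S" "continuous_on S A" for S and A :: "real^'n::_ \<Rightarrow> (real^'n::_) \<Rightarrow>\<^sub>L (real^'n::_)"
    by (intro set_lebesgue_integral_eq_integral(1) absolutely_integrable_on_compact continuous_on_det_matrix that)
  have "integral (cball 0 r) (\<lambda>x. ?d (g x) - ?d (h x))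
      = integral (cball 0 r) (\<lambda>x. if x \<in> L then ?d (G' x) - ?d (H' x) else 0)"
    by (rule integral_cong) (use off on in auto)
  also have "\<dots> = integral L (\<lambda>x. ?d (G' x) - ?d (H' x))"
    using LK by (simp add: Henstock_Kurzweil_Integration.integral_restrict_Int Int_absorb2)
  also have "\<dots> = integral L (\<lambda>x. ?d (G' x)) - integral L (\<lambda>x. ?d (H' x))"
    by (intro Henstock_Kurzweil_Integration.integral_diff int L continuous_on_subset[OF G(2)] continuous_on_subset[OF H(2)])
  finally show ?thesis
    using I0 int[OF compact_cball continuous_on_subset[OF g(2)]] int[OF compact_cball continuous_on_subset[OF h(2)]]
    by (simp add: Henstock_Kurzweil_Integration.integral_diff)
qed

text \<open>Twice the second difference, with step \<open>e\<close>, of the positive part: a hat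
  function supported in \<open>[-e, e]\<close>. \<open>smooth_step\<close> below is a primitive of
  it, constant on either side of that interval.\<close>

definition tent :: "real \<Rightarrow> real \<Rightarrow> real" where
  "tent e t = 2 * max 0 (t + e) - 2 * (2 * max 0 t) + 2 * max 0 (t - e)"

definition smooth_step :: "real \<Rightarrow> real \<Rightarrow> real" where
  "smooth_step e t = ramp_sq (t + e) - 2 * ramp_sq t + ramp_sq (t - e)"

lemma has_real_derivative_smooth_step: "(smooth_step e has_real_derivative tent e t) (at t)"
  unfolding smooth_step_def tent_def
  by (auto intro!: derivative_eq_intros DERIV_chain'[OF _ has_real_derivative_ramp_sq])

lemma tent_pos_iff: "0 < e \<Longrightarrow> 0 < tent e t \<longleftrightarrow> \<bar>t\<bar> < e"
  unfolding tent_def by (auto simp: max_def)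

lemma tent_nonneg: "0 < e \<Longrightarrow> 0 \<le> tent e t"
  unfolding tent_def by (auto simp: max_def)

definition cube_bump :: "real \<Rightarrow> real^'n \<Rightarrow> real^'n \<Rightarrow> real" where
  "cube_bump e q y = (\<Prod>i\<in>UNIV. tent e (y $ i - q $ i))"

text \<open>By design its Jacobian determinant is \<open>cube_bump e q\<close>. So for any
  \<open>G\<close> the product of \<open>cube_bump e q (G x)\<close> with the Jacobian determinant
  of \<open>G\<close> is again a Jacobian determinant, that of \<open>cube_map e q\<close> after
  \<open>G\<close>, and the invariance of determinant integrals applies to it.\<close>

definition cube_map :: "real \<Rightarrow> real^'n \<Rightarrow> real^'n \<Rightarrow> real^'n" where
  "cube_map e q y = (\<chi> i. smooth_step e (y $ i - q $ i))"

definition cube :: "real \<Rightarrow> real^'n \<Rightarrow> (real^'n) set" where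
  "cube e q = cbox (\<chi> i. q $ i - e) (\<chi> i. q $ i + e)"

lemma mem_cube: "y \<in> cube e q \<longleftrightarrow> (\<forall>i. \<bar>y $ i - q $ i\<bar> \<le> e)"
  unfolding cube_def mem_box_cart by (auto simp: abs_le_iff algebra_simps)

lemma cube_bump_eq_0: "0 < e \<Longrightarrow> y \<notin> cube e q \<Longrightarrow> cube_bump e q y = 0"
  unfolding cube_bump_def mem_cube using tent_pos_iff tent_nonneg
  by (force intro: prod_zero simp: not_le le_less)

lemma continuous_on_cube_bump [continuous_intros]:
  "continuous_on S f \<Longrightarrow> continuous_on S (\<lambda>x. cube_bump e q (f x))"
  unfolding cube_bump_def tent_def by (intro continuous_intros) auto

lemma integral_cube_bump_neq_0:
  assumes "0 < e" shows "integral (cube e q) (cube_bump e q) \<noteq> 0"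
proof -
  have "integral (cube e q) (cube_bump e q) = 0 \<longleftrightarrow> (\<forall>x \<in> cube e q. cube_bump e q x = 0)"
    unfolding cube_def
  proof (rule integral_cbox_eq_0_iff)
    show "box (\<chi> i. q $ i - e) (\<chi> i. q $ i + e) \<noteq> {}"
      using assms by (auto simp: interval_ne_empty_cart)
    show "0 \<le> cube_bump e q x" for x unfolding cube_bump_def by (intro prod_nonneg) (auto simp: tent_nonneg assms)
  qed (intro continuous_intros)
  moreover have "0 < cube_bump e q q" unfolding cube_bump_def using assms by (intro prod_pos) (auto simp: tent_pos_iff)
  moreover have "q \<in> cube e q" using assms by (simp add: mem_cube)
  ultimately show ?thesis by force
qed

lemma has_derivative_cube_map:
  assumes "(F has_derivative F') (at x)"
  shows "((\<lambda>x. cube_map e q (F x)) has_derivative (\<lambda>h. \<chi> i. tent e (F x $ i - q $ i) * F' h $ i)) (at x)"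
proof (subst has_derivative_componentwise_within, rule ballI)
  fix b :: "real^'b" assume "b \<in> Basis"
  then obtain i where b: "b = axis i 1" by (auto simp: Basis_vec_def)
  have "((\<lambda>x. F x $ i - q $ i) has_derivative (\<lambda>h. F' h $ i)) (at x)"
    using assms by (auto intro!: derivative_eq_intros has_derivative_bounded_linear bounded_linear.has_derivative[OF bounded_linear_vec_nth])
  then have "((\<lambda>x. smooth_step e (F x $ i - q $ i)) has_derivative (\<lambda>h. tent e (F x $ i - q $ i) * F' h $ i)) (at x)"
    by (rule has_derivative_compose[OF _ has_real_derivative_smooth_step[unfolded has_field_derivative_def]])
  then show "((\<lambda>x. cube_map e q (F x) \<bullet> b) has_derivative (\<lambda>h. (\<chi> i. tent e (F x $ i - q $ i) * F' h $ i) \<bullet> b)) (at x)"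
    by (simp add: b inner_axis cube_map_def)
qed

lemma det_scaled_rows:
  fixes A :: "real^'n \<Rightarrow> real^'n"
  shows "det (matrix (\<lambda>h. \<chi> i. c i * A h $ i)) = (\<Prod>i\<in>UNIV. c i) * det (matrix A)"
proof -
  have "matrix (\<lambda>h. \<chi> i. c i * A h $ i) = (\<chi> i. c i *s (matrix A $ i))"
    by (simp add: matrix_def vec_eq_iff)
  moreover have "matrix A = (\<chi> i. matrix A $ i)" by (simp add: vec_eq_iff)
  ultimately show ?thesis by (metis det_rows_mul)
qed

lemma even_sum_sgn_iff:
  assumes "finite Z" "\<And>x. x \<in> Z \<Longrightarrow> s x = 1 \<or> s x = (-1::int)"
  shows "even (\<Sum>x\<in>Z. s x) \<longleftrightarrow> even (card Z)"
  using assms by (induction Z rule: finite_induct) (auto, force+)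

text \<open>Near a regular value the integral localises to small neighbourhoods of the preimages, each of
  which contributes the sign of its Jacobian.\<close>

lemma integral_det_cube_map:
  fixes G :: "real^'n::{finite,wellorder} \<Rightarrow> real^'n::_"
  assumes U: "open U" and L: "compact L" "L \<subseteq> U"
    and G: "\<And>x. x \<in> U \<Longrightarrow> (G has_derivative blinfun_apply (G' x)) (at x)" "continuous_on U G'"
    and reg: "\<And>x. x \<in> L \<Longrightarrow> G x = q \<Longrightarrow> det (matrix (blinfun_apply (G' x))) \<noteq> 0"
    and fro: "q \<notin> G ` frontier L"
  shows "finite {x\<in>L. G x = q} \<and> (\<exists>k::int. \<exists>e0>0. (even k \<longleftrightarrow> even (card {x\<in>L. G x = q})) \<and>
    (\<forall>e. 0 < e \<and> e < e0 \<longrightarrow> integral L (\<lambda>x. cube_bump e q (G x) * det (matrix (blinfun_apply (G' x))))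
       = of_int k * integral (cube e q) (cube_bump e q)))"
proof -
  define Z where "Z = {x\<in>L. G x = q}"
  define J where "J x = det (matrix (blinfun_apply (G' x)))" for x
  have C1: "C1_on G U" using G unfolding C1_on_def by blast
  note contG = C1_on_imp_continuous_on[OF C1]
  have contJ: "continuous_on U J" unfolding J_def by (rule continuous_on_det_matrix[OF G(2)])
  have ZU: "Z \<subseteq> U" and Zint: "Z \<subseteq> interior L"
    using L fro unfolding Z_def by (auto simp: frontier_def compact_imp_closed)
  \<comment> \<open>The inverse function theorem at a preimage of the regular value, in a form that
    lets the neighbourhood be taken inside any given open set \<open>S\<close>.\<close>
  have local: "\<exists>U' V g. open U' \<and> U' \<subseteq> S \<and> x \<in> U' \<and> open V \<and> q \<in> V \<and> homeomorphism U' V G g"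
    if lx: "x \<in> Z" "open S" "x \<in> S" "S \<subseteq> U" for x S
  proof -
    have "x \<in> U" "x \<in> L" "G x = q" using that ZU unfolding Z_def by auto
    then have "invertible (matrix (blinfun_apply (G' x)))" using reg by (simp add: invertible_det_nz)
    then obtain B where B: "B ** matrix (blinfun_apply (G' x)) = mat 1" by (meson invertible_left_inverse)
    define invf where "invf = Blinfun ((*v) B)"
    have "blinfun_apply invf = (*v) B" unfolding invf_def
      by (simp add: bounded_linear_Blinfun_apply linear_conv_bounded_linear[symmetric])
    then have "invf o\<^sub>L G' x = id_blinfun"
    proof (intro blinfun_eqI)
      fix h
      have "matrix (blinfun_apply (G' x)) *v h = blinfun_apply (G' x) h"
        by (simp add: matrix_works bounded_linear.linear[OF blinfun.bounded_linear_right])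
      then have "B *v (blinfun_apply (G' x) h) = h" by (metis B matrix_vector_mul_assoc matrix_vector_mul_lid)
      with \<open>blinfun_apply invf = (*v) B\<close> show "blinfun_apply (invf o\<^sub>L G' x) h = blinfun_apply id_blinfun h" by simp
    qed
    moreover have "\<And>y. y \<in> S \<Longrightarrow> (G has_derivative blinfun_apply (G' y)) (at y)" "continuous_on S G'"
      using lx(4) G continuous_on_subset by blast+
    ultimately obtain U' V g where "open U'" "U' \<subseteq> S" "x \<in> U'" "open V" "G x \<in> V" "homeomorphism U' V G g"
      using inverse_function_theorem[of S G G' x invf] lx(2,3) by metis
    then show ?thesis using \<open>G x = q\<close> by blast
  qed
  have "\<forall>x\<in>Z. \<exists>U'. open U' \<and> x \<in> U' \<and> U' \<inter> Z = {x}"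
  proof
    fix x assume x: "x \<in> Z"
    obtain U' V g where U': "open U'" "x \<in> U'" "homeomorphism U' V G g"
      using local[OF x U] x ZU by blast
    then have "inj_on G U'" unfolding homeomorphism_def by (metis inj_onI)
    then have "U' \<inter> Z = {x}" using U'(2) x unfolding Z_def inj_on_def by auto
    with U' show "\<exists>U'. open U' \<and> x \<in> U' \<and> U' \<inter> Z = {x}" by blast
  qed
  then obtain W where W: "\<And>x. x \<in> Z \<Longrightarrow> open (W x) \<and> x \<in> W x \<and> W x \<inter> Z = {x}" by metis
  have Z_eq: "Z = L \<inter> G -` {q}" unfolding Z_def by auto
  have "closed (L \<inter> G -` {q})"
    by (rule continuous_closed_preimage[OF continuous_on_subset[OF contG L(2)] compact_imp_closed[OF L(1)]]) simp
  then have "compact (L \<inter> (L \<inter> G -` {q}))" using L(1) by (rule compact_Int_closed[rotated])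
  then have cZ: "compact Z" unfolding Z_eq by simp
  obtain D where D: "D \<subseteq> Z" "finite D" "Z \<subseteq> (\<Union>x\<in>D. W x)"
  proof (rule compactE_image[OF cZ, of Z W])
    show "open (W x)" if "x \<in> Z" for x using W[OF that] by simp
    show "Z \<subseteq> (\<Union>x\<in>Z. W x)" using W by (auto intro!: UN_I)
  qed
  have "Z \<subseteq> D"
  proof
    fix z assume z: "z \<in> Z"
    then obtain x where "x \<in> D" "z \<in> W x" using D(3) by blast
    moreover have "W x \<inter> Z = {x}" using W[OF subsetD[OF D(1) \<open>x \<in> D\<close>]] by simp
    ultimately have "z = x" using z by (metis IntI singletonD)
    then show "z \<in> D" using \<open>x \<in> D\<close> by simp
  qed
  then have finZ: "finite Z" using D(2) finite_subset by blast
  have "\<exists>d>0. \<forall>x\<in>Z. \<forall>y\<in>Z. x \<noteq> y \<longrightarrow> d \<le> dist x y"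
  proof -
    define T where "T = insert 1 ((\<lambda>(x, y). dist x y) ` {p \<in> Z \<times> Z. fst p \<noteq> snd p})"
    have "finite T" unfolding T_def using finZ by auto
    moreover have "Min T \<in> T" using \<open>finite T\<close> by (intro Min_in) (auto simp: T_def)
    then have "0 < Min T" unfolding T_def by auto
    moreover have "Min T \<le> dist x y" if "x \<in> Z" "y \<in> Z" "x \<noteq> y" for x y
      using \<open>finite T\<close> that by (intro Min_le) (auto simp: T_def image_iff intro!: bexI[of _ "(x, y)"])
    ultimately show ?thesis by blast
  qed
  then obtain d where d: "d > 0" "\<And>x y. x \<in> Z \<Longrightarrow> y \<in> Z \<Longrightarrow> x \<noteq> y \<Longrightarrow> d \<le> dist x y" by blast
  define s where "s x = (if 0 < J x then 1 else - 1 :: int)" for x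
  have sJ: "s x = 1 \<or> s x = - 1" for x unfolding s_def by auto
  \<comment> \<open>On each piece the Jacobian keeps the sign \<open>s x\<close>, and balls of
    radius \<open>d/2\<close>, where distinct preimages are at least \<open>d\<close> apart, keep
    the pieces disjoint.\<close>
  define nice where "nice x U' V g \<longleftrightarrow> open U' \<and> U' \<subseteq> interior L \<inter> ball x (d/2) \<inter> {y\<in>U. 0 < of_int (s x) * J y} \<and> x \<in> U' \<and> open V \<and> q \<in> V \<and> homeomorphism U' V G g" for x U' V g
  have "\<forall>x\<in>Z. \<exists>U' V g. nice x U' V g"
  proof
    fix x assume x: "x \<in> Z"
    have "0 < of_int (s x) * J x" using reg[of x] x unfolding s_def Z_def J_def by auto
    moreover have "continuous_on U (\<lambda>y. of_int (s x) * J y)" by (intro continuous_intros contJ)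
    then have "open {y\<in>U. 0 < of_int (s x) * J y}"
      using continuous_open_preimage[of U "\<lambda>y. of_int (s x) * J y" "{0<..}"] U
      by (simp add: vimage_def Int_def)
    ultimately show "\<exists>U' V g. nice x U' V g"
      unfolding nice_def using x Zint ZU d(1) by (intro local) auto
  qed
  then obtain A V g where nice: "\<And>x. x \<in> Z \<Longrightarrow> nice x (A x) (V x) (g x)" by metis
  have A: "open (A x)" "A x \<subseteq> interior L \<inter> ball x (d/2) \<inter> {y\<in>U. 0 < of_int (s x) * J y}" "x \<in> A x"
    and V: "open (V x)" "q \<in> V x" and hom: "homeomorphism (A x) (V x) G (g x)" if "x \<in> Z" for x
    using nice[OF that] unfolding nice_def by simp_all
  \<comment> \<open>The rest of \<open>L\<close> is compact, so its image is closed. Since that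
    image misses \<open>q\<close>, all points of \<open>L\<close> with values close to
    \<open>q\<close> lie in one of the pieces.\<close>
  define R where "R = L - (\<Union>x\<in>Z. A x)"
  have "compact R" unfolding R_def using A(1) L(1) by (intro compact_diff open_UN) auto
  then have "closed (G ` R)" unfolding R_def
    by (meson Diff_subset L(2) compact_continuous_image compact_imp_closed contG continuous_on_subset subset_trans)
  moreover have "q \<notin> G ` R" using A(3) unfolding R_def Z_def by auto
  ultimately have "open ((\<Inter>x\<in>Z. V x) - G ` R)" "q \<in> (\<Inter>x\<in>Z. V x) - G ` R"
    using V finZ by (auto intro!: open_Diff open_INT)
  then obtain \<epsilon> where \<epsilon>: "\<epsilon> > 0" "ball q \<epsilon> \<subseteq> (\<Inter>x\<in>Z. V x) - G ` R" using openE by blast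
  \<comment> \<open>A cube of half-side \<open>e\<close> lies in the closed ball of radius
    \<open>CARD('n) * e\<close> by the \<open>1\<close>-norm bound; the added \<open>1\<close> makes
    the inequality strict.\<close>
  define e0 where "e0 = \<epsilon> / (CARD('n) + 1)"
  have e0: "0 < e0" unfolding e0_def using \<epsilon>(1) by simp
  have cube_sub: "cube e q \<subseteq> ball q \<epsilon>" if "0 < e" "e < e0" for e
  proof
    fix y assume y: "y \<in> cube e q"
    have "norm (y - q) \<le> (\<Sum>i\<in>UNIV. \<bar>(y - q) $ i\<bar>)" by (rule norm_le_l1_cart)
    also have "\<dots> \<le> (\<Sum>i\<in>(UNIV::'n set). e)" using y by (intro sum_mono) (simp add: mem_cube)
    also have "\<dots> = CARD('n) * e" by simp
    also have "\<dots> \<le> CARD('n) * e0" using that by (intro mult_left_mono) auto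
    also have "\<dots> < \<epsilon>" unfolding e0_def using \<epsilon>(1) by (simp add: field_simps)
    finally show "y \<in> ball q \<epsilon>" by (simp add: dist_norm norm_minus_commute)
  qed
  have main: "integral L (\<lambda>x. cube_bump e q (G x) * J x) = of_int (\<Sum>x\<in>Z. s x) * integral (cube e q) (cube_bump e q)"
    if e: "0 < e" "e < e0" for e
  proof -
    define I where "I = integral (cube e q) (cube_bump e q)"
    define B where "B x = g x ` cube e q" for x
    have cV: "cube e q \<subseteq> V x" if "x \<in> Z" for x using cube_sub[OF e] \<epsilon>(2) that by blast
    have cc: "compact (cube e q)" unfolding cube_def by simp
    have BA: "B x \<subseteq> A x" and GB: "G ` B x = cube e q" and cB: "compact (B x)" and injB: "inj_on G (B x)"
      and Bin: "\<And>y. y \<in> A x \<Longrightarrow> G y \<in> cube e q \<Longrightarrow> y \<in> B x" if "x \<in> Z" for x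
    proof -
      have h: "\<And>y. y \<in> A x \<Longrightarrow> g x (G y) = y" "\<And>z. z \<in> V x \<Longrightarrow> G (g x z) = z" "g x ` V x = A x" "continuous_on (V x) (g x)"
        using hom[OF that] unfolding homeomorphism_def by auto
      show BA': "B x \<subseteq> A x" using cV[OF that] h unfolding B_def by blast
      show "G ` B x = cube e q" using cV[OF that] h(2) unfolding B_def image_image
        by (metis (no_types, lifting) image_cong image_ident subsetD)
      show "compact (B x)" unfolding B_def
        using cc cV[OF that] compact_continuous_image continuous_on_subset h(4) by blast
      have "inj_on G (A x)" using h(1) by (rule inj_on_inverseI)
      then show "inj_on G (B x)" using BA' inj_on_subset by blast
      show "y \<in> B x" if "y \<in> A x" "G y \<in> cube e q" for y
        using that h(1) unfolding B_def by (metis image_eqI)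
    qed
    have BL: "B x \<subseteq> L" "B x \<subseteq> U" if "x \<in> Z" for x using BA[OF that] A(2)[OF that] interior_subset by blast+
    have piece: "((\<lambda>y. cube_bump e q (G y) * J y) has_integral (of_int (s x) * I)) (B x)" if x: "x \<in> Z" for x
    proof -
      \<comment> \<open>The change-of-variables theorem concerns vector-valued functions, so the
        real bump is wrapped as a vector with one component.\<close>
      let ?f = "\<lambda>y. vec (cube_bump e q y) :: real^1"
      have "?f absolutely_integrable_on (cube e q)"
        by (intro absolutely_integrable_on_compact cc) (simp add: vec_def, intro continuous_intros)
      then have "?f absolutely_integrable_on (G ` B x) \<and> integral (G ` B x) ?f = vec I"
        unfolding GB[OF x] I_def by (simp add: integral_on_1_eq)
      then have "(\<lambda>y. \<bar>det (matrix (blinfun_apply (G' y)))\<bar> *\<^sub>R ?f (G y)) absolutely_integrable_on B x \<and>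
           integral (B x) (\<lambda>y. \<bar>det (matrix (blinfun_apply (G' y)))\<bar> *\<^sub>R ?f (G y)) = vec I"
        by (subst has_absolute_integral_change_of_variables)
          (use BL[OF x] G(1) cB[OF x] injB[OF x] in \<open>auto intro: has_derivative_at_withinI simp: fmeasurableD lmeasurable_compact\<close>)
      then have 1: "integral (B x) (\<lambda>y. \<bar>J y\<bar> * cube_bump e q (G y)) = I"
        by (simp add: integral_on_1_eq J_def vec_eq_iff)
      have 2: "(\<lambda>y. cube_bump e q (G y) * J y) integrable_on B x"
        using BL[OF x] contJ contG
        by (intro set_lebesgue_integral_eq_integral(1) absolutely_integrable_on_compact cB x continuous_intros)
          (auto intro: continuous_on_subset)
      have "integral (B x) (\<lambda>y. cube_bump e q (G y) * J y) = integral (B x) (\<lambda>y. of_int (s x) * (\<bar>J y\<bar> * cube_bump e q (G y)))"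
      proof (rule integral_cong)
        fix y assume "y \<in> B x"
        then have "0 < of_int (s x) * J y" using BA[OF x] A(2)[OF x] by blast
        then have "of_int (s x) * \<bar>J y\<bar> = J y" using sJ[of x] by auto
        then show "cube_bump e q (G y) * J y = of_int (s x) * (\<bar>J y\<bar> * cube_bump e q (G y))"
          by (metis mult.assoc mult.commute)
      qed
      also have "\<dots> = of_int (s x) * I" using 1 by simp
      finally show ?thesis using 2 by (metis has_integral_integral)
    qed
    have disj: "B x \<inter> B y = {}" if xy: "x \<in> Z" "y \<in> Z" "x \<noteq> y" for x y
    proof (rule ccontr)
      assume "B x \<inter> B y \<noteq> {}"
      then obtain z where "z \<in> ball x (d/2)" "z \<in> ball y (d/2)" using BA[OF xy(1)] BA[OF xy(2)] A(2)[OF xy(1)] A(2)[OF xy(2)] by blast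
      then have "dist x y < d" by (metis dist_commute dist_triangle_half_l mem_ball)
      then show False using d(2)[OF xy] by simp
    qed
    have "((\<lambda>y. cube_bump e q (G y) * J y) has_integral (\<Sum>x\<in>Z. of_int (s x) * I)) (\<Union>x\<in>Z. B x)"
      by (rule has_integral_UN[OF finZ piece]) (auto simp: pairwise_def disj)
    then have "integral (\<Union>x\<in>Z. B x) (\<lambda>y. cube_bump e q (G y) * J y) = of_int (\<Sum>x\<in>Z. s x) * I"
      by (simp add: integral_unique sum_distrib_right)
    moreover have "integral L (\<lambda>y. cube_bump e q (G y) * J y) =
      integral L (\<lambda>y. if y \<in> (\<Union>x\<in>Z. B x) then cube_bump e q (G y) * J y else 0)"
    proof (rule integral_cong)
      fix y assume y: "y \<in> L"
      show "cube_bump e q (G y) * J y = (if y \<in> (\<Union>x\<in>Z. B x) then cube_bump e q (G y) * J y else 0)"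
      proof (cases "G y \<in> cube e q")
        case True
        then have "G y \<notin> G ` R" using cube_sub[OF e] \<epsilon>(2) by blast
        then obtain x where "x \<in> Z" "y \<in> A x" using y unfolding R_def by blast
        then have "y \<in> (\<Union>x\<in>Z. B x)" using Bin True by blast
        then show ?thesis by simp
      qed (simp add: cube_bump_eq_0[OF e(1)])
    qed
    moreover have "(\<Union>x\<in>Z. B x) \<inter> L = (\<Union>x\<in>Z. B x)" using BL by blast
    moreover have "integral L (\<lambda>y. if y \<in> (\<Union>x\<in>Z. B x) then cube_bump e q (G y) * J y else 0)
        = integral ((\<Union>x\<in>Z. B x) \<inter> L) (\<lambda>y. cube_bump e q (G y) * J y)"
      by (rule Henstock_Kurzweil_Integration.integral_restrict_Int)
    ultimately show ?thesis unfolding I_def by (simp only:)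
  qed
  show ?thesis
    unfolding Z_def[symmetric]
  proof (intro conjI exI[of _ "\<Sum>x\<in>Z. s x"] exI[of _ e0])
    show "even (\<Sum>x\<in>Z. s x) = even (card Z)" by (rule even_sum_sgn_iff[OF finZ sJ])
  qed (use finZ e0 main in \<open>auto simp: J_def\<close>)
qed

text \<open>A finite union of closed balls has its frontier in a finite union of spheres. The
  frontier has to be null so that almost every value avoids its image.\<close>

lemma compact_neighbourhood_negligible_frontier:
  fixes L :: "'a::euclidean_space set"
  assumes "compact L" "open U" "L \<subseteq> U"
  obtains L' where "compact L'" "L \<subseteq> L'" "L' \<subseteq> U" "negligible (frontier L')"
proof -
  obtain r D where r: "\<And>x. x \<in> L \<Longrightarrow> 0 < r x" "\<And>x. x \<in> L \<Longrightarrow> cball x (r x) \<subseteq> U"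
    and D: "D \<subseteq> L" "finite D" "L \<subseteq> (\<Union>x\<in>D. ball x (r x))"
    by (rule compact_finite_ball_cover[OF assms]) (rule that)
  have "frontier (\<Union>((\<lambda>x. cball x (r x)) ` D)) \<subseteq> (\<Union>t\<in>(\<lambda>x. cball x (r x)) ` D. frontier t)"
    by (rule frontier_Union_subset) (use D in auto)
  moreover have "negligible (\<Union>t\<in>(\<lambda>x. cball x (r x)) ` D. frontier t)"
    using D(2) by (intro negligible_Union) (auto simp: negligible_sphere)
  ultimately have "negligible (frontier (\<Union>x\<in>D. cball x (r x)))" using negligible_subset by blast
  moreover have "compact (\<Union>x\<in>D. cball x (r x))" using D(2) by (intro compact_UN) auto
  moreover have "L \<subseteq> (\<Union>x\<in>D. cball x (r x))" using D(3) by (meson UN_mono ball_subset_cball order_refl subset_trans)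
  moreover have "(\<Union>x\<in>D. cball x (r x)) \<subseteq> U" using D(1) r(2) by (meson UN_least subsetD)
  ultimately show ?thesis using that by blast
qed

lemma cube_map_compose_derivative:
  fixes G :: "real^'n \<Rightarrow> real^'n"
  assumes G: "\<And>x. x \<in> U \<Longrightarrow> (G has_derivative blinfun_apply (G' x)) (at x)" "continuous_on U G'"
  obtains W' where "\<And>x. x \<in> U \<Longrightarrow> ((\<lambda>x. cube_map e q (G x)) has_derivative blinfun_apply (W' x)) (at x)"
    "continuous_on U W'"
    "\<And>x. x \<in> U \<Longrightarrow> det (matrix (blinfun_apply (W' x))) = cube_bump e q (G x) * det (matrix (blinfun_apply (G' x)))"
proof -
  have C1: "C1_on G U" using G unfolding C1_on_def by blast
  let ?W = "\<lambda>x h. \<chi> i. tent e (G x $ i - q $ i) * blinfun_apply (G' x) h $ i"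
  have d: "((\<lambda>x. cube_map e q (G x)) has_derivative ?W x) (at x)" if "x \<in> U" for x
    by (rule has_derivative_cube_map[OF G(1)[OF that]])
  have "C1_on (\<lambda>x. cube_map e q (G x)) U"
    by (rule C1_onI[OF d]) (use G(2) C1_on_imp_continuous_on[OF C1] in \<open>auto simp: tent_def intro!: continuous_intros\<close>)
  then obtain W' where W': "\<And>x. x \<in> U \<Longrightarrow> ((\<lambda>x. cube_map e q (G x)) has_derivative blinfun_apply (W' x)) (at x)"
    "continuous_on U W'" unfolding C1_on_def by blast
  have "blinfun_apply (W' x) = ?W x" if "x \<in> U" for x
    using W'(1) d that has_derivative_unique by blast
  then show ?thesis
    by (intro that[OF W']) (simp_all add: det_scaled_rows cube_bump_def)
qed

text \<open>For \<open>q\<close> outside the critical values and the images of the frontier of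
  \<open>L'\<close>, both counts are localised by integrals against the same small cube. The
  composites with \<open>cube_map\<close> agree off \<open>L\<close>, so the integrals over
  \<open>L'\<close> agree and the signed counts \<open>k1\<close> and \<open>k2\<close> are equal;
  parity forgets the signs. Solutions in \<open>L' - L\<close> are common to both maps and can be
  removed from both counts.\<close>

lemma degree_parity_vec:
  fixes G H :: "real^'n::{finite,wellorder} \<Rightarrow> real^'n::_"
  assumes U: "open U" and L: "compact L" "L \<subseteq> U" and C1: "C1_on G U" "C1_on H U"
    and eq: "\<And>x. x \<in> U \<Longrightarrow> x \<notin> L \<Longrightarrow> G x = H x"
  shows "\<exists>N. negligible N \<and> (\<forall>q. q \<notin> N \<longrightarrow> finite {x\<in>L. G x = q} \<and> finite {x\<in>L. H x = q} \<and>
           (even (card {x\<in>L. G x = q}) \<longleftrightarrow> even (card {x\<in>L. H x = q})))"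
proof -
  obtain L' where L': "compact L'" "L \<subseteq> L'" "L' \<subseteq> U" "negligible (frontier L')"
    using compact_neighbourhood_negligible_frontier[OF L(1) U L(2)] by metis
  define crit where "crit F = {x\<in>L'. det (matrix (frechet_derivative F (at x))) = 0}" for F :: "real^'n::_ \<Rightarrow> real^'n::_"
  have negF: "negligible (F ` crit F \<union> F ` frontier L')" if F: "C1_on F U" for F
  proof (rule negligible_Un)
    show "negligible (F ` crit F)"
    proof (rule baby_Sard)
      show "(F has_derivative frechet_derivative F (at x)) (at x within crit F)" if "x \<in> crit F" for x
      proof -
        have "x \<in> U" using that L'(3) unfolding crit_def by auto
        then have "(F has_derivative frechet_derivative F (at x)) (at x)"
          using C1_on_imp_differentiable[OF F] frechet_derivative_works by blast
        then show ?thesis by (rule has_derivative_at_withinI)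
      qed
    qed (auto simp: crit_def det_eq_0_rank)
    show "negligible (F ` frontier L')"
    proof (rule negligible_differentiable_image_negligible[OF order_refl L'(4)])
      have "frontier L' \<subseteq> U" using L'(1,3) by (meson compact_imp_closed frontier_subset_closed subset_trans)
      then show "F differentiable_on frontier L'"
        using C1_on_imp_differentiable[OF F] by (meson differentiable_at_imp_differentiable_on subsetD)
    qed
  qed
  define N where "N = (G ` crit G \<union> G ` frontier L') \<union> (H ` crit H \<union> H ` frontier L')"
  have "negligible N" unfolding N_def using negF C1 by (intro negligible_Un) auto
  moreover have "finite {x\<in>L. G x = q} \<and> finite {x\<in>L. H x = q} \<and>
           (even (card {x\<in>L. G x = q}) \<longleftrightarrow> even (card {x\<in>L. H x = q}))" if q: "q \<notin> N" for q
  proof -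
    have loc: "finite {x\<in>L'. F x = q} \<and> (\<exists>k::int. \<exists>e0>0. (even k \<longleftrightarrow> even (card {x\<in>L'. F x = q})) \<and>
      (\<forall>e. 0 < e \<and> e < e0 \<longrightarrow> integral L' (\<lambda>x. cube_bump e q (F x) * det (matrix (blinfun_apply (F' x))))
       = of_int k * integral (cube e q) (cube_bump e q)))"
      if F: "\<And>x. x \<in> U \<Longrightarrow> (F has_derivative blinfun_apply (F' x)) (at x)" "continuous_on U F'"
        and qF: "q \<notin> F ` crit F \<union> F ` frontier L'" for F F'
    proof (rule integral_det_cube_map[OF U L'(1,3) F])
      show "det (matrix (blinfun_apply (F' x))) \<noteq> 0" if x: "x \<in> L'" "F x = q" for x
      proof -
        have "frechet_derivative F (at x) = blinfun_apply (F' x)"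
          using F(1) x L'(3) by (metis frechet_derivative_at subsetD)
        then show ?thesis using qF x unfolding crit_def by auto
      qed
    qed (use qF in auto)
    obtain G' H' where G': "\<And>x. x \<in> U \<Longrightarrow> (G has_derivative blinfun_apply (G' x)) (at x)" "continuous_on U G'"
      and H': "\<And>x. x \<in> U \<Longrightarrow> (H has_derivative blinfun_apply (H' x)) (at x)" "continuous_on U H'"
      using C1 unfolding C1_on_def by blast
    have qG: "q \<notin> G ` crit G \<union> G ` frontier L'" and qH: "q \<notin> H ` crit H \<union> H ` frontier L'"
      using q unfolding N_def by blast+
    obtain k1 e1 where fin1: "finite {x\<in>L'. G x = q}" and k1: "even k1 \<longleftrightarrow> even (card {x\<in>L'. G x = q})" "e1 > 0"
      and I1: "\<And>e. 0 < e \<Longrightarrow> e < e1 \<Longrightarrow> integral L' (\<lambda>x. cube_bump e q (G x) * det (matrix (blinfun_apply (G' x))))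
       = of_int k1 * integral (cube e q) (cube_bump e q)"
      using loc[OF G' qG] by blast
    obtain k2 e2 where fin2: "finite {x\<in>L'. H x = q}" and k2: "even k2 \<longleftrightarrow> even (card {x\<in>L'. H x = q})" "e2 > 0"
      and I2: "\<And>e. 0 < e \<Longrightarrow> e < e2 \<Longrightarrow> integral L' (\<lambda>x. cube_bump e q (H x) * det (matrix (blinfun_apply (H' x))))
       = of_int k2 * integral (cube e q) (cube_bump e q)"
      using loc[OF H' qH] by blast
    define e where "e = min e1 e2 / 2"
    have e: "0 < e" "e < e1" "e < e2" unfolding e_def using k1(2) k2(2) by auto
    obtain A where A: "\<And>x. x \<in> U \<Longrightarrow> ((\<lambda>x. cube_map e q (G x)) has_derivative blinfun_apply (A x)) (at x)" "continuous_on U A"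
      "\<And>x. x \<in> U \<Longrightarrow> det (matrix (blinfun_apply (A x))) = cube_bump e q (G x) * det (matrix (blinfun_apply (G' x)))"
      using cube_map_compose_derivative[OF G', where e=e and q=q] by blast
    obtain B where B: "\<And>x. x \<in> U \<Longrightarrow> ((\<lambda>x. cube_map e q (H x)) has_derivative blinfun_apply (B x)) (at x)" "continuous_on U B"
      "\<And>x. x \<in> U \<Longrightarrow> det (matrix (blinfun_apply (B x))) = cube_bump e q (H x) * det (matrix (blinfun_apply (H' x)))"
      using cube_map_compose_derivative[OF H', where e=e and q=q] by blast
    have "integral L' (\<lambda>x. det (matrix (blinfun_apply (A x)))) = integral L' (\<lambda>x. det (matrix (blinfun_apply (B x))))"
    proof (rule integral_det_eq[OF U L'(1,3) A(1,2) B(1,2)])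
      show "cube_map e q (G x) = cube_map e q (H x)" if "x \<in> U" "x \<notin> L'" for x
        using eq[OF that(1)] that(2) L'(2) by (metis subsetD)
    qed
    moreover have "integral L' (\<lambda>x. det (matrix (blinfun_apply (A x)))) = of_int k1 * integral (cube e q) (cube_bump e q)"
      unfolding I1[OF e(1,2), symmetric] using A(3) L'(3) by (intro integral_cong) auto
    moreover have "integral L' (\<lambda>x. det (matrix (blinfun_apply (B x)))) = of_int k2 * integral (cube e q) (cube_bump e q)"
      unfolding I2[OF e(1,3), symmetric] using B(3) L'(3) by (intro integral_cong) auto
    ultimately have "k1 = k2" using integral_cube_bump_neq_0[OF e(1), of q] by simp
    then have par: "even (card {x\<in>L'. G x = q}) \<longleftrightarrow> even (card {x\<in>L'. H x = q})" using k1(1) k2(1) by simp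
    let ?R = "{x\<in>L' - L. G x = q}"
    have split: "{x\<in>L'. G x = q} = {x\<in>L. G x = q} \<union> ?R" "{x\<in>L'. H x = q} = {x\<in>L. H x = q} \<union> ?R"
      using L'(2,3) eq by auto
    have fin: "finite {x\<in>L. G x = q}" "finite {x\<in>L. H x = q}" "finite ?R"
      using L'(2) by (auto intro: finite_subset[OF _ fin1] finite_subset[OF _ fin2])
    have "card {x\<in>L'. G x = q} = card {x\<in>L. G x = q} + card ?R" "card {x\<in>L'. H x = q} = card {x\<in>L. H x = q} + card ?R"
      unfolding split using fin by (auto intro!: card_Un_disjoint)
    then show ?thesis using par fin by auto
  qed
  ultimately show ?thesis by blast
qed

text \<open>The change-of-variables theorem of the library is stated for vectors with a finite well-ordered
  index type, so a euclidean space gets an index type of its dimension.\<close>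

typedef (overloaded) ('a::euclidean_space) dim_index = "{..<DIM('a)}"
  using DIM_positive by (auto intro: exI[of _ 0])

instantiation dim_index :: (euclidean_space) linorder
begin
definition less_eq_dim_index :: "'a dim_index \<Rightarrow> 'a dim_index \<Rightarrow> bool"
  where "x \<le> y \<longleftrightarrow> Rep_dim_index x \<le> Rep_dim_index y"
definition less_dim_index :: "'a dim_index \<Rightarrow> 'a dim_index \<Rightarrow> bool"
  where "x < y \<longleftrightarrow> Rep_dim_index x < Rep_dim_index y"
instance by standard (auto simp: less_eq_dim_index_def less_dim_index_def Rep_dim_index_inject)
end

instance dim_index :: (euclidean_space) wellorder
proof
  fix P :: "'a dim_index \<Rightarrow> bool" and a
  assume step: "\<And>x. (\<And>y. y < x \<Longrightarrow> P y) \<Longrightarrow> P x"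
  show "P a"
    by (induction a rule: measure_induct_rule[of Rep_dim_index]) (rule step, simp add: less_dim_index_def)
qed

lemma UNIV_dim_index: "(UNIV :: 'a::euclidean_space dim_index set) = Abs_dim_index ` {..<DIM('a)}"
  using type_definition.Abs_image[OF type_definition_dim_index] by blast

instance dim_index :: (euclidean_space) finite
  by standard (simp add: UNIV_dim_index)

lemma card_dim_index: "CARD('a::euclidean_space dim_index) = DIM('a)"
  by (metis card_lessThan type_definition.card type_definition_dim_index)

lemma degree_parity:
  fixes G H :: "'a::euclidean_space \<Rightarrow> 'a"
  assumes U: "open U" and L: "compact L" "L \<subseteq> U" and C1: "C1_on G U" "C1_on H U"
    and eq: "\<And>x. x \<in> U \<Longrightarrow> x \<notin> L \<Longrightarrow> G x = H x"
  shows "\<exists>N. negligible N \<and> (\<forall>q. q \<notin> N \<longrightarrow> finite {x\<in>L. G x = q} \<and> finite {x\<in>L. H x = q} \<and>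
           (even (card {x\<in>L. G x = q}) \<longleftrightarrow> even (card {x\<in>L. H x = q})))"
proof -
  have dim: "DIM(real^'a dim_index) = DIM('a)" by (simp add: card_dim_index)
  obtain f :: "real^'a dim_index \<Rightarrow> 'a" and g where fg: "linear f" "linear g" "\<And>x. g (f x) = x" "\<And>y. f (g y) = y"
    using isomorphisms_UNIV_UNIV[OF dim] by metis
  have contf: "continuous_on S f" and contg: "continuous_on T g" for S T
    using fg by (auto intro: linear_continuous_on simp: linear_conv_bounded_linear)
  define U' where "U' = f -` U"
  have U': "open U'" unfolding U'_def using U contf[of UNIV] by (simp add: open_vimage)
  have L': "compact (g ` L)" "g ` L \<subseteq> U'"
    using L contg[of L] fg(4) unfolding U'_def by (auto intro: compact_continuous_image)
  have C1': "C1_on (\<lambda>x. g (F (f x))) U'" if "C1_on F U" for F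
    by (rule C1_on_linear_compose[OF fg(2)], rule C1_on_compose[OF C1_on_linear[OF fg(1)] that])
      (auto simp: U'_def)
  have eq': "g (G (f x)) = g (H (f x))" if "x \<in> U'" "x \<notin> g ` L" for x
    using eq[of "f x"] that fg(3) unfolding U'_def by (metis image_eqI vimageD)
  obtain N where N: "negligible N" and par: "\<And>q. q \<notin> N \<Longrightarrow> finite {x\<in>g ` L. g (G (f x)) = q} \<and> finite {x\<in>g ` L. g (H (f x)) = q} \<and>
           (even (card {x\<in>g ` L. g (G (f x)) = q}) \<longleftrightarrow> even (card {x\<in>g ` L. g (H (f x)) = q}))"
    using degree_parity_vec[OF U' L' C1'[OF C1(1)] C1'[OF C1(2)] eq'] by blast
  have "negligible (f ` N)"
    by (rule negligible_differentiable_image_negligible[OF _ N])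
      (use dim fg(1) in \<open>auto intro: linear_imp_differentiable_on\<close>)
  moreover have "finite {x\<in>L. G x = q} \<and> finite {x\<in>L. H x = q} \<and>
           (even (card {x\<in>L. G x = q}) \<longleftrightarrow> even (card {x\<in>L. H x = q}))" if "q \<notin> f ` N" for q
  proof -
    have gq: "g q \<notin> N" using that fg(4) by (metis image_eqI)
    have inj: "inj_on g S" for S by (metis fg(4) inj_onI)
    have "g a = g b \<longleftrightarrow> a = b" for a b using fg(4) by metis
    then have "{x\<in>g ` L. g (F (f x)) = g q} = g ` {x\<in>L. F x = q}" for F
      by (auto simp: fg(4))
    then show ?thesis using par[OF gq] inj by (simp add: card_image finite_image_iff)
  qed
  ultimately show ?thesis by blast
qed

section \<open>Null sets in subspaces\<close>

text \<open>The orthogonal projection onto \<open>Q\<close> as a total function on the ambient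
  space. Models are parts of subspaces of one ambient type, and precomposition with
  \<open>oproj\<close> extends maps from them to open sets of that space, where derivatives and
  negligible sets are available.\<close>

definition oproj :: "'a::euclidean_space set \<Rightarrow> 'a \<Rightarrow> 'a" where
  "oproj Q = (SOME P. linear P \<and> (\<forall>u. P u \<in> Q) \<and> (\<forall>u\<in>Q. P u = u) \<and> (\<forall>u. \<forall>q\<in>Q. (u - P u) \<bullet> q = 0))"

lemma oproj_props:
  fixes Q :: "'a::euclidean_space set"
  assumes "subspace Q"
  shows "linear (oproj Q) \<and> (\<forall>u. oproj Q u \<in> Q) \<and> (\<forall>u\<in>Q. oproj Q u = u) \<and>
    (\<forall>u. \<forall>q\<in>Q. (u - oproj Q u) \<bullet> q = 0)"
  unfolding oproj_def
proof (rule someI_ex[where P="\<lambda>P. linear P \<and> (\<forall>u. P u \<in> Q) \<and> (\<forall>u\<in>Q. P u = u) \<and> (\<forall>u. \<forall>q\<in>Q. (u - P u) \<bullet> q = 0)"])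
  obtain B where B: "B \<subseteq> Q" "pairwise orthogonal B" "\<And>x. x \<in> B \<Longrightarrow> norm x = 1" "independent B" "span B = Q"
    using orthonormal_basis_subspace[OF assms] by metis
  have finB: "finite B" using B(4) independent_imp_finite by blast
  define P where "P u = (\<Sum>b\<in>B. (u \<bullet> b) *\<^sub>R b)" for u
  have lin: "linear P" unfolding P_def
    by (intro linearI) (simp_all add: inner_left_distrib scaleR_left_distrib sum.distrib scaleR_sum_right)
  have "P u \<in> Q" for u unfolding P_def using B(1) assms
    by (intro subspace_sum subspace_scale) auto
  moreover have orth: "(u - P u) \<bullet> b = 0" if "b \<in> B" for u b
  proof -
    have "P u \<bullet> b = (\<Sum>c\<in>B. if c = b then u \<bullet> b else 0)" unfolding P_def inner_sum_left
    proof (rule sum.cong)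
      fix c assume "c \<in> B"
      then show "(u \<bullet> c) *\<^sub>R c \<bullet> b = (if c = b then u \<bullet> b else 0)"
        using B(2,3) that by (auto simp: pairwise_def orthogonal_def norm_eq_1)
    qed simp
    then show ?thesis using finB that by (simp add: inner_diff_left)
  qed
  have orthQ: "(u - P u) \<bullet> q = 0" if "q \<in> Q" for u q
  proof -
    have "q \<in> span B" using that B(5) by simp
    then show ?thesis
      by (induction rule: span_induct_alt) (auto simp: inner_right_distrib orth)
  qed
  moreover have "P u = u" if "u \<in> Q" for u
  proof -
    have "u - P u \<in> Q" using that \<open>\<And>u. P u \<in> Q\<close> assms subspace_diff by blast
    then have "(u - P u) \<bullet> (u - P u) = 0" by (rule orthQ)
    then show ?thesis by simp
  qed
  ultimately show "\<exists>P. linear P \<and> (\<forall>u. P u \<in> Q) \<and> (\<forall>u\<in>Q. P u = u) \<and> (\<forall>u. \<forall>q\<in>Q. (u - P u) \<bullet> q = 0)"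
    using lin by blast
qed

context
  fixes Q :: "'a::euclidean_space set"
  assumes Q: "subspace Q"
begin

lemma linear_oproj: "linear (oproj Q)"
  and oproj_in [simp]: "oproj Q u \<in> Q"
  and oproj_id: "u \<in> Q \<Longrightarrow> oproj Q u = u"
  and oproj_orth: "q \<in> Q \<Longrightarrow> (u - oproj Q u) \<bullet> q = 0"
  using oproj_props[OF Q] by blast+

lemma oproj_residual [simp]: "oproj Q (u - oproj Q u) = 0"
  using linear_diff[OF linear_oproj] oproj_id[OF oproj_in] by simp

lemma oproj_add_residual: "x \<in> Q \<Longrightarrow> oproj Q z = 0 \<Longrightarrow> oproj Q (x + z) = x"
  using linear_add[OF linear_oproj] oproj_id by simp

lemma continuous_on_oproj: "continuous_on S (oproj Q)"
  using linear_oproj by (auto intro: linear_continuous_on simp: linear_conv_bounded_linear)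

lemma norm_oproj_le: "norm (oproj Q u) \<le> norm u"
proof -
  have "(norm u)\<^sup>2 = (norm (oproj Q u))\<^sup>2 + (norm (u - oproj Q u))\<^sup>2"
    using norm_add_Pythagorean[of "oproj Q u" "u - oproj Q u"] oproj_orth[OF oproj_in, of u u]
    by (simp add: orthogonal_def inner_commute)
  then have "(norm (oproj Q u))\<^sup>2 \<le> (norm u)\<^sup>2" by simp
  then show ?thesis using power2_le_imp_le norm_ge_zero by blast
qed

end

text \<open>A subset of a subspace \<open>Q\<close> has measure zero in \<open>Q\<close> iff the cylinder of radius 1 over it is
  negligible in the ambient space.\<close>

definition null_in :: "'a::euclidean_space set \<Rightarrow> 'a set \<Rightarrow> bool" where
  "null_in Q B \<longleftrightarrow> negligible {u. oproj Q u \<in> B \<and> norm (u - oproj Q u) < 1}"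

lemma null_in_subset: "null_in Q B \<Longrightarrow> A \<subseteq> B \<Longrightarrow> null_in Q A"
  unfolding null_in_def by (erule negligible_subset) auto

lemma null_in_UN:
  assumes "countable I" "\<And>i. i \<in> I \<Longrightarrow> null_in Q (B i)"
  shows "null_in Q (\<Union>i\<in>I. B i)"
proof -
  have "negligible (\<Union>i\<in>I. {u. oproj Q u \<in> B i \<and> norm (u - oproj Q u) < 1})"
    using assms unfolding null_in_def by (intro negligible_countable_Union) auto
  then show ?thesis unfolding null_in_def by (rule negligible_subset) auto
qed

lemma null_in_Un: "null_in Q A \<Longrightarrow> null_in Q B \<Longrightarrow> null_in Q (A \<union> B)"
  unfolding null_in_def by (drule (1) negligible_Un, erule negligible_subset) auto

text \<open>The ambient ball of radius \<open>min r 1\<close> lies in the cylinder, since both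
  \<open>oproj Q u - x\<close> and \<open>u - oproj Q u\<close> are at most as long as
  \<open>u - x\<close>.\<close>

lemma not_null_in_ball:
  assumes Q: "subspace Q" and x: "x \<in> Q" and "0 < r"
  shows "\<not> null_in Q (Q \<inter> ball x r)"
proof
  assume null: "null_in Q (Q \<inter> ball x r)"
  define s where "s = min r 1"
  have "ball x s \<subseteq> {u. oproj Q u \<in> Q \<inter> ball x r \<and> norm (u - oproj Q u) < 1}"
  proof
    fix u assume u: "u \<in> ball x s"
    have px: "oproj Q (u - x) = oproj Q u - x"
      using linear_diff[OF linear_oproj[OF Q]] oproj_id[OF Q x] by simp
    have "norm (oproj Q u - x) < r"
      using norm_oproj_le[OF Q, of "u - x"] u unfolding px s_def by (simp add: dist_norm norm_minus_commute)
    moreover have "norm (u - oproj Q u) < 1"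
    proof -
      have "(norm (u - x))\<^sup>2 = (norm (oproj Q u - x))\<^sup>2 + (norm (u - oproj Q u))\<^sup>2"
        using norm_add_Pythagorean[of "oproj Q u - x" "u - oproj Q u"] oproj_orth[OF Q, of "oproj Q u - x" u] x
        by (simp add: orthogonal_def inner_commute Q subspace_diff)
      then have "(norm (u - oproj Q u))\<^sup>2 \<le> (norm (u - x))\<^sup>2" by simp
      then have "norm (u - oproj Q u) \<le> norm (u - x)" using power2_le_imp_le norm_ge_zero by blast
      then show ?thesis using u unfolding s_def by (simp add: dist_norm norm_minus_commute)
    qed
    ultimately show "u \<in> {u. oproj Q u \<in> Q \<inter> ball x r \<and> norm (u - oproj Q u) < 1}"
      using Q by (simp add: dist_norm norm_minus_commute)
  qed
  with null have "negligible (ball x s)" unfolding null_in_def using negligible_subset by blast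
  then show False using \<open>0 < r\<close> unfolding s_def by (simp add: open_not_negligible)
qed

text \<open>The estimate makes \<open>f\<close> a Lipschitz function of \<open>w x\<close>, hence of
  a point of a space of dimension less than \<open>dim H\<close>. That space is copied isometrically
  to a proper subspace \<open>T\<close> of \<open>H\<close>. The set of points projecting to
  \<open>T\<close> is negligible, and a Lipschitz map on part of it, acting as the identity in the
  directions orthogonal to \<open>H\<close>, covers the cylinder over the image of
  \<open>f\<close>.\<close>

lemma null_in_Lipschitz_lowdim:
  fixes H :: "'a::euclidean_space set" and f :: "'b::euclidean_space \<Rightarrow> 'a" and w :: "'b \<Rightarrow> 'c::euclidean_space"
  assumes H: "subspace H" and w: "linear w" "dim (range w) < dim H"
    and f: "\<And>x. x \<in> S \<Longrightarrow> f x \<in> H"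
    and lip: "\<And>x y. x \<in> S \<Longrightarrow> y \<in> S \<Longrightarrow> norm (f x - f y) \<le> C * norm (w x - w y)"
  shows "null_in H (f ` S)"
proof -
  have "subspace (range w)" using w(1) linear_subspace_image subspace_UNIV by blast
  obtain T where T: "subspace T" "T \<subseteq> span H" "dim T = dim (range w)"
    using choose_subspace_of_subspace[of "dim (range w)" H] w(2) by auto
  have TH: "T \<subseteq> H" using T(2) H by (simp add: span_eq_iff[THEN iffD2])
  obtain j where j: "linear j" "j ` range w = T" "\<And>x. x \<in> range w \<Longrightarrow> norm (j x) = norm x"
    using isometry_subspaces[OF \<open>subspace (range w)\<close> T(1)] T(3) by metis
  define v where "v x = j (w x)" for x
  have vT: "v x \<in> T" for x using j(2) unfolding v_def by blast
  have normv: "norm (v x - v y) = norm (w x - w y)" for x y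
  proof -
    have "v x - v y = j (w (x - y))" unfolding v_def by (simp add: linear_diff[OF j(1)] linear_diff[OF w(1)])
    then have "norm (v x - v y) = norm (w (x - y))" using j(3)[OF rangeI] by simp
    then show ?thesis by (simp add: linear_diff[OF w(1)])
  qed
  \<comment> \<open>\<open>f\<close> read as a function of \<open>v x\<close>. The choice of
    \<open>x\<close> is immaterial: points with equal \<open>v\<close> have equal \<open>w\<close>,
    hence by \<open>lip\<close> equal values of \<open>f\<close>.\<close>
  define lam where "lam e = f (SOME x. x \<in> S \<and> v x = e)" for e
  have lam: "lam (v x) = f x" if "x \<in> S" for x
  proof -
    have "\<exists>y. y \<in> S \<and> v y = v x" using that by blast
    from someI_ex[OF this] have y: "(SOME y. y \<in> S \<and> v y = v x) \<in> S" "v (SOME y. y \<in> S \<and> v y = v x) = v x" by auto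
    have "norm (f (SOME y. y \<in> S \<and> v y = v x) - f x) \<le> C * norm (w (SOME y. y \<in> S \<and> v y = v x) - w x)"
      using lip[OF y(1) that] .
    also have "\<dots> = 0" using normv[of "SOME y. y \<in> S \<and> v y = v x" x] y(2) by simp
    finally show ?thesis unfolding lam_def by simp
  qed
  define E where "E = {u. oproj H u \<in> v ` S}"
  have "{u. oproj H u \<in> T} \<noteq> UNIV"
  proof
    assume U: "{u. oproj H u \<in> T} = UNIV"
    have "H \<subseteq> T"
    proof
      fix h assume "h \<in> H"
      have "oproj H h \<in> T" using U by blast
      then show "h \<in> T" using oproj_id[OF H \<open>h \<in> H\<close>] by simp
    qed
    then have "dim H \<le> dim T" by (rule dim_subset)
    then show False using T(3) w(2) by simp
  qed
  moreover have sub: "subspace {u. oproj H u \<in> T}"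
    using linear_subspace_vimage[OF linear_oproj[OF H] T(1)] by (simp add: vimage_def)
  ultimately have "dim {u. oproj H u \<in> T} < DIM('a)"
    using dim_eq_full[of "{u. oproj H u \<in> T}"] dim_subset_UNIV[of "{u. oproj H u \<in> T}"]
    by (metis le_neq_implies_less span_eq_iff)
  then have "negligible {u. oproj H u \<in> T}" by (rule negligible_lowdim)
  then have negE: "negligible E" unfolding E_def using vT by (elim negligible_subset) auto
  define L where "L u = lam (oproj H u) + (u - oproj H u)" for u
  have "negligible (L ` E)"
  proof (rule negligible_locally_Lipschitz_image[OF order_refl negE])
    fix u assume u: "u \<in> E"
    have "norm (L u' - L u) \<le> (\<bar>C\<bar> + 2) * norm (u' - u)" if u': "u' \<in> E" for u'
    proof -
      obtain x x' where x: "x \<in> S" "oproj H u = v x" "x' \<in> S" "oproj H u' = v x'"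
        using u u' unfolding E_def by blast
      have p: "norm (oproj H u' - oproj H u) \<le> norm (u' - u)"
        using norm_oproj_le[OF H, of "u' - u"] by (simp add: linear_diff[OF linear_oproj[OF H]])
      have "norm (f x' - f x) \<le> C * norm (w x' - w x)" using lip x by blast
      also have "\<dots> = C * norm (oproj H u' - oproj H u)" using x normv by simp
      also have "\<dots> \<le> \<bar>C\<bar> * norm (u' - u)" using p by (intro mult_mono) auto
      finally have 1: "norm (f x' - f x) \<le> \<bar>C\<bar> * norm (u' - u)" .
      have eqL: "L u' - L u = (f x' - f x) + ((u' - u) - (oproj H u' - oproj H u))"
        unfolding L_def using x lam by simp
      have "norm (L u' - L u) \<le> norm (f x' - f x) + (norm (u' - u) + norm (oproj H u' - oproj H u))"
        unfolding eqL using norm_triangle_ineq[of "f x' - f x" "(u' - u) - (oproj H u' - oproj H u)"]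
          norm_triangle_ineq4[of "u' - u" "oproj H u' - oproj H u"] by linarith
      then show ?thesis using 1 p by (simp add: algebra_simps)
    qed
    then show "\<exists>T B. open T \<and> u \<in> T \<and> (\<forall>y\<in>E \<inter> T. norm (L y - L u) \<le> B * norm (y - u))"
      by (intro exI[of _ UNIV]) auto
  qed
  moreover have "{u. oproj H u \<in> f ` S \<and> norm (u - oproj H u) < 1} \<subseteq> L ` E"
  proof clarify
    fix u x assume u: "oproj H u = f x" "x \<in> S"
    define z where "z = v x + (u - oproj H u)"
    have "v x \<in> H" using vT TH by blast
    then have z: "oproj H z = v x" unfolding z_def by (intro oproj_add_residual[OF H]) (simp_all add: H)
    have "L z = f x + (z - v x)" unfolding L_def using z lam u(2) by simp
    also have "\<dots> = u" unfolding z_def using u(1) by simp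
    finally have "L z = u" .
    moreover have "z \<in> E" unfolding E_def using z u(2) by simp
    ultimately show "u \<in> L ` E" by blast
  qed
  ultimately show ?thesis unfolding null_in_def using negligible_subset by blast
qed

lemma C1_on_oproj_compose:
  fixes Q :: "'a::euclidean_space set" and g :: "'a \<Rightarrow> 'b::euclidean_space"
  assumes Q: "subspace Q" and U: "open U" "\<And>u. u \<in> U \<Longrightarrow> oproj Q u \<in> D"
    and g: "\<And>x. x \<in> D \<Longrightarrow> C1_near D g x"
  shows "C1_on (\<lambda>u. g (oproj Q u)) U"
proof (rule C1_on_localI)
  fix u assume u: "u \<in> U"
  obtain N k where N: "open N" "oproj Q u \<in> N" "C1_on k N" "\<And>y. y \<in> N \<inter> D \<Longrightarrow> k y = g y"
    using g[OF U(2)[OF u]] unfolding C1_near_def by blast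
  define V where "V = oproj Q -` N \<inter> U"
  have "open V" unfolding V_def using N(1) U(1) continuous_on_oproj[OF Q, of UNIV] by (simp add: open_Int open_vimage)
  moreover have "C1_on (\<lambda>u. g (oproj Q u)) V"
  proof (rule C1_on_cong[OF \<open>open V\<close>])
    show "C1_on (\<lambda>u. k (oproj Q u)) V"
      by (rule C1_on_compose[OF C1_on_linear[OF linear_oproj[OF Q]] N(3)]) (auto simp: V_def)
    show "k (oproj Q x) = g (oproj Q x)" if "x \<in> V" for x
      using that N(4) U(2) unfolding V_def by blast
  qed
  ultimately show "\<exists>N. open N \<and> u \<in> N \<and> C1_on (\<lambda>u. g (oproj Q u)) N"
    using u N(2) unfolding V_def by blast
qed

text \<open>The maps \<open>g\<close> and \<open>h\<close> are extended to the ambient space by the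
  identity in the directions orthogonal to \<open>Q\<close>. Plain product extensions would differ
  on an unbounded set, so \<open>H\<close> interpolates from \<open>h\<close> back to
  \<open>g\<close> as the residual \<open>u - oproj Q u\<close> grows.\<close>

lemma degree_parity_subspace:
  fixes Q :: "'a::euclidean_space set" and g h :: "'a \<Rightarrow> 'a"
  assumes Q: "subspace Q" and D: "openin (top_of_set Q) D" and L: "compact L" "L \<subseteq> D"
    and C1: "\<And>x. x \<in> D \<Longrightarrow> C1_near D g x" "\<And>x. x \<in> D \<Longrightarrow> C1_near D h x"
    and inQ: "\<And>x. x \<in> D \<Longrightarrow> g x \<in> Q" "\<And>x. x \<in> D \<Longrightarrow> h x \<in> Q"
    and eq: "\<And>x. x \<in> D \<Longrightarrow> x \<notin> L \<Longrightarrow> g x = h x"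
  shows "\<exists>B. null_in Q B \<and> (\<forall>q. q \<in> Q \<longrightarrow> q \<notin> B \<longrightarrow> finite {x\<in>L. g x = q} \<and> finite {x\<in>L. h x = q} \<and>
           (even (card {x\<in>L. g x = q}) \<longleftrightarrow> even (card {x\<in>L. h x = q})))"
proof -
  let ?P = "oproj Q"
  note lin = linear_oproj[OF Q]
  define U where "U = {u. ?P u \<in> D}"
  obtain O' where O': "open O'" "D = Q \<inter> O'" using D by (auto simp: openin_open)
  have "U = ?P -` O'" unfolding U_def O'(2) using Q by auto
  then have oU: "open U" using O'(1) continuous_on_oproj[OF Q, of UNIV] by (simp add: open_vimage)
  have gU: "C1_on (\<lambda>u. g (?P u)) U" "C1_on (\<lambda>u. h (?P u)) U"
    by (rule C1_on_oproj_compose[OF Q oU, where D=D]; use C1 in \<open>simp add: U_def\<close>)+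
  have resU: "C1_on (\<lambda>u. u - ?P u) S" for S by (intro C1_on_diff C1_on_id C1_on_linear lin)
  \<comment> \<open>Equal to \<open>1\<close> for \<open>norm z \<le> 1\<close>, the radius of the
    cylinder in \<open>null_in\<close>, and to \<open>0\<close> as soon as
    \<open>z \<bullet> z \<ge> 2\<close>, in particular for \<open>norm z > 2\<close>.\<close>
  define \<kappa> where "\<kappa> z = ramp_sq (1 - ramp_sq (z \<bullet> z - 1))" for z :: 'a
  define G where "G u = g (?P u) + (u - ?P u)" for u
  define H where "H u = g (?P u) + \<kappa> (u - ?P u) *\<^sub>R (h (?P u) - g (?P u)) + (u - ?P u)" for u
  have CG: "C1_on G U" unfolding G_def by (intro C1_on_add gU resU)
  have CH: "C1_on H U" unfolding H_def \<kappa>_def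
    by (intro C1_on_add C1_on_scaleR C1_on_diff C1_on_ramp_sq_compose C1_on_inner gU resU C1_on_const C1_on_id C1_on_linear lin)
  define L' where "L' = {u. ?P u \<in> L \<and> norm (u - ?P u) \<le> 2}"
  have "closed L'"
  proof -
    have "L' = ?P -` L \<inter> {u. norm (u - ?P u) \<le> 2}" unfolding L'_def by auto
    moreover have "closed (?P -` L)" using L(1) continuous_on_oproj[OF Q, of UNIV] by (intro closed_vimage compact_imp_closed)
    moreover have "closed {u. norm (u - ?P u) \<le> 2}"
      by (intro closed_Collect_le continuous_intros continuous_on_oproj[OF Q])
    ultimately show ?thesis by auto
  qed
  moreover have "bounded L'"
  proof -
    obtain b where b: "\<And>x. x \<in> L \<Longrightarrow> norm x \<le> b" 
      using compact_imp_bounded[OF L(1)] unfolding bounded_iff by blast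
    have "norm u \<le> b + 2" if "u \<in> L'" for u
    proof -
      have "norm u \<le> norm (?P u) + norm (u - ?P u)" using norm_triangle_ineq[of "?P u" "u - ?P u"] by simp
      then show ?thesis using that b[of "?P u"] unfolding L'_def by auto
    qed
    then show ?thesis unfolding bounded_iff by blast
  qed
  ultimately have cL': "compact L'" by (simp add: compact_eq_bounded_closed)
  have L'U: "L' \<subseteq> U" unfolding L'_def U_def using L(2) by auto
  have GH: "G u = H u" if "u \<in> U" "u \<notin> L'" for u
  proof (cases "?P u \<in> L")
    case False
    then show ?thesis using eq[of "?P u"] that unfolding G_def H_def U_def by simp
  next
    case True
    then have n: "2 < norm (u - ?P u)" using that unfolding L'_def by simp
    have "2 * 2 \<le> norm (u - ?P u) * norm (u - ?P u)" using n by (intro mult_mono) auto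
    then have "4 \<le> (u - ?P u) \<bullet> (u - ?P u)" by (simp add: dot_square_norm power2_eq_square)
    then have "1 \<le> ((u - ?P u) \<bullet> (u - ?P u) - 1)\<^sup>2" using power_mono[of 1 "(u - ?P u) \<bullet> (u - ?P u) - 1" 2] by simp
    then have "\<kappa> (u - ?P u) = 0" unfolding \<kappa>_def using \<open>4 \<le> _\<close> by simp
    then show ?thesis unfolding G_def H_def by simp
  qed
  obtain N where N: "negligible N" and par: "\<And>q. q \<notin> N \<Longrightarrow> finite {x\<in>L'. G x = q} \<and> finite {x\<in>L'. H x = q} \<and>
           (even (card {x\<in>L'. G x = q}) \<longleftrightarrow> even (card {x\<in>L'. H x = q}))"
    using degree_parity[OF oU cL' L'U CG CH GH] by blast
  \<comment> \<open>The cylinder of radius \<open>1\<close> over \<open>B\<close> lies in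
    \<open>N\<close>. A value \<open>q\<close> outside \<open>B\<close> has a short orthogonal
    displacement \<open>z\<close> with \<open>q + z\<close> outside \<open>N\<close>, and
    \<open>q + z\<close> is the value to which the ambient parity is applied.\<close>
  define B where "B = {q. \<forall>z. ?P z = 0 \<and> norm z < 1 \<longrightarrow> q + z \<in> N}"
  have "null_in Q B" unfolding null_in_def
  proof (rule negligible_subset[OF N], clarify)
    fix u assume u: "?P u \<in> B" "norm (u - ?P u) < 1"
    then have "?P u + (u - ?P u) \<in> N" unfolding B_def using oproj_residual[OF Q, of u] by blast
    then show "u \<in> N" by simp
  qed
  moreover have "finite {x\<in>L. g x = q} \<and> finite {x\<in>L. h x = q} \<and>
           (even (card {x\<in>L. g x = q}) \<longleftrightarrow> even (card {x\<in>L. h x = q}))" if q: "q \<in> Q" "q \<notin> B" for q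
  proof -
    obtain z where z: "?P z = 0" "norm z < 1" "q + z \<notin> N" using q unfolding B_def by blast
    have k1: "\<kappa> z = 1"
    proof -
      have "z \<bullet> z \<le> 1" using z(2) by (simp add: dot_square_norm power_le_one)
      then show ?thesis unfolding \<kappa>_def by simp
    qed
    have PG: "?P (G u) = g (?P u)" "?P (H u) = g (?P u) + \<kappa> (u - ?P u) *\<^sub>R (h (?P u) - g (?P u))" if "u \<in> L'" for u
    proof -
      have "?P u \<in> D" using that L(2) unfolding L'_def by auto
      then have "g (?P u) \<in> Q" "h (?P u) \<in> Q" using inQ by auto
      then have "g (?P u) + \<kappa> (u - ?P u) *\<^sub>R (h (?P u) - g (?P u)) \<in> Q"
        using Q by (intro subspace_add subspace_scale subspace_diff)
      then show "?P (G u) = g (?P u)" "?P (H u) = g (?P u) + \<kappa> (u - ?P u) *\<^sub>R (h (?P u) - g (?P u))"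
        unfolding G_def H_def using \<open>g (?P u) \<in> Q\<close> oproj_add_residual[OF Q] oproj_residual[OF Q] by simp_all
    qed
    have Pqz: "?P (q + z) = q" using oproj_add_residual[OF Q q(1) z(1)] .
    have shift: "x + z \<in> L'" "?P (x + z) = x" if "x \<in> L" for x
    proof -
      have "x \<in> Q" using that L(2) D openin_imp_subset by blast
      then show "?P (x + z) = x" using oproj_add_residual[OF Q _ z(1)] by blast
      then show "x + z \<in> L'" unfolding L'_def using that z(2) by simp
    qed
    \<comment> \<open>Applying \<open>oproj Q\<close> to \<open>G u = q + z\<close> shows that the
      residual of \<open>u\<close> is \<open>z\<close>, so the solutions are the translates by
      \<open>z\<close> of those in \<open>Q\<close>. The same holds for \<open>H\<close>, where
      moreover \<open>\<kappa>\<close> is \<open>1\<close> at this residual.\<close>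
    have 1: "{u\<in>L'. G u = q + z} = (\<lambda>x. x + z) ` {x\<in>L. g x = q}"
    proof (intro equalityI subsetI)
      fix u assume u: "u \<in> {u\<in>L'. G u = q + z}"
      then have g: "g (?P u) = q" using PG(1)[of u] Pqz by simp
      then have "u - ?P u = z" using u unfolding G_def by simp
      then show "u \<in> (\<lambda>x. x + z) ` {x\<in>L. g x = q}"
        using u g by (intro image_eqI[of _ _ "?P u"]) (auto simp: L'_def algebra_simps)
    qed (use shift in \<open>auto simp: G_def\<close>)
    have 2: "{u\<in>L'. H u = q + z} = (\<lambda>x. x + z) ` {x\<in>L. h x = q}"
    proof (intro equalityI subsetI)
      fix u assume u: "u \<in> {u\<in>L'. H u = q + z}"
      then have g: "g (?P u) + \<kappa> (u - ?P u) *\<^sub>R (h (?P u) - g (?P u)) = q" using PG(2)[of u] Pqz by simp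
      then have z': "u - ?P u = z" using u unfolding H_def by simp
      then have "h (?P u) = q" using g k1 by simp
      then show "u \<in> (\<lambda>x. x + z) ` {x\<in>L. h x = q}"
        using u z' by (intro image_eqI[of _ _ "?P u"]) (auto simp: L'_def algebra_simps)
    qed (use shift k1 in \<open>auto simp: H_def\<close>)
    have inj: "inj_on (\<lambda>x. x + z) S" for S by (simp add: inj_on_def)
    show ?thesis using par[OF z(3)] unfolding 1 2 by (simp add: card_image inj finite_image_iff)
  qed
  ultimately show ?thesis by blast
qed

section \<open>Charts, boundary points and lifts of the retraction\<close>

definition chart_model :: "nat \<Rightarrow> 'e::euclidean_space set \<Rightarrow> bool" where
  "chart_model n M \<longleftrightarrow> euclidean_model n M \<or> halfspace_model n M"

section \<open>Linear structure and relative interior of the models\<close>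

lemma euclidean_model_span: "euclidean_model n M \<Longrightarrow> span M = M"
  unfolding euclidean_model_def by (simp add: span_eq_iff)

lemma halfspace_model_span:
  assumes "halfspace_model n M"
  obtains b where "b \<in> span M" "norm b = 1" "M = {v \<in> span M. 0 \<le> b \<bullet> v}" "dim (span M) = n"
proof -
  obtain S b where S: "subspace S" "dim S = n" "b \<in> S" "b \<noteq> 0" "M = {v \<in> S. 0 \<le> b \<bullet> v}"
    using assms unfolding halfspace_model_def by blast
  have "S \<subseteq> span M"
  proof
    fix v assume v: "v \<in> S"
    \<comment> \<open>Chosen so that both \<open>v + t b\<close> and \<open>t b\<close> lie in the
      half-space, which exhibits \<open>v\<close> as a difference of two elements of
      \<open>M\<close>.\<close>
    define t where "t = \<bar>b \<bullet> v\<bar> / (b \<bullet> b)"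
    have t: "0 \<le> t" "t * (b \<bullet> b) = \<bar>b \<bullet> v\<bar>" unfolding t_def using S(4) by auto
    have "v + t *\<^sub>R b \<in> M" "t *\<^sub>R b \<in> M"
      unfolding S(5) using S(1,3) v t by (auto simp: subspace_add subspace_scale inner_add_right)
    then have "(v + t *\<^sub>R b) - t *\<^sub>R b \<in> span M" by (intro span_diff span_base)
    then show "v \<in> span M" by simp
  qed
  moreover have "span M \<subseteq> S" using S(1,5) by (intro span_minimal) auto
  ultimately have sp: "span M = S" by blast
  define b' where "b' = b /\<^sub>R norm b"
  have "0 < inverse (norm b)" using S(4) by simp
  then have "0 \<le> b \<bullet> v \<longleftrightarrow> 0 \<le> b' \<bullet> v" for v unfolding b'_def by (simp add: zero_le_mult_iff)
  then have "M = {v \<in> S. 0 \<le> b' \<bullet> v}" unfolding S(5) by blast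
  then have "M = {v \<in> span M. 0 \<le> b' \<bullet> v}" unfolding sp .
  moreover have "b' \<in> span M" "norm b' = 1" unfolding sp b'_def using S by (simp_all add: subspace_scale)
  moreover have "dim (span M) = n" unfolding sp by (rule S(2))
  ultimately show ?thesis using that by blast
qed

lemma chart_model_basic:
  assumes "chart_model n M"
  shows chart_model_zero: "0 \<in> M" and chart_model_closed: "closed M" and chart_model_dim: "dim (span M) = n"
    and chart_model_cone: "x \<in> M \<Longrightarrow> y \<in> M \<Longrightarrow> 0 \<le> s \<Longrightarrow> x + s *\<^sub>R y \<in> M"
    and chart_model_affine: "affine hull M = span M"
proof -
  have "0 \<in> M \<and> closed M \<and> dim (span M) = n \<and> (\<forall>x y s. x \<in> M \<longrightarrow> y \<in> M \<longrightarrow> 0 \<le> s \<longrightarrow> x + s *\<^sub>R y \<in> M)"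
  proof (cases "euclidean_model n M")
    case True
    then show ?thesis
      by (auto simp: euclidean_model_span closed_subspace euclidean_model_def subspace_0 subspace_add subspace_scale)
  next
    case False
    then obtain b where b: "b \<in> span M" "norm b = 1" "M = {v \<in> span M. 0 \<le> b \<bullet> v}" "dim (span M) = n"
      using assms halfspace_model_span unfolding chart_model_def by blast
    have "0 \<in> M" using b(3) span_0[of M] by (metis (mono_tags) inner_zero_right mem_Collect_eq order_refl)
    moreover have "closed (span M \<inter> {v. 0 \<le> b \<bullet> v})"
      by (intro closed_Int closed_span closed_Collect_le continuous_intros)
    then have "closed M" using b(3) by (simp add: Collect_conj_eq)
    moreover have "x + s *\<^sub>R y \<in> M" if "x \<in> M" "y \<in> M" "0 \<le> s" for x y s
    proof -
      have "x \<in> span M" "y \<in> span M" "0 \<le> b \<bullet> x" "0 \<le> b \<bullet> y" using that b(3) by auto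
      then have "x + s *\<^sub>R y \<in> {v \<in> span M. 0 \<le> b \<bullet> v}"
        using that(3) by (simp add: span_add span_scale inner_add_right)
      then show ?thesis using b(3) by simp
    qed
    ultimately show ?thesis using b(4) by blast
  qed
  then show "0 \<in> M" "closed M" "dim (span M) = n" "x \<in> M \<Longrightarrow> y \<in> M \<Longrightarrow> 0 \<le> s \<Longrightarrow> x + s *\<^sub>R y \<in> M"
    by auto
  then show "affine hull M = span M" by (simp add: affine_hull_span_0 hull_inc)
qed

lemma rel_interior_model:
  assumes "chart_model n M"
  shows "rel_interior M = {x. \<exists>T. openin (top_of_set (span M)) T \<and> x \<in> T \<and> T \<subseteq> M}"
  unfolding rel_interior_def chart_model_affine[OF assms] ..

lemma openin_rel_interior_model: "chart_model n M \<Longrightarrow> openin (top_of_set (span M)) (rel_interior M)"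
  using openin_rel_interior[of M] by (simp add: chart_model_affine)

lemma rel_frontier_model: "chart_model n M \<Longrightarrow> rel_frontier M = M - rel_interior M"
  unfolding rel_frontier_def by (simp add: chart_model_closed)

lemma rel_interior_euclidean: "euclidean_model n M \<Longrightarrow> rel_interior M = M"
  unfolding euclidean_model_def by (simp add: rel_interior_affine subspace_imp_affine)

lemma halfspace_model_structure:
  assumes "halfspace_model n M"
  obtains b where "b \<in> span M" "norm b = 1" "M = {v \<in> span M. 0 \<le> b \<bullet> v}" "dim (span M) = n"
    "rel_interior M = {v \<in> span M. 0 < b \<bullet> v}" "rel_frontier M = {v \<in> span M. b \<bullet> v = 0}"
    "subspace (rel_frontier M)" "dim (rel_frontier M) = n - 1" "0 < n"
proof -
  have model: "chart_model n M" using assms unfolding chart_model_def by simp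
  obtain b where b: "b \<in> span M" "norm b = 1" and M: "M = {v \<in> span M. 0 \<le> b \<bullet> v}" and dim: "dim (span M) = n"
    using halfspace_model_span[OF assms] by blast
  have memM: "v \<in> M \<longleftrightarrow> v \<in> span M \<and> 0 \<le> b \<bullet> v" for v using M by auto
  have bb: "b \<bullet> b = 1" using b(2) by (simp add: dot_square_norm)
  have int: "rel_interior M = {v \<in> span M. 0 < b \<bullet> v}"
  proof (intro equalityI subsetI)
    fix v assume "v \<in> rel_interior M"
    then obtain T where T: "openin (top_of_set (span M)) T" "v \<in> T" "T \<subseteq> M"
      unfolding rel_interior_model[OF model] by blast
    obtain e where e: "0 < e" "ball v e \<inter> span M \<subseteq> T" 
    proof -
      have "\<forall>x\<in>T. \<exists>e. 0 < e \<and> ball x e \<inter> span M \<subseteq> T" using T(1) unfolding openin_contains_ball by simp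
      then show ?thesis using that T(2) by blast
    qed
    have v: "v \<in> span M" "0 \<le> b \<bullet> v" using T memM by auto
    have "v - (e/2) *\<^sub>R b \<in> ball v e \<inter> span M"
      using e(1) b v by (auto simp: dist_norm span_diff span_scale)
    then have "0 \<le> b \<bullet> (v - (e/2) *\<^sub>R b)" using e(2) T(3) memM by blast
    then show "v \<in> {v \<in> span M. 0 < b \<bullet> v}" using e(1) v bb by (simp add: inner_diff_right)
  next
    fix v assume v: "v \<in> {v \<in> span M. 0 < b \<bullet> v}"
    have "open {v. 0 < b \<bullet> v}" by (intro open_Collect_less continuous_intros)
    then have "openin (top_of_set (span M)) (span M \<inter> {v. 0 < b \<bullet> v})" by (rule openin_open_Int)
    moreover have "span M \<inter> {v. 0 < b \<bullet> v} \<subseteq> M"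
    proof
      fix w assume "w \<in> span M \<inter> {v. 0 < b \<bullet> v}"
      then show "w \<in> M" using memM[of w] by simp
    qed
    ultimately show "v \<in> rel_interior M" unfolding rel_interior_model[OF model] using v by blast
  qed
  have fro: "rel_frontier M = {v \<in> span M. b \<bullet> v = 0}"
    unfolding rel_frontier_model[OF model] int
  proof (rule Set.set_eqI)
    fix w show "w \<in> M - {v \<in> span M. 0 < b \<bullet> v} \<longleftrightarrow> w \<in> {v \<in> span M. b \<bullet> v = 0}"
      using memM[of w] by auto
  qed
  have sub: "subspace (rel_frontier M)"
    unfolding fro by (auto simp: subspace_def span_add span_scale span_0 inner_add_right)
  have "dim {y \<in> span M. \<forall>x\<in>span {b}. orthogonal x y} + dim (span {b}) = dim (span M)"
    using b(1) by (intro dim_subspace_orthogonal_to_vectors) (auto simp: span_minimal)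
  moreover have "{y \<in> span M. \<forall>x\<in>span {b}. orthogonal x y} = rel_frontier M"
  proof -
    have "(\<forall>x\<in>span {b}. orthogonal x y) \<longleftrightarrow> b \<bullet> y = 0" for y
      by (auto simp: orthogonal_def span_singleton inner_commute)
    then show ?thesis unfolding fro by simp
  qed
  moreover have "dim (span {b}) = 1" using b(2) by (auto simp: dim_span dim_singleton)
  ultimately have "dim (rel_frontier M) + 1 = n" using dim by simp
  then have "dim (rel_frontier M) = n - 1" "0 < n" by auto
  with b M dim int fro sub show ?thesis using that by blast
qed

lemma zero_rel_frontier_halfspace: "halfspace_model n M \<Longrightarrow> 0 \<in> rel_frontier M"
  by (metis halfspace_model_structure subspace_0)

lemma euclidean_iff_zero_rel_interior:
  assumes "chart_model n M"
  shows "euclidean_model n M \<longleftrightarrow> 0 \<in> rel_interior M"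
    and "halfspace_model n M \<longleftrightarrow> 0 \<notin> rel_interior M"
  using assms zero_rel_frontier_halfspace[of n M] rel_frontier_model[OF assms]
    rel_interior_euclidean[of n M] chart_model_zero[OF assms] unfolding chart_model_def by auto

text \<open>Invariance of domain: an injective continuous image of an open subset of an
  \<open>n\<close>-dimensional space is open in \<open>span M\<close>. This is what separates
  boundary points from interior ones.\<close>

lemma injective_image_subset_rel_interior:
  fixes f :: "'e::euclidean_space \<Rightarrow> 'f::euclidean_space"
  assumes M: "chart_model n M" and S: "subspace S" "dim S = n" and N: "openin (top_of_set S) N"
    and f: "continuous_on N f" "inj_on f N" "f ` N \<subseteq> M"
  shows "f ` N \<subseteq> rel_interior M"
proof -
  have "openin (top_of_set (span M)) (f ` N)"
    by (rule invariance_of_domain_subspaces[OF N S(1) _ _ f(1) _ f(2)])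
      (use f(3) S(2) chart_model_dim[OF M] in \<open>auto intro: span_base\<close>)
  then show ?thesis unfolding rel_interior_model[OF M] using f(3) by blast
qed

text \<open>Invariance of domain in both directions: for \<open>\<psi>\<close> on the interior of
  \<open>M\<close>, and for its inverse on the part of the image inside the interior of
  \<open>M'\<close>, which is open in \<open>span M'\<close> because the image is relatively
  open.\<close>

lemma smooth_embedding_rel_interior_iff:
  assumes e: "smooth_embedding M M' \<psi>" and M: "chart_model n M" and M': "chart_model n M'" and y: "y \<in> M"
  shows "\<psi> y \<in> rel_interior M' \<longleftrightarrow> y \<in> rel_interior M"
proof
  assume "y \<in> rel_interior M"
  moreover have "continuous_on (rel_interior M) \<psi>" "inj_on \<psi> (rel_interior M)" "\<psi> ` rel_interior M \<subseteq> M'"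
    using e rel_interior_subset[of M] unfolding smooth_embedding_def
    by (auto intro: continuous_on_subset[OF smooth_on_imp_continuous_on] inj_on_subset)
  then have "\<psi> ` rel_interior M \<subseteq> rel_interior M'"
    using injective_image_subset_rel_interior[OF M' subspace_span chart_model_dim[OF M] openin_rel_interior_model[OF M]] by blast
  ultimately show "\<psi> y \<in> rel_interior M'" by blast
next
  assume psi: "\<psi> y \<in> rel_interior M'"
  let ?N = "\<psi> ` M \<inter> rel_interior M'"
  obtain T where T: "open T" "\<psi> ` M = M' \<inter> T" using e unfolding smooth_embedding_def openin_open by auto
  have "?N = rel_interior M' \<inter> T" using T(2) rel_interior_subset[of M'] by auto
  then have "openin (top_of_set (span M')) ?N"
    using openin_rel_interior_model[OF M'] T(1) by (simp add: openin_Int_open)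
  moreover have "continuous_on ?N (inv_into M \<psi>)" "inj_on (inv_into M \<psi>) ?N" "inv_into M \<psi> ` ?N \<subseteq> M"
    using e unfolding smooth_embedding_def
    by (auto intro: continuous_on_subset[OF smooth_on_imp_continuous_on] inj_on_inv_into inv_into_into)
  ultimately have "inv_into M \<psi> ` ?N \<subseteq> rel_interior M"
    by (intro injective_image_subset_rel_interior[OF M subspace_span chart_model_dim[OF M']])
  moreover have "inv_into M \<psi> (\<psi> y) = y" using e y unfolding smooth_embedding_def by auto
  ultimately show "y \<in> rel_interior M" using psi y by (metis IntI image_eqI image_subset_iff)
qed

lemma C1_near_eventually_in_open:
  assumes "C1_near M f x" "x \<in> M" "open S" "f x \<in> S"
  shows "\<exists>N. open N \<and> x \<in> N \<and> (\<forall>y\<in>N \<inter> M. f y \<in> S)"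
proof -
  obtain A h where A: "open A" "x \<in> A" "C1_on h A" "\<forall>y\<in>A \<inter> M. h y = f y"
    using assms(1) unfolding C1_near_def by blast
  have "open (A \<inter> h -` S)"
    using continuous_open_preimage[OF C1_on_imp_continuous_on[OF A(3)] A(1) assms(3)] .
  then show ?thesis using A assms(2,4) by (intro exI[of _ "A \<inter> h -` S"]) auto
qed

section \<open>The group action and the projection of a single chart\<close>

lemma chart_onD:
  assumes "chart_on n T c"
  shows "openin T (cnbhd c)" "ccenter c \<in> cnbhd c" "chart_model n (cmodel c)"
    "finite (carrier (cgroup c))" "group_action (cgroup c) (cmodel c) (caction c)"
    "\<And>g. g \<in> carrier (cgroup c) \<Longrightarrow> smooth_on (cmodel c) (caction c g)"
    "\<And>g. g \<in> carrier (cgroup c) \<Longrightarrow> caction c g 0 = 0"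
    "quotient_map (top_of_set (cmodel c)) (subtopology T (cnbhd c)) (cproj c)"
    "\<And>y z. y \<in> cmodel c \<Longrightarrow> z \<in> cmodel c \<Longrightarrow>
        cproj c y = cproj c z \<longleftrightarrow> (\<exists>g\<in>carrier (cgroup c). z = caction c g y)"
    "cproj c 0 = ccenter c"
  using assms unfolding chart_on_def chart_model_def orbit_def faithful_action_def by auto

lemma chart_group: "chart_on n T c \<Longrightarrow> group (cgroup c)"
  using chart_onD(5) group_action.group_hom group_hom.axioms(1) by blast

lemma chart_action_closed:
  "chart_on n T c \<Longrightarrow> g \<in> carrier (cgroup c) \<Longrightarrow> y \<in> cmodel c \<Longrightarrow> caction c g y \<in> cmodel c"
  using chart_onD(5) group_action.element_image by fastforce

lemma chart_action_inverse:
  assumes "chart_on n T c" "g \<in> carrier (cgroup c)" "y \<in> cmodel c"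
  shows "caction c (inv\<^bsub>cgroup c\<^esub> g) (caction c g y) = y"
  using group_action.orbit_sym_aux[OF chart_onD(5)[OF assms(1)] assms(2,3) refl] .

lemma chart_action_one:
  assumes "chart_on n T c" "y \<in> cmodel c"
  shows "caction c \<one>\<^bsub>cgroup c\<^esub> y = y"
  using group_action.id_eq_one[OF chart_onD(5)[OF assms(1)]] assms(2) by (metis restrict_apply')

lemma chart_inv_closed:
  "chart_on n T c \<Longrightarrow> g \<in> carrier (cgroup c) \<Longrightarrow> inv\<^bsub>cgroup c\<^esub> g \<in> carrier (cgroup c)"
  by (rule group.inv_closed[OF chart_group])

lemma chart_action_inverse':
  assumes "chart_on n T c" "g \<in> carrier (cgroup c)" "y \<in> cmodel c"
  shows "caction c g (caction c (inv\<^bsub>cgroup c\<^esub> g) y) = y"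
  using chart_action_inverse[OF assms(1) chart_inv_closed[OF assms(1,2)] assms(3)]
  by (simp add: group.inv_inv[OF chart_group[OF assms(1)] assms(2)])

lemma chart_image:
  assumes "chart_on n T c"
  shows "cproj c ` cmodel c = cnbhd c" and "continuous_map (top_of_set (cmodel c)) T (cproj c)"
proof -
  have "cnbhd c \<subseteq> topspace T" using chart_onD(1)[OF assms] openin_subset by blast
  then show "cproj c ` cmodel c = cnbhd c"
    using quotient_imp_surjective_map[OF chart_onD(8)[OF assms]] by (simp add: Int_absorb1)
  show "continuous_map (top_of_set (cmodel c)) T (cproj c)"
    using quotient_imp_continuous_map[OF chart_onD(8)[OF assms]] continuous_map_into_fulltopology by blast
qed

text \<open>The saturation of \<open>V\<close> is a union of its preimages under group elements,
  hence open, so its image under the quotient map is open.\<close>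

lemma chart_open_map:
  assumes c: "chart_on n T c" and V: "openin (top_of_set (cmodel c)) V"
  shows "openin T (cproj c ` V)"
proof -
  let ?M = "cmodel c" and ?G = "carrier (cgroup c)"
  have VM: "V \<subseteq> ?M" using V openin_imp_subset by blast
  have sub: "cproj c ` V \<subseteq> cnbhd c" using VM chart_image(1)[OF c] by blast
  have eq: "{x \<in> ?M. cproj c x \<in> cproj c ` V} = (\<Union>g\<in>?G. ?M \<inter> caction c g -` V)"
  proof (intro equalityI subsetI)
    fix x assume "x \<in> {x \<in> ?M. cproj c x \<in> cproj c ` V}"
    then obtain v where v: "x \<in> ?M" "v \<in> V" "cproj c x = cproj c v" by auto
    then obtain g where "g \<in> ?G" "v = caction c g x"
      using chart_onD(9)[OF c v(1) subsetD[OF VM v(2)]] by blast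
    then show "x \<in> (\<Union>g\<in>?G. ?M \<inter> caction c g -` V)" using v by blast
  next
    fix x assume "x \<in> (\<Union>g\<in>?G. ?M \<inter> caction c g -` V)"
    then obtain g where g: "g \<in> ?G" "x \<in> ?M" "caction c g x \<in> V" by blast
    then have "cproj c x = cproj c (caction c g x)" using chart_onD(9)[OF c, of x "caction c g x"] VM by blast
    then show "x \<in> {x \<in> ?M. cproj c x \<in> cproj c ` V}" using g by auto
  qed
  have "openin (top_of_set ?M) (?M \<inter> caction c g -` V)" if "g \<in> ?G" for g
    by (rule continuous_openin_preimage[OF smooth_on_imp_continuous_on[OF chart_onD(6)[OF c that]] _ V])
      (use chart_action_closed[OF c that] in auto)
  then have "openin (top_of_set ?M) {x \<in> ?M. cproj c x \<in> cproj c ` V}"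
    unfolding eq by (intro openin_Union) auto
  moreover have "cproj c ` V \<subseteq> topspace (subtopology T (cnbhd c))"
    using sub chart_onD(1)[OF c] openin_subset by fastforce
  ultimately have "openin (subtopology T (cnbhd c)) (cproj c ` V)"
    using chart_onD(8)[OF c] unfolding quotient_map_def by simp
  then show ?thesis using chart_onD(1)[OF c] openin_trans_full by blast
qed

text \<open>The group fixes \<open>0\<close>, so the fibre over the centre, which is the orbit of
  \<open>0\<close>, is a single point.\<close>

lemma chart_fibre_zero:
  assumes "chart_on n T c" "y \<in> cmodel c" "cproj c y = ccenter c"
  shows "y = 0"
proof -
  have "cproj c 0 = cproj c y" using assms(3) chart_onD(10)[OF assms(1)] by simp
  then show ?thesis
    using chart_onD(7,9)[OF assms(1)] chart_model_zero[OF chart_onD(3)[OF assms(1)]] assms(2) by metis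
qed

text \<open>The inverse is the action of the inverse element. Being embeddings, group elements
  preserve the relative interior of the model, hence its frontier.\<close>

lemma chart_action_smooth_embedding:
  assumes c: "chart_on n T c" and g: "g \<in> carrier (cgroup c)"
  shows "smooth_embedding (cmodel c) (cmodel c) (caction c g)"
proof -
  let ?M = "cmodel c"
  have inj: "inj_on (caction c g) ?M" using group_action.inj_prop[OF chart_onD(5)[OF c] g] .
  have im: "caction c g ` ?M = ?M" using group_action.surj_prop[OF chart_onD(5)[OF c] g] .
  have inv: "inv_into ?M (caction c g) y = caction c (inv\<^bsub>cgroup c\<^esub> g) y" if "y \<in> ?M" for y
    using that chart_action_inverse'[OF c g that] chart_action_closed[OF c chart_inv_closed[OF c g] that] inj
    by (metis inv_into_f_f)
  have "smooth_on ?M (inv_into ?M (caction c g))"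
    unfolding smooth_on_def
  proof
    fix x assume x: "x \<in> ?M"
    obtain N h where N: "open N" "x \<in> N" "\<forall>k. Ck_on k h N" "\<forall>y\<in>N \<inter> ?M. h y = caction c (inv\<^bsub>cgroup c\<^esub> g) y"
      using chart_onD(6)[OF c chart_inv_closed[OF c g]] x unfolding smooth_on_def by blast
    then have "\<forall>y\<in>N \<inter> ?M. h y = inv_into ?M (caction c g) y" using inv by auto
    with N show "\<exists>N h. open N \<and> x \<in> N \<and> (\<forall>k. Ck_on k h N) \<and> (\<forall>y\<in>N \<inter> ?M. h y = inv_into ?M (caction c g) y)"
      by blast
  qed
  then show ?thesis
    unfolding smooth_embedding_def im using inj chart_onD(6)[OF c g] chart_action_closed[OF c g] by auto
qed

lemma chart_embedsE:
  assumes "chart_embeds a c"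
  obtains \<psi> \<theta> where "smooth_embedding (cmodel a) (cmodel c) \<psi>"
    "\<theta> \<in> hom (cgroup a) (cgroup c)" "inj_on \<theta> (carrier (cgroup a))"
    "\<And>g y. g \<in> carrier (cgroup a) \<Longrightarrow> y \<in> cmodel a \<Longrightarrow> \<psi> (caction a g y) = caction c (\<theta> g) (\<psi> y)"
    "\<And>y. y \<in> cmodel a \<Longrightarrow> cproj c (\<psi> y) = cproj a y"
  using assms unfolding chart_embeds_def by blast

lemma chart_embeds_concentric:
  assumes "chart_embeds a c" "chart_on n T c" "0 \<in> cmodel a" "cproj a 0 = ccenter c"
  obtains \<psi> where "smooth_embedding (cmodel a) (cmodel c) \<psi>" "\<psi> 0 = 0"
    "\<And>y. y \<in> cmodel a \<Longrightarrow> cproj c (\<psi> y) = cproj a y"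
proof -
  obtain \<psi> where psi: "smooth_embedding (cmodel a) (cmodel c) \<psi>" "\<And>y. y \<in> cmodel a \<Longrightarrow> cproj c (\<psi> y) = cproj a y"
    using chart_embedsE[OF assms(1)] by metis
  have "\<psi> 0 \<in> cmodel c" using psi(1) assms(3) unfolding smooth_embedding_def by auto
  then have "\<psi> 0 = 0" using chart_fibre_zero[OF assms(2)] psi(2)[OF assms(3)] assms(4) by simp
  with psi show ?thesis using that by blast
qed

abbreviation trivial_chart :: "('p, 'e::euclidean_space, 'g) ochart \<Rightarrow> bool" where
  "trivial_chart c \<equiv> carrier (cgroup c) = {\<one>\<^bsub>cgroup c\<^esub>}"

lemma trivial_chart_inj:
  assumes "chart_on n T c" "trivial_chart c" shows "inj_on (cproj c) (cmodel c)"
proof (rule inj_onI)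
  fix y z assume "y \<in> cmodel c" "z \<in> cmodel c" "cproj c y = cproj c z"
  then have "z = caction c \<one>\<^bsub>cgroup c\<^esub> y" using chart_onD(9)[OF assms(1)] assms(2) by auto
  then show "y = z" using chart_action_one[OF assms(1) \<open>y \<in> cmodel c\<close>] by simp
qed

lemma trivial_chart_embeds:
  assumes "chart_embeds a c" "trivial_chart c" "group (cgroup a)" shows "trivial_chart a"
proof -
  obtain \<theta> where th: "\<theta> \<in> hom (cgroup a) (cgroup c)" "inj_on \<theta> (carrier (cgroup a))"
    using chart_embedsE[OF assms(1)] by metis
  have one: "\<one>\<^bsub>cgroup a\<^esub> \<in> carrier (cgroup a)" using assms(3) group.is_monoid monoid.one_closed by blast
  have "g = \<one>\<^bsub>cgroup a\<^esub>" if "g \<in> carrier (cgroup a)" for g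
  proof -
    have "\<theta> g \<in> carrier (cgroup c)" "\<theta> \<one>\<^bsub>cgroup a\<^esub> \<in> carrier (cgroup c)"
      using th(1) that one unfolding hom_def by auto
    then have "\<theta> g = \<theta> \<one>\<^bsub>cgroup a\<^esub>" using assms(2) by auto
    then show ?thesis using inj_onD[OF th(2)] that one by blast
  qed
  then show ?thesis using one by blast
qed

section \<open>Boundary points and transition maps in an atlas\<close>

locale bordered_orbifold =
  fixes n :: nat and X :: "('p, 'e::euclidean_space, 'g) orbifold"
  assumes orb: "orbifold_with_boundary n X"
begin

abbreviation "TX \<equiv> ospace X"
abbreviation "AX \<equiv> oatlas X"
abbreviation "BX \<equiv> boundary_points n X"

lemma atlas_chart: "c \<in> AX \<Longrightarrow> chart_on n TX c"
  using orb unfolding orbifold_with_boundary_def by blast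

lemma atlas_small: "openin TX U \<Longrightarrow> x \<in> U \<Longrightarrow> \<exists>c\<in>AX. ccenter c = x \<and> cnbhd c \<subseteq> U"
  using orb unfolding orbifold_with_boundary_def by blast

lemma atlas_embeds: "a \<in> AX \<Longrightarrow> c \<in> AX \<Longrightarrow> cnbhd a \<subseteq> cnbhd c \<Longrightarrow> chart_embeds a c"
  using orb unfolding orbifold_with_boundary_def by blast

lemma Hausdorff_TX: "Hausdorff_space TX"
  using orb unfolding orbifold_with_boundary_def by blast

lemma atlas_model: "c \<in> AX \<Longrightarrow> chart_model n (cmodel c)"
  using atlas_chart chart_onD(3) by blast

lemma atlas_center: "c \<in> AX \<Longrightarrow> cproj c 0 = ccenter c" "c \<in> AX \<Longrightarrow> 0 \<in> cmodel c"
  using atlas_chart chart_onD(10) atlas_model chart_model_zero by blast+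

text \<open>\<open>boundary_points\<close> asks for one half-space chart at \<open>x\<close>. Any
  other chart at \<open>x\<close> is compared with it through a smaller chart \<open>e\<close> at
  \<open>x\<close> inside both: the embeddings of \<open>e\<close> send \<open>0\<close> to
  \<open>0\<close> and preserve interior points, so all three models are of the same type.\<close>

lemma halfspace_at_boundary_point:
  assumes x: "x \<in> BX" and c: "c \<in> AX" "ccenter c = x"
  shows "halfspace_model n (cmodel c)"
proof -
  obtain a where a: "a \<in> AX" "ccenter a = x" "halfspace_model n (cmodel a)"
    using x unfolding boundary_points_def by blast
  have "openin TX (cnbhd a \<inter> cnbhd c)" "x \<in> cnbhd a \<inter> cnbhd c"
    using chart_onD(1,2)[OF atlas_chart[OF a(1)]] chart_onD(1,2)[OF atlas_chart[OF c(1)]] a(2) c(2)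
    by (simp_all add: openin_Int)
  then obtain e where e: "e \<in> AX" "ccenter e = x" "cnbhd e \<subseteq> cnbhd a \<inter> cnbhd c"
    using atlas_small by blast
  have *: "0 \<in> rel_interior (cmodel d) \<longleftrightarrow> 0 \<in> rel_interior (cmodel e)" if d: "d \<in> AX" "ccenter d = x" "cnbhd e \<subseteq> cnbhd d" for d
  proof -
    have "cproj e 0 = ccenter d" using atlas_center(1)[OF e(1)] e(2) d(2) by simp
    then obtain \<psi> where "smooth_embedding (cmodel e) (cmodel d) \<psi>" "\<psi> 0 = 0"
      using chart_embeds_concentric[OF atlas_embeds[OF e(1) d(1,3)] atlas_chart[OF d(1)] atlas_center(2)[OF e(1)]] by blast
    then show ?thesis
      using smooth_embedding_rel_interior_iff[OF _ atlas_model[OF e(1)] atlas_model[OF d(1)] atlas_center(2)[OF e(1)]] by metis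
  qed
  show ?thesis
    using *[OF a(1,2)] *[OF c] e(3) a(3) euclidean_iff_zero_rel_interior(2)[OF atlas_model] a(1) c(1) by blast
qed

text \<open>A small chart \<open>e\<close> centred at the point embeds into \<open>c\<close> and
  sends \<open>0\<close> into the orbit of \<open>y\<close>. The embedding and the group element in
  between preserve interior points, so \<open>y\<close> is interior iff \<open>0\<close> is interior
  in the model of \<open>e\<close>.\<close>

lemma boundary_point_iff_rel_frontier:
  assumes c: "c \<in> AX" and y: "y \<in> cmodel c"
  shows "cproj c y \<in> BX \<longleftrightarrow> y \<in> rel_frontier (cmodel c)"
proof -
  have ch: "chart_on n TX c" by (rule atlas_chart[OF c])
  have "cproj c y \<in> cnbhd c" using y chart_image(1)[OF ch] by blast
  then obtain e where e: "e \<in> AX" "ccenter e = cproj c y" "cnbhd e \<subseteq> cnbhd c"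
    using atlas_small chart_onD(1)[OF ch] by blast
  obtain \<psi> where psi: "smooth_embedding (cmodel e) (cmodel c) \<psi>" "\<And>y. y \<in> cmodel e \<Longrightarrow> cproj c (\<psi> y) = cproj e y"
    using chart_embedsE[OF atlas_embeds[OF e(1) c e(3)]] by metis
  have p0: "\<psi> 0 \<in> cmodel c" using psi(1) atlas_center(2)[OF e(1)] unfolding smooth_embedding_def by auto
  have "cproj c y = cproj c (\<psi> 0)" using psi(2) atlas_center[OF e(1)] e(2) by simp
  then obtain g where g: "g \<in> carrier (cgroup c)" "\<psi> 0 = caction c g y" using chart_onD(9)[OF ch y p0] by blast
  have "cproj c y \<in> BX \<longleftrightarrow> halfspace_model n (cmodel e)"
    using halfspace_at_boundary_point e(1,2) unfolding boundary_points_def by blast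
  also have "\<dots> \<longleftrightarrow> 0 \<notin> rel_interior (cmodel e)" by (rule euclidean_iff_zero_rel_interior(2)[OF atlas_model[OF e(1)]])
  also have "\<dots> \<longleftrightarrow> caction c g y \<notin> rel_interior (cmodel c)"
    using smooth_embedding_rel_interior_iff[OF psi(1) atlas_model[OF e(1)] atlas_model[OF c] atlas_center(2)[OF e(1)]] g(2) by simp
  also have "\<dots> \<longleftrightarrow> y \<notin> rel_interior (cmodel c)"
    using smooth_embedding_rel_interior_iff[OF chart_action_smooth_embedding[OF ch g(1)] atlas_model[OF c] atlas_model[OF c] y] by simp
  also have "\<dots> \<longleftrightarrow> y \<in> rel_frontier (cmodel c)" using y rel_frontier_model[OF atlas_model[OF c]] by blast
  finally show ?thesis .
qed

text \<open>The transition map is \<open>\<phi>\<close> after the inverse of \<open>\<psi>\<close>,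
  for the embeddings of a smaller chart \<open>e\<close> centred at the common point. Since the
  groups are trivial, \<open>\<psi> 0\<close> and \<open>\<phi> 0\<close> are \<open>y\<close> and
  \<open>z\<close> themselves and not merely points of their orbits.\<close>

lemma transition_C1:
  assumes a: "a \<in> AX" "trivial_chart a" and c: "c \<in> AX" "trivial_chart c"
    and y: "y \<in> cmodel a" and z: "z \<in> cmodel c" and yz: "cproj a y = cproj c z"
  obtains t N where "C1_near (cmodel a) t y" "open N" "y \<in> N"
    "\<And>y'. y' \<in> N \<Longrightarrow> y' \<in> cmodel a \<Longrightarrow> t y' \<in> cmodel c \<and> cproj c (t y') = cproj a y'"
proof -
  have "cproj a y \<in> cnbhd a \<inter> cnbhd c"
    using y z yz chart_image(1)[OF atlas_chart[OF a(1)]] chart_image(1)[OF atlas_chart[OF c(1)]] by (metis IntI imageI)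
  moreover have "openin TX (cnbhd a \<inter> cnbhd c)" using a c chart_onD(1)[OF atlas_chart] by blast
  ultimately obtain e where e: "e \<in> AX" "ccenter e = cproj a y" "cnbhd e \<subseteq> cnbhd a" "cnbhd e \<subseteq> cnbhd c"
    using atlas_small by (metis le_inf_iff)
  have emb: "\<exists>\<psi>. smooth_embedding (cmodel e) (cmodel d) \<psi> \<and> \<psi> 0 = v \<and> (\<forall>y\<in>cmodel e. cproj d (\<psi> y) = cproj e y)"
    if d: "d \<in> AX" "trivial_chart d" "cnbhd e \<subseteq> cnbhd d" "v \<in> cmodel d" "cproj d v = cproj a y" for d v
  proof -
    obtain \<psi> where psi: "smooth_embedding (cmodel e) (cmodel d) \<psi>" "\<And>y. y \<in> cmodel e \<Longrightarrow> cproj d (\<psi> y) = cproj e y"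
      using chart_embedsE[OF atlas_embeds[OF e(1) d(1,3)]] by metis
    have "\<psi> 0 \<in> cmodel d" using psi(1) atlas_center(2)[OF e(1)] unfolding smooth_embedding_def by auto
    moreover have "cproj d (\<psi> 0) = cproj d v" using psi(2) atlas_center[OF e(1)] e(2) d(5) by simp
    ultimately have "\<psi> 0 = v" using trivial_chart_inj[OF atlas_chart[OF d(1)] d(2)] d(4) by (simp add: inj_on_eq_iff)
    with psi show ?thesis by blast
  qed
  obtain \<psi> where psi: "smooth_embedding (cmodel e) (cmodel a) \<psi>" "\<psi> 0 = y" "\<And>y. y\<in>cmodel e \<Longrightarrow> cproj a (\<psi> y) = cproj e y"
    using emb[OF a e(3) y refl] by blast
  obtain \<phi> where phi: "smooth_embedding (cmodel e) (cmodel c) \<phi>" "\<phi> 0 = z" "\<And>y. y\<in>cmodel e \<Longrightarrow> cproj c (\<phi> y) = cproj e y"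
    using emb[OF c e(4) z yz[symmetric]] by blast
  obtain N where N: "open N" "\<psi> ` cmodel e = cmodel a \<inter> N" using psi(1) unfolding smooth_embedding_def openin_open by auto
  have yN: "y \<in> N" using N(2) psi(2) atlas_center(2)[OF e(1)] by (metis IntD2 imageI)
  have inv0: "inv_into (cmodel e) \<psi> y = 0"
    using psi(1,2) atlas_center(2)[OF e(1)] unfolding smooth_embedding_def by (metis inv_into_f_f)
  have invN: "inv_into (cmodel e) \<psi> y' \<in> cmodel e \<and> \<psi> (inv_into (cmodel e) \<psi> y') = y'" if "y' \<in> N" "y' \<in> cmodel a" for y'
    using that N(2) by (metis IntI f_inv_into_f inv_into_into)
  have "C1_near (\<psi> ` cmodel e) (inv_into (cmodel e) \<psi>) y"
    using psi(1) N(2) yN y unfolding smooth_embedding_def by (intro smooth_on_imp_C1_near) auto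
  then have 1: "C1_near (cmodel a) (inv_into (cmodel e) \<psi>) y"
    by (rule C1_near_mono[OF _ N(1) yN]) (use N(2) in auto)
  have 2: "C1_near (cmodel e) \<phi> (inv_into (cmodel e) \<psi> y)"
    unfolding inv0 using phi(1) atlas_center(2)[OF e(1)] unfolding smooth_embedding_def by (intro smooth_on_imp_C1_near) auto
  have "C1_near (cmodel a) (\<lambda>y. \<phi> (inv_into (cmodel e) \<psi> y)) y"
    by (rule C1_near_compose[OF 1 2 y N(1) yN]) (use invN in auto)
  then show ?thesis
  proof (rule that[OF _ N(1) yN])
    fix y' assume "y' \<in> N" "y' \<in> cmodel a"
    then have i: "inv_into (cmodel e) \<psi> y' \<in> cmodel e" "\<psi> (inv_into (cmodel e) \<psi> y') = y'" using invN by auto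
    then show "\<phi> (inv_into (cmodel e) \<psi> y') \<in> cmodel c \<and> cproj c (\<phi> (inv_into (cmodel e) \<psi> y')) = cproj a y'"
      using phi(1,3) psi(3) unfolding smooth_embedding_def by (metis Pi_iff)
  qed
qed

end

locale boundary_retraction = bordered_orbifold n X for n and X :: "('p, 'e::euclidean_space, 'g) orbifold" +
  fixes F :: "('p, 'e, 'g, 'p, 'e, 'g) omap" and e
  assumes smooth: "smooth_complete_map n X (n - 1) (boundary n X) F"
    and same: "same_complete_map (boundary n X) (restrict_to_boundary n X F) (identity_map e)"
begin

abbreviation "f \<equiv> under F"

lemma continuous_f: "continuous_map TX (subtopology TX BX) f"
  using smooth unfolding smooth_complete_map_def boundary_def by simp

lemma f_in: "x \<in> topspace TX \<Longrightarrow> f x \<in> BX \<inter> topspace TX"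
  using continuous_map_image_subset_topspace[OF continuous_f] by auto

lemma continuous_f': "continuous_map TX TX f"
  using continuous_f continuous_map_in_subtopology by blast

lemma f_boundary: "x \<in> BX \<Longrightarrow> x \<in> topspace TX \<Longrightarrow> f x = x"
  using same unfolding same_complete_map_def restrict_to_boundary_def identity_map_def boundary_def by auto

text \<open>The lifts of \<open>F\<close> live in charts that vary with the point and are only
  compatible with the atlas. Composing with embeddings turns the lift \<open>h\<close> into the
  inverse of \<open>\<phi>\<close> after \<open>h\<close> after \<open>\<psi>\<close>, a lift
  between any sufficiently small atlas charts at \<open>z\<close> and \<open>f z\<close>. The target
  is the boundary chart of \<open>b\<close>, whose model is the frontier of that of
  \<open>b\<close>.\<close>

lemma local_lift:
  assumes z: "z \<in> topspace TX"
  obtains V W where "openin TX V" "z \<in> V" "openin TX W" "f z \<in> W"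
    "\<And>a b. a \<in> AX \<Longrightarrow> ccenter a = z \<Longrightarrow> cnbhd a \<subseteq> V \<Longrightarrow> b \<in> AX \<Longrightarrow> ccenter b = f z \<Longrightarrow> cnbhd b \<subseteq> W \<Longrightarrow>
      \<exists>k N. C1_near (cmodel a) k 0 \<and> k 0 = 0 \<and> open N \<and> 0 \<in> N \<and>
        (\<forall>y\<in>N \<inter> cmodel a. k y \<in> rel_frontier (cmodel b) \<and> cproj b (k y) = f (cproj a y))"
proof -
  define c where "c = src_chart F z"
  define d where "d = tgt_chart F z"
  define h where "h = lift_at F z"
  have "let c = src_chart F z; d = tgt_chart F z; h = lift_at F z; \<Theta> = hom_at F z in
          orbifold_chart n X c \<and> ccenter c = z \<and>
          orbifold_chart (n - 1) (boundary n X) d \<and> ccenter d = under F z \<and>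
          \<Theta> \<in> hom (cgroup c) (cgroup d) \<and>
          h \<in> cmodel c \<rightarrow> cmodel d \<and> smooth_on (cmodel c) h \<and>
          (\<forall>g\<in>carrier (cgroup c). \<forall>y\<in>cmodel c. h (caction c g y) = caction d (\<Theta> g) (h y)) \<and>
          (\<forall>y\<in>cmodel c. cproj d (h y) = under F (cproj c y))"
    using smooth z unfolding smooth_complete_map_def by blast
  then have oc: "orbifold_chart n X c" "ccenter c = z" and od: "orbifold_chart (n - 1) (boundary n X) d" "ccenter d = f z"
    and h: "h \<in> cmodel c \<rightarrow> cmodel d" "smooth_on (cmodel c) h" "\<And>y. y\<in>cmodel c \<Longrightarrow> cproj d (h y) = f (cproj c y)"
    unfolding c_def d_def h_def Let_def by blast+
  have cc: "chart_on n TX c" using oc unfolding orbifold_chart_def by blast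
  have cd: "chart_on (n - 1) (subtopology TX BX) d" using od unfolding orbifold_chart_def boundary_def by simp
  have c0: "0 \<in> cmodel c" "cproj c 0 = z" using chart_onD(3,10)[OF cc] chart_model_zero oc(2) by auto
  have h0: "h 0 = 0" using chart_fibre_zero[OF cd] h c0 od(2) by (simp add: Pi_iff)
  obtain W where W: "openin TX W" "cnbhd d = W \<inter> BX" using chart_onD(1)[OF cd] by (auto simp: openin_subtopology)
  show ?thesis
  proof (rule that[of "cnbhd c" W])
    show "openin TX (cnbhd c)" "z \<in> cnbhd c" using chart_onD(1,2)[OF cc] oc(2) by auto
    show "openin TX W" by (rule W(1))
    show "f z \<in> W" using chart_onD(2)[OF cd] od(2) W(2) by auto
    fix a b assume a: "a \<in> AX" "ccenter a = z" "cnbhd a \<subseteq> cnbhd c" and b: "b \<in> AX" "ccenter b = f z" "cnbhd b \<subseteq> W"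
    have "chart_embeds a c" using oc(1) a unfolding orbifold_chart_def by blast
    then obtain \<psi> where psi: "smooth_embedding (cmodel a) (cmodel c) \<psi>" "\<psi> 0 = 0" "\<And>y. y \<in> cmodel a \<Longrightarrow> cproj c (\<psi> y) = cproj a y"
      using chart_embeds_concentric[OF _ cc atlas_center(2)[OF a(1)]] atlas_center(1)[OF a(1)] a(2) oc(2) by metis
    have hb: "halfspace_model n (cmodel b)" using halfspace_at_boundary_point b f_in[OF z] by blast
    define B where "B = boundary_chart n X b"
    have Bs: "cmodel B = rel_frontier (cmodel b)" "cproj B = cproj b" "cnbhd B = cnbhd b \<inter> BX"
      unfolding B_def boundary_chart_def by simp_all
    have "B \<in> oatlas (boundary n X)" unfolding B_def boundary_def using b(1) hb by auto
    moreover have "cnbhd B \<subseteq> cnbhd d" unfolding Bs(3) W(2) using b(3) by blast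
    ultimately have "chart_embeds B d" using od(1) unfolding orbifold_chart_def by blast
    then obtain \<phi> where phi: "smooth_embedding (cmodel B) (cmodel d) \<phi>" "\<phi> 0 = 0" "\<And>y. y \<in> cmodel B \<Longrightarrow> cproj d (\<phi> y) = cproj B y"
      using chart_embeds_concentric[OF _ cd] zero_rel_frontier_halfspace[OF hb] atlas_center(1)[OF b(1)] b(2) od(2) Bs by metis
    have zB: "0 \<in> cmodel B" using zero_rel_frontier_halfspace[OF hb] Bs(1) by simp
    obtain S where S: "open S" "\<phi> ` cmodel B = cmodel d \<inter> S" using phi(1) unfolding smooth_embedding_def openin_open by auto
    have S0: "0 \<in> S" using S(2) phi(2) zB by (metis IntD2 imageI)
    have inv0: "inv_into (cmodel B) \<phi> 0 = 0"
      using phi(1,2) zB unfolding smooth_embedding_def by (metis inv_into_f_f)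
    have za: "0 \<in> cmodel a" by (rule atlas_center(2)[OF a(1)])
    have psi_in: "\<psi> y \<in> cmodel c" if "y \<in> cmodel a" for y using psi(1) that unfolding smooth_embedding_def by auto
    have 1: "C1_near (cmodel a) (\<lambda>y. h (\<psi> y)) 0"
      by (rule C1_near_compose[OF _ _ za open_UNIV, where M'="cmodel c"])
        (use psi h c0 za in \<open>auto simp: smooth_embedding_def intro!: smooth_on_imp_C1_near\<close>)
    have "h (\<psi> 0) \<in> S" using psi(2) h0 S0 by simp
    then obtain N where N: "open N" "0 \<in> N" "\<And>y. y \<in> N \<inter> cmodel a \<Longrightarrow> h (\<psi> y) \<in> S"
      using C1_near_eventually_in_open[OF 1 za S(1)] by blast
    have in_im: "h (\<psi> y) \<in> \<phi> ` cmodel B" if "y \<in> N" "y \<in> cmodel a" for y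
      unfolding S(2) using N(3) that h(1) psi_in by (auto simp: Pi_iff)
    have "C1_near (\<phi> ` cmodel B) (inv_into (cmodel B) \<phi>) (h (\<psi> 0))"
      using phi(1) in_im[OF N(2) za] unfolding smooth_embedding_def by (intro smooth_on_imp_C1_near) auto
    then have 2: "C1_near (cmodel a) (\<lambda>y. inv_into (cmodel B) \<phi> (h (\<psi> y))) 0"
      by (rule C1_near_compose[OF 1 _ za N(1,2) in_im])
    have 3: "inv_into (cmodel B) \<phi> (h (\<psi> y)) \<in> rel_frontier (cmodel b) \<and> cproj b (inv_into (cmodel B) \<phi> (h (\<psi> y))) = f (cproj a y)"
      if y: "y \<in> N \<inter> cmodel a" for y
    proof -
      have i: "inv_into (cmodel B) \<phi> (h (\<psi> y)) \<in> cmodel B" "\<phi> (inv_into (cmodel B) \<phi> (h (\<psi> y))) = h (\<psi> y)"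
        using in_im y by (auto intro: inv_into_into f_inv_into_f)
      then have "cproj B (inv_into (cmodel B) \<phi> (h (\<psi> y))) = cproj d (h (\<psi> y))" using phi(3) by metis
      also have "\<dots> = f (cproj a y)" using h(3) psi_in psi(3) y by simp
      finally show ?thesis using i(1) Bs by simp
    qed
    show "\<exists>k N. C1_near (cmodel a) k 0 \<and> k 0 = 0 \<and> open N \<and> 0 \<in> N \<and>
        (\<forall>y\<in>N \<inter> cmodel a. k y \<in> rel_frontier (cmodel b) \<and> cproj b (k y) = f (cproj a y))"
      using 2 3 N(1,2) inv0 psi(2) h0
      by (intro exI[of _ "\<lambda>y. inv_into (cmodel B) \<phi> (h (\<psi> y))"] exI[of _ N]) auto
  qed
qed

end

section \<open>A fibre that avoids the singular set\<close>

lemma has_vector_derivative_along_ray: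
  assumes M: "chart_model n M" and v: "v \<in> M" and D: "(f has_derivative D) (at 0 within M)"
  shows "((\<lambda>t. f (t *\<^sub>R v)) has_vector_derivative D v) (at 0 within {0..})"
proof -
  have im: "(\<lambda>t. t *\<^sub>R v) ` {0..} \<subseteq> M"
    using chart_model_cone[OF M chart_model_zero[OF M] v] by auto
  have "((\<lambda>t. t *\<^sub>R v) has_derivative (\<lambda>t. t *\<^sub>R v)) (at 0 within {0..})"
    by (auto intro!: derivative_eq_intros)
  moreover have "(f has_derivative D) (at (0 *\<^sub>R v) within (\<lambda>t. t *\<^sub>R v) ` {0..})"
    using has_derivative_subset[OF D im] by simp
  ultimately have "((\<lambda>t. f (t *\<^sub>R v)) has_derivative (\<lambda>t. D (t *\<^sub>R v))) (at 0 within {0..})"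
    by (rule has_derivative_in_compose)
  moreover have "D (t *\<^sub>R v) = t *\<^sub>R D v" for t
    using has_derivative_linear[OF D] by (simp add: linear_scale)
  ultimately show ?thesis unfolding has_vector_derivative_def by simp
qed

text \<open>In a half-space \<open>0\<close> is a frontier point, so uniqueness comes from one-sided
  derivatives along the rays in \<open>M\<close>. They determine the derivative on \<open>M\<close>,
  and linearity extends this to \<open>span M\<close>.\<close>

lemma derivative_within_model_unique:
  assumes M: "chart_model n M" and D: "(f has_derivative D) (at 0 within M)" "(f has_derivative E) (at 0 within M)"
    and v: "v \<in> span M"
  shows "D v = E v"
proof -
  have nb: "at (0::real) within {0..} \<noteq> bot" by (simp add: at_within_Ici_at_right)
  have "D v = E v" if "v \<in> M" for v
    using vector_derivative_unique_within[OF nb has_vector_derivative_along_ray[OF M that D(1)]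
        has_vector_derivative_along_ray[OF M that D(2)]] .
  then show ?thesis
    using linear_eq_on_span[OF has_derivative_linear[OF D(1)] has_derivative_linear[OF D(2)] _ v] by blast
qed

text \<open>Along a ray in \<open>M\<close> the values of \<open>f\<close> are unchanged by
  projection to \<open>span M\<close>, so the one-sided derivative equals its own projection;
  linearity does the rest.\<close>

lemma derivative_within_model_in_span:
  assumes M: "chart_model n M" and D: "(f has_derivative D) (at 0 within M)"
    and f: "\<And>x. x \<in> M \<Longrightarrow> f x \<in> span M" and v: "v \<in> span M"
  shows "D v \<in> span M"
proof -
  let ?P = "oproj (span M)"
  have nb: "at (0::real) within {0..} \<noteq> bot" by (simp add: at_within_Ici_at_right)
  have inM: "D v \<in> span M" if v: "v \<in> M" for v
  proof -
    have d: "((\<lambda>t. f (t *\<^sub>R v)) has_vector_derivative D v) (at 0 within {0..})"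
      by (rule has_vector_derivative_along_ray[OF M v D])
    have dP: "((\<lambda>t. ?P (f (t *\<^sub>R v))) has_vector_derivative ?P (D v)) (at 0 within {0..})"
    proof (rule bounded_linear.has_vector_derivative[OF _ d])
      show "bounded_linear ?P" using linear_oproj[OF subspace_span] linear_conv_bounded_linear by blast
    qed
    have fP: "?P (f (t *\<^sub>R v)) = f (t *\<^sub>R v)" if "t \<in> {0..}" for t
      using that f chart_model_cone[OF M chart_model_zero[OF M] v, of t] by (simp add: oproj_id)
    have "((\<lambda>t. f (t *\<^sub>R v)) has_vector_derivative ?P (D v)) (at 0 within {0..})"
      by (rule has_vector_derivative_transform[OF _ _ dP]) (auto simp: fP)
    then have "D v = ?P (D v)" using vector_derivative_unique_within[OF nb d] by blast
    then show ?thesis using oproj_in[OF subspace_span] by metis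
  qed
  have "span M \<subseteq> D -` span M"
    using inM linear_subspace_vimage[OF has_derivative_linear[OF D] subspace_span] by (intro span_minimal) auto
  then show ?thesis using v by blast
qed

text \<open>A substitute for linearising the action at \<open>0\<close>. Averaging the derivatives
  \<open>D g\<close> over the group gives \<open>w\<close>, whose range lies in the fixed subspace.
  For fixed points \<open>x\<close> and \<open>y\<close> near \<open>0\<close>, strict
  differentiability makes \<open>(x - y) - D g (x - y)\<close> at most half as long as
  \<open>x - y\<close>. The average inherits this bound, whence the factor \<open>2\<close>.\<close>

lemma chart_fixed_points_estimate:
  fixes c :: "('p, 'e::euclidean_space, 'g) ochart"
  assumes c: "chart_on n T c"
  obtains w :: "'e \<Rightarrow> 'e" and N where "linear w" "dim (range w) \<le> stratum_dim c" "open N" "0 \<in> N"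
    "\<And>x y. x \<in> N \<Longrightarrow> y \<in> N \<Longrightarrow> x \<in> cmodel c \<Longrightarrow> y \<in> cmodel c \<Longrightarrow>
       \<forall>g\<in>carrier (cgroup c). caction c g x = x \<and> caction c g y = y \<Longrightarrow>
       norm (x - y) \<le> 2 * norm (w x - w y)"
proof -
  let ?M = "cmodel c" and ?G = "carrier (cgroup c)" and ?S = "span (cmodel c)"
  have M: "chart_model n ?M" by (rule chart_onD(3)[OF c])
  have finG: "finite ?G" by (rule chart_onD(4)[OF c])
  interpret group "cgroup c" by (rule chart_group[OF c])
  have z: "0 \<in> ?M" by (rule chart_model_zero[OF M])
  define good where "good g k D d \<longleftrightarrow> (\<forall>y\<in>ball 0 d \<inter> ?M. k y = caction c g y) \<and> (k has_derivative D) (at 0) \<and> 0 < d \<and>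
      (\<forall>x\<in>ball 0 d. \<forall>y\<in>ball 0 d. norm (k x - k y - D (x - y)) \<le> 1/2 * norm (x - y))" for g k D and d :: real
  have "\<exists>k D d. good g k D d" if g: "g \<in> ?G" for g
  proof -
    obtain N k where N: "open N" "0 \<in> N" "C1_on k N" "\<forall>y\<in>N \<inter> ?M. k y = caction c g y"
      using smooth_on_imp_C1_near[OF chart_onD(6)[OF c g] z] unfolding C1_near_def by blast
    obtain D where D: "(k has_derivative D) (at 0)"
      and strict: "\<And>e. 0 < e \<Longrightarrow> \<exists>d>0. ball 0 d \<subseteq> N \<and>
           (\<forall>x\<in>ball 0 d. \<forall>y\<in>ball 0 d. norm (k x - k y - D (x - y)) \<le> e * norm (x - y))"
      using C1_on_strict[OF N(3,1,2)] by metis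
    obtain d where d: "d > 0" "ball 0 d \<subseteq> N"
      "\<forall>x\<in>ball 0 d. \<forall>y\<in>ball 0 d. norm (k x - k y - D (x - y)) \<le> 1/2 * norm (x - y)"
      using strict[of "1/2"] by auto
    show ?thesis unfolding good_def using D d N(4) by (intro exI[of _ k] exI[of _ D] exI[of _ d]) auto
  qed
  then obtain k D d where "\<And>g. g \<in> ?G \<Longrightarrow> good g (k g) (D g) (d g)" by metis
  then have kD: "\<And>g y. g \<in> ?G \<Longrightarrow> y \<in> ball 0 (d g) \<Longrightarrow> y \<in> ?M \<Longrightarrow> k g y = caction c g y"
    "\<And>g. g \<in> ?G \<Longrightarrow> (k g has_derivative D g) (at 0)" "\<And>g. g \<in> ?G \<Longrightarrow> 0 < d g"
    "\<And>g x y. g \<in> ?G \<Longrightarrow> x \<in> ball 0 (d g) \<Longrightarrow> y \<in> ball 0 (d g) \<Longrightarrow> norm (k g x - k g y - D g (x - y)) \<le> 1/2 * norm (x - y)"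
    unfolding good_def by blast+
  have der: "(caction c g has_derivative D g) (at 0 within ?M)" if g: "g \<in> ?G" for g
    by (rule has_derivative_transform_within[OF has_derivative_at_withinI[OF kD(2)[OF g]] kD(3)[OF g] z])
      (use kD(1)[OF g] in \<open>auto simp: dist_commute\<close>)
  have linD: "linear (D g)" if "g \<in> ?G" for g using kD(2)[OF that] has_derivative_linear by blast
  have DS: "D g v \<in> ?S" if "g \<in> ?G" "v \<in> ?S" for g v
    by (rule derivative_within_model_in_span[OF M der[OF that(1)] _ that(2)])
      (auto intro: span_base chart_action_closed[OF c that(1)])
  have Dmult: "D (g \<otimes>\<^bsub>cgroup c\<^esub> h) v = D g (D h v)" if gh: "g \<in> ?G" "h \<in> ?G" and v: "v \<in> ?S" for g h v
  proof -
    have im: "caction c h ` ?M \<subseteq> ?M" using chart_action_closed[OF c gh(2)] by blast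
    have "(caction c g has_derivative D g) (at (caction c h 0) within caction c h ` ?M)"
      using has_derivative_subset[OF der[OF gh(1)] im] chart_onD(7)[OF c gh(2)] by simp
    from has_derivative_in_compose[OF der[OF gh(2)] this]
    have 1: "((\<lambda>x. caction c g (caction c h x)) has_derivative (\<lambda>v. D g (D h v))) (at 0 within ?M)" .
    have "(caction c (g \<otimes>\<^bsub>cgroup c\<^esub> h) has_derivative (\<lambda>v. D g (D h v))) (at 0 within ?M)"
      by (rule has_derivative_transform[OF z _ 1])
        (simp add: group_action.composition_rule[OF chart_onD(5)[OF c] _ gh])
    then show ?thesis
      using derivative_within_model_unique[OF M der _ v] gh by blast
  qed
  define m where "m = card ?G"
  have m: "0 < m" unfolding m_def using finG one_closed by (auto simp: card_gt_0_iff)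
  \<comment> \<open>Only on \<open>span (cmodel c)\<close> are the derivatives determined by the
    action, hence the projection before averaging.\<close>
  define w where "w u = (\<Sum>g\<in>?G. D g (oproj ?S u)) /\<^sub>R real m" for u
  have linw: "linear w"
  proof -
    have "linear (\<lambda>u. D g (oproj ?S u))" if "g \<in> ?G" for g
      using linear_compose[OF linear_oproj[OF subspace_span] linD[OF that]] by (simp add: o_def)
    then have "linear (\<lambda>u. \<Sum>g\<in>?G. D g (oproj ?S u))" by (intro linear_compose_sum) auto
    then show ?thesis unfolding w_def by (rule linear_compose_scale_right)
  qed
  have rangew: "range w \<subseteq> {v \<in> ?S. \<forall>g\<in>?G. frechet_derivative (caction c g) (at 0 within ?M) v = v}"
  proof clarify
    fix u
    let ?v = "oproj ?S u"
    have vS: "?v \<in> ?S" by simp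
    have wS: "w u \<in> ?S" unfolding w_def using DS vS by (intro span_scale span_sum)
    moreover have "frechet_derivative (caction c g) (at 0 within ?M) (w u) = w u" if g: "g \<in> ?G" for g
    proof -
      have "(caction c g has_derivative frechet_derivative (caction c g) (at 0 within ?M)) (at 0 within ?M)"
        using der[OF g] frechet_derivative_works unfolding differentiable_def by blast
      then have "frechet_derivative (caction c g) (at 0 within ?M) (w u) = D g (w u)"
        using derivative_within_model_unique[OF M _ der[OF g] wS] by blast
      also have "\<dots> = (\<Sum>h\<in>?G. D g (D h ?v)) /\<^sub>R real m"
        unfolding w_def by (simp add: linear_scale[OF linD[OF g]] linear_sum[OF linD[OF g]])
      also have "\<dots> = (\<Sum>h\<in>?G. D (g \<otimes>\<^bsub>cgroup c\<^esub> h) ?v) /\<^sub>R real m"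
        using Dmult[OF g _ vS] by simp
      also have "(\<Sum>h\<in>?G. D (g \<otimes>\<^bsub>cgroup c\<^esub> h) ?v) = (\<Sum>h\<in>?G. D h ?v)"
        by (rule sum.reindex_bij_witness[where j="\<lambda>h. g \<otimes>\<^bsub>cgroup c\<^esub> h" and i="\<lambda>h. inv\<^bsub>cgroup c\<^esub> g \<otimes>\<^bsub>cgroup c\<^esub> h"])
          (use g in \<open>auto simp: m_assoc[symmetric]\<close>)
      finally show ?thesis unfolding w_def .
    qed
    ultimately show "w u \<in> ?S \<and> (\<forall>g\<in>?G. frechet_derivative (caction c g) (at 0 within ?M) (w u) = w u)" by blast
  qed
  have dim: "dim (range w) \<le> stratum_dim c" unfolding stratum_dim_def by (rule dim_subset[OF rangew])
  define N where "N = (\<Inter>g\<in>?G. ball (0::'e) (d g))"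
  show ?thesis
  proof (rule that[OF linw dim, of N])
    show "open N" "0 \<in> N" unfolding N_def using finG kD(3) by auto
    fix x y assume xy: "x \<in> N" "y \<in> N" "x \<in> ?M" "y \<in> ?M"
      and fix_xy: "\<forall>g\<in>?G. caction c g x = x \<and> caction c g y = y"
    have pxy: "oproj ?S (x - y) = x - y" using xy by (intro oproj_id) (auto intro: span_diff span_base)
    have 1: "norm ((x - y) - D g (x - y)) \<le> 1/2 * norm (x - y)" if g: "g \<in> ?G" for g
    proof -
      have "k g x = x" "k g y = y" using kD(1)[OF g] xy fix_xy g unfolding N_def by auto
      moreover have "x \<in> ball 0 (d g)" "y \<in> ball 0 (d g)" using xy g unfolding N_def by auto
      ultimately show ?thesis using kD(4)[OF g, of x y] by simp
    qed
    have "real m *\<^sub>R ((x - y) - w (x - y)) = (\<Sum>g\<in>?G. (x - y) - D g (x - y))"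
      unfolding w_def pxy using m by (simp add: sum_subtractf scaleR_diff_right m_def sum_constant_scaleR)
    then have "real m * norm ((x - y) - w (x - y)) = norm (\<Sum>g\<in>?G. (x - y) - D g (x - y))"
      by (metis abs_of_nat norm_scaleR)
    also have "\<dots> \<le> (\<Sum>g\<in>?G. 1/2 * norm (x - y))" using 1 by (rule sum_norm_le)
    also have "\<dots> = real m * (1/2 * norm (x - y))" by (simp add: m_def)
    finally have "norm ((x - y) - w (x - y)) \<le> 1/2 * norm (x - y)" using m by simp
    moreover have "norm (x - y) \<le> norm ((x - y) - w (x - y)) + norm (w (x - y))"
      using norm_triangle_ineq[of "(x - y) - w (x - y)" "w (x - y)"] by simp
    ultimately show "norm (x - y) \<le> 2 * norm (w x - w y)" by (simp add: linear_diff[OF linw])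
  qed
qed

lemma C1_near_Lipschitz:
  assumes "C1_near M f x"
  shows "\<exists>N C. open N \<and> x \<in> N \<and> 0 \<le> C \<and> (\<forall>y\<in>N \<inter> M. \<forall>z\<in>N \<inter> M. norm (f y - f z) \<le> C * norm (y - z))"
proof -
  obtain N k where N: "open N" "x \<in> N" "C1_on k N" "\<forall>y\<in>N \<inter> M. k y = f y"
    using assms unfolding C1_near_def by blast
  obtain D where D: "(k has_derivative D) (at x)"
    and strict: "\<And>e. 0 < e \<Longrightarrow> \<exists>d>0. ball x d \<subseteq> N \<and>
         (\<forall>y\<in>ball x d. \<forall>z\<in>ball x d. norm (k y - k z - D (y - z)) \<le> e * norm (y - z))"
    using C1_on_strict[OF N(3,1,2)] by metis
  obtain d where d: "d > 0" "ball x d \<subseteq> N"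
    "\<forall>y\<in>ball x d. \<forall>z\<in>ball x d. norm (k y - k z - D (y - z)) \<le> 1 * norm (y - z)"
    using strict[of 1] by auto
  obtain K where K: "0 < K" "\<And>v. norm (D v) \<le> norm v * K"
    using bounded_linear.pos_bounded[OF has_derivative_bounded_linear[OF D]] by blast
  have "norm (f y - f z) \<le> (1 + K) * norm (y - z)" if "y \<in> ball x d \<inter> M" "z \<in> ball x d \<inter> M" for y z
  proof -
    have "k y = f y" "k z = f z" using that d(2) N(4) by auto
    then have "norm (f y - f z - D (y - z)) \<le> norm (y - z)" using d(3) that by force
    moreover have "norm (f y - f z) \<le> norm (f y - f z - D (y - z)) + norm (D (y - z))"
      using norm_triangle_ineq[of "f y - f z - D (y - z)" "D (y - z)"] by simp
    ultimately show ?thesis using K(2)[of "y - z"] by (simp add: algebra_simps)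
  qed
  then show ?thesis using d(1) K(1) by (intro exI[of _ "ball x d"] exI[of _ "1 + K"]) auto
qed

context bordered_orbifold
begin

definition regular_points :: "'p set" where
  "regular_points = {x \<in> topspace TX. \<exists>c\<in>AX. ccenter c = x \<and> trivial_chart c}"

text \<open>The order of the isotropy group of \<open>x\<close>. Taking the least order over all
  charts centred at \<open>x\<close> makes it a function of the point without a comparison of all
  these charts.\<close>

definition min_isotropy :: "'p \<Rightarrow> nat" where
  "min_isotropy x = (LEAST k. \<exists>c\<in>AX. ccenter c = x \<and> card (carrier (cgroup c)) = k)"

lemma min_isotropy_le: "c \<in> AX \<Longrightarrow> min_isotropy (ccenter c) \<le> card (carrier (cgroup c))"
  unfolding min_isotropy_def by (rule Least_le) blast

text \<open>A chart attaining the minimum can be shrunk: the group of a smaller chart at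
  \<open>x\<close> injects into its group, so the order stays minimal.\<close>

lemma min_isotropy_chart:
  assumes x: "openin TX V" "x \<in> V"
  obtains c where "c \<in> AX" "ccenter c = x" "cnbhd c \<subseteq> V" "card (carrier (cgroup c)) = min_isotropy x"
proof -
  have "\<exists>k. \<exists>c\<in>AX. ccenter c = x \<and> card (carrier (cgroup c)) = k" using atlas_small[OF x] by blast
  from LeastI_ex[OF this] obtain c where c: "c \<in> AX" "ccenter c = x" "card (carrier (cgroup c)) = min_isotropy x"
    unfolding min_isotropy_def by blast
  have "openin TX (V \<inter> cnbhd c)" "x \<in> V \<inter> cnbhd c"
    using x chart_onD(1,2)[OF atlas_chart[OF c(1)]] c(2) by (simp_all add: openin_Int)
  then obtain e where e: "e \<in> AX" "ccenter e = x" "cnbhd e \<subseteq> V \<inter> cnbhd c" using atlas_small by blast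
  obtain \<theta> where "\<theta> \<in> hom (cgroup e) (cgroup c)" "inj_on \<theta> (carrier (cgroup e))"
    using chart_embedsE[OF atlas_embeds[OF e(1) c(1)]] e(3) by (metis le_inf_iff)
  then have "card (carrier (cgroup e)) \<le> card (carrier (cgroup c))"
    using chart_onD(4)[OF atlas_chart[OF c(1)]] by (intro card_inj_on_le) (auto simp: hom_def)
  then have "card (carrier (cgroup e)) = min_isotropy x" using min_isotropy_le[OF e(1)] e(2) c(3) by simp
  then show ?thesis using that e by blast
qed

text \<open>If the isotropy order at the image of \<open>y\<close> equals the order of the group of
  the chart, the injection \<open>\<theta>\<close> of isotropy groups is onto. The image of
  \<open>0\<close> under the embedding is then fixed by the whole group, and \<open>y\<close>, being
  in its orbit, coincides with it. In this way strata become fixed point sets.\<close>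

lemma equal_isotropy_fixed:
  assumes c: "c \<in> AX" "card (carrier (cgroup c)) = min_isotropy x" and y: "y \<in> cmodel c" "cproj c y = x"
  shows "\<forall>g\<in>carrier (cgroup c). caction c g y = y"
proof -
  have ch: "chart_on n TX c" by (rule atlas_chart[OF c(1)])
  have "x \<in> cnbhd c" using y chart_image(1)[OF ch] by blast
  then obtain e where e: "e \<in> AX" "ccenter e = x" "cnbhd e \<subseteq> cnbhd c" using atlas_small[OF chart_onD(1)[OF ch]] by blast
  obtain \<psi> \<theta> where psi: "smooth_embedding (cmodel e) (cmodel c) \<psi>" and th: "\<theta> \<in> hom (cgroup e) (cgroup c)" "inj_on \<theta> (carrier (cgroup e))"
    and eqv: "\<And>g y. g \<in> carrier (cgroup e) \<Longrightarrow> y \<in> cmodel e \<Longrightarrow> \<psi> (caction e g y) = caction c (\<theta> g) (\<psi> y)"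
    and cov: "\<And>y. y \<in> cmodel e \<Longrightarrow> cproj c (\<psi> y) = cproj e y"
    using chart_embedsE[OF atlas_embeds[OF e(1) c(1) e(3)]] by metis
  have z: "0 \<in> cmodel e" by (rule atlas_center(2)[OF e(1)])
  have sub: "\<theta> ` carrier (cgroup e) \<subseteq> carrier (cgroup c)" using th(1) unfolding hom_def by auto
  have "card (carrier (cgroup c)) \<le> card (\<theta> ` carrier (cgroup e))"
    using c(2) min_isotropy_le[OF e(1)] e(2) card_image[OF th(2)] by simp
  then have onto: "\<theta> ` carrier (cgroup e) = carrier (cgroup c)"
    using card_seteq[OF chart_onD(4)[OF ch] sub] by simp
  have p0: "\<psi> 0 \<in> cmodel c" using psi z unfolding smooth_embedding_def by auto
  have fix0: "caction c g (\<psi> 0) = \<psi> 0" if "g \<in> carrier (cgroup c)" for g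
  proof -
    have "g \<in> \<theta> ` carrier (cgroup e)" unfolding onto by (rule that)
    then obtain h where h: "h \<in> carrier (cgroup e)" "g = \<theta> h" by (rule imageE)
    then show ?thesis using eqv[OF h(1) z] chart_onD(7)[OF atlas_chart[OF e(1)] h(1)] by simp
  qed
  have "cproj c (\<psi> 0) = cproj c y" using cov[OF z] atlas_center(1)[OF e(1)] e(2) y(2) by simp
  then obtain g where "g \<in> carrier (cgroup c)" "y = caction c g (\<psi> 0)" using chart_onD(9)[OF ch p0 y(1)] by blast
  then have "y = \<psi> 0" using fix0 by simp
  then show ?thesis using fix0 by blast
qed

text \<open>The Lindelof property holds in the models, which are subsets of Euclidean space, and
  passes to the orbifold because by compactness finitely many charts cover it.\<close>

lemma countable_subcover:
  assumes cpt: "compact_space TX" and Z: "Z \<subseteq> topspace TX" and V: "\<And>z. z \<in> Z \<Longrightarrow> openin TX (V z) \<and> z \<in> V z"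
  obtains Z' where "countable Z'" "Z' \<subseteq> Z" "Z \<subseteq> (\<Union>z\<in>Z'. V z)"
proof -
  have "\<forall>U\<in>cnbhd ` AX. openin TX U" using chart_onD(1)[OF atlas_chart] by blast
  moreover have "topspace TX \<subseteq> \<Union>(cnbhd ` AX)"
    using atlas_small[OF openin_topspace] chart_onD(2)[OF atlas_chart] by blast
  ultimately obtain \<F> where F: "finite \<F>" "\<F> \<subseteq> cnbhd ` AX" "topspace TX \<subseteq> \<Union>\<F>"
    using cpt unfolding compact_space_alt by (metis)
  then obtain C where C: "finite C" "C \<subseteq> AX" "topspace TX \<subseteq> (\<Union>c\<in>C. cnbhd c)"
    using finite_subset_image[OF F(1,2)] by metis
  have "\<exists>Z'. countable Z' \<and> Z' \<subseteq> Z \<and> Z \<inter> cnbhd c \<subseteq> (\<Union>z\<in>Z'. V z)" if c: "c \<in> C" for c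
  proof -
    have ch: "chart_on n TX c" using c C(2) atlas_chart by blast
    define P where "P z = {y \<in> cmodel c. cproj c y \<in> V z}" for z
    have oP: "openin (top_of_set (cmodel c)) (P z)" if "z \<in> Z" for z
      using openin_continuous_map_preimage[OF chart_image(2)[OF ch] V[OF that, THEN conjunct1]] unfolding P_def by simp
    obtain \<G> where G: "\<G> \<subseteq> P ` Z" "countable \<G>" "\<Union>\<G> = \<Union>(P ` Z)"
    proof (rule Lindelof_openin[of "P ` Z" "cmodel c"])
      show "openin (top_of_set (cmodel c)) S" if "S \<in> P ` Z" for S using oP that by auto
    qed
    obtain Z' where Z': "countable Z'" "Z' \<subseteq> Z" "\<G> = P ` Z'"
      using countable_subset_image[THEN iffD1, OF conjI[OF G(2,1)]] by blast
    have "x \<in> (\<Union>z\<in>Z'. V z)" if x: "x \<in> Z \<inter> cnbhd c" for x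
    proof -
      have "x \<in> cproj c ` cmodel c" unfolding chart_image(1)[OF ch] using x by simp
      then obtain y where y: "y \<in> cmodel c" "cproj c y = x" by auto
      then have "y \<in> \<Union>(P ` Z)" using V[of x] x unfolding P_def by blast
      then have "y \<in> \<Union>(P ` Z')" using G(3) Z'(3) by simp
      then show ?thesis using y unfolding P_def by blast
    qed
    then show ?thesis using Z' by blast
  qed
  then obtain Y where Y: "\<And>c. c \<in> C \<Longrightarrow> countable (Y c) \<and> Y c \<subseteq> Z \<and> Z \<inter> cnbhd c \<subseteq> (\<Union>z\<in>Y c. V z)" by metis
  show ?thesis
  proof (rule that[of "\<Union>c\<in>C. Y c"])
    show "countable (\<Union>c\<in>C. Y c)" using C(1) Y by (intro countable_UN) (auto simp: countable_finite)
    show "(\<Union>c\<in>C. Y c) \<subseteq> Z" using Y by blast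
    show "Z \<subseteq> (\<Union>z\<in>\<Union>c\<in>C. Y c. V z)"
    proof
      fix z assume z: "z \<in> Z"
      then obtain c where "c \<in> C" "z \<in> cnbhd c" using Z C(3) by blast
      then have "z \<in> (\<Union>z\<in>Y c. V z)" using Y[of c] z by auto
      then show "z \<in> (\<Union>z\<in>\<Union>c\<in>C. Y c. V z)" using \<open>c \<in> C\<close> by auto
    qed
  qed
qed

end

context boundary_retraction
begin

text \<open>Here \<open>b\<close> only has to contain \<open>f z\<close>: a lift into a small chart
  at \<open>f z\<close> is composed with an embedding into \<open>b\<close>, which keeps frontier
  points on the frontier. With \<open>b\<close> fixed, the images of different points
  \<open>z\<close> can be measured in the same hyperplane.\<close>

lemma local_lift_into_chart:
  assumes z: "z \<in> topspace TX" and b: "b \<in> AX" "halfspace_model n (cmodel b)" "f z \<in> cnbhd b"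
  obtains V where "openin TX V" "z \<in> V"
    "\<And>a. a \<in> AX \<Longrightarrow> ccenter a = z \<Longrightarrow> cnbhd a \<subseteq> V \<Longrightarrow>
      \<exists>k N. C1_near (cmodel a) k 0 \<and> open N \<and> 0 \<in> N \<and>
        (\<forall>y\<in>N \<inter> cmodel a. k y \<in> rel_frontier (cmodel b) \<and> cproj b (k y) = f (cproj a y))"
proof -
  obtain V W where VW: "openin TX V" "z \<in> V" "openin TX W" "f z \<in> W" and lift:
    "\<And>a b. a \<in> AX \<Longrightarrow> ccenter a = z \<Longrightarrow> cnbhd a \<subseteq> V \<Longrightarrow> b \<in> AX \<Longrightarrow> ccenter b = f z \<Longrightarrow> cnbhd b \<subseteq> W \<Longrightarrow>
      \<exists>k N. C1_near (cmodel a) k 0 \<and> k 0 = 0 \<and> open N \<and> 0 \<in> N \<and>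
        (\<forall>y\<in>N \<inter> cmodel a. k y \<in> rel_frontier (cmodel b) \<and> cproj b (k y) = f (cproj a y))"
    using local_lift[OF z] by blast
  have "openin TX (W \<inter> cnbhd b)" "f z \<in> W \<inter> cnbhd b"
    using VW b chart_onD(1)[OF atlas_chart[OF b(1)]] by auto
  then obtain b' where b': "b' \<in> AX" "ccenter b' = f z" "cnbhd b' \<subseteq> W \<inter> cnbhd b" using atlas_small by blast
  obtain \<psi> where psi: "smooth_embedding (cmodel b') (cmodel b) \<psi>" "\<And>y. y \<in> cmodel b' \<Longrightarrow> cproj b (\<psi> y) = cproj b' y"
    using chart_embedsE[OF atlas_embeds[OF b'(1) b(1)]] b'(3) by (metis le_inf_iff)
  have hb': "halfspace_model n (cmodel b')" using halfspace_at_boundary_point b'(1,2) f_in[OF z] by blast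
  show ?thesis
  proof (rule that[OF VW(1,2)])
    fix a assume a: "a \<in> AX" "ccenter a = z" "cnbhd a \<subseteq> V"
    have "cnbhd b' \<subseteq> W" using b'(3) by simp
    from lift[OF a b'(1,2) this] obtain k N where k: "C1_near (cmodel a) k 0" "k 0 = 0" "open N" "0 \<in> N"
      and kN: "\<And>y. y \<in> N \<Longrightarrow> y \<in> cmodel a \<Longrightarrow> k y \<in> rel_frontier (cmodel b') \<and> cproj b' (k y) = f (cproj a y)"
      by (metis IntI)
    have fr: "rel_frontier (cmodel b') \<subseteq> cmodel b'" using rel_frontier_model[OF atlas_model[OF b'(1)]] by blast
    have "C1_near (cmodel a) (\<lambda>y. \<psi> (k y)) 0"
    proof (rule C1_near_compose[OF k(1) _ atlas_center(2)[OF a(1)] k(3,4)])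
      show "C1_near (cmodel b') \<psi> (k 0)" unfolding k(2)
        using psi(1) atlas_center(2)[OF b'(1)] unfolding smooth_embedding_def by (intro smooth_on_imp_C1_near) auto
      show "k y \<in> cmodel b'" if "y \<in> N" "y \<in> cmodel a" for y using kN that fr by blast
    qed
    moreover have "\<psi> (k y) \<in> rel_frontier (cmodel b) \<and> cproj b (\<psi> (k y)) = f (cproj a y)" if y: "y \<in> N \<inter> cmodel a" for y
    proof -
      have ky: "k y \<in> rel_frontier (cmodel b')" "cproj b' (k y) = f (cproj a y)" using kN y by auto
      then have kM: "k y \<in> cmodel b'" using fr by blast
      have "\<psi> (k y) \<in> cmodel b" using psi(1) kM unfolding smooth_embedding_def by auto
      moreover have "\<psi> (k y) \<notin> rel_interior (cmodel b)"
        using smooth_embedding_rel_interior_iff[OF psi(1) atlas_model[OF b'(1)] atlas_model[OF b(1)] kM] ky(1)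
          rel_frontier_model[OF atlas_model[OF b'(1)]] by blast
      ultimately show ?thesis using rel_frontier_model[OF atlas_model[OF b(1)]] psi(2)[OF kM] ky(2) by simp
    qed
    ultimately show "\<exists>k N. C1_near (cmodel a) k 0 \<and> open N \<and> 0 \<in> N \<and>
        (\<forall>y\<in>N \<inter> cmodel a. k y \<in> rel_frontier (cmodel b) \<and> cproj b (k y) = f (cproj a y))"
      using k(3,4) by blast
  qed
qed

text \<open>Near \<open>z\<close>, points of the same isotropy order come from points of a chart
  \<open>a\<close> fixed by its whole group. On these the lift is Lipschitz in terms of a linear map
  \<open>w\<close> of rank less than \<open>n - 1\<close>, so its image in the hyperplane is
  null.\<close>

lemma singular_stratum_image_null:
  assumes sing: "singular_codim_gt_1 n X"
    and z: "z \<in> topspace TX" "z \<notin> regular_points" and b: "b \<in> AX" "halfspace_model n (cmodel b)" "f z \<in> cnbhd b"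
  shows "\<exists>V. openin TX V \<and> z \<in> V \<and> null_in (rel_frontier (cmodel b))
    {v \<in> rel_frontier (cmodel b). cproj b v \<in> f ` {x \<in> V. min_isotropy x = min_isotropy z}}"
proof -
  let ?H = "rel_frontier (cmodel b)"
  obtain H: "subspace ?H" "dim ?H = n - 1" "0 < n" using halfspace_model_structure[OF b(2)] by metis
  have HM: "?H \<subseteq> cmodel b" using rel_frontier_model[OF atlas_model[OF b(1)]] by blast
  have chb: "chart_on n TX b" by (rule atlas_chart[OF b(1)])
  obtain V where V: "openin TX V" "z \<in> V" and lift:
    "\<And>a. a \<in> AX \<Longrightarrow> ccenter a = z \<Longrightarrow> cnbhd a \<subseteq> V \<Longrightarrow>
      \<exists>k N. C1_near (cmodel a) k 0 \<and> open N \<and> 0 \<in> N \<and>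
        (\<forall>y\<in>N \<inter> cmodel a. k y \<in> ?H \<and> cproj b (k y) = f (cproj a y))"
    using local_lift_into_chart[OF z(1) b] by blast
  obtain a where a: "a \<in> AX" "ccenter a = z" "cnbhd a \<subseteq> V" "card (carrier (cgroup a)) = min_isotropy z"
    using min_isotropy_chart[OF V] by blast
  have cha: "chart_on n TX a" by (rule atlas_chart[OF a(1)])
  obtain k N where k: "C1_near (cmodel a) k 0" "open N" "0 \<in> N"
    and kN: "\<And>y. y \<in> N \<Longrightarrow> y \<in> cmodel a \<Longrightarrow> k y \<in> ?H \<and> cproj b (k y) = f (cproj a y)"
    using lift[OF a(1-3)] by blast
  have za: "0 \<in> cmodel a" by (rule atlas_center(2)[OF a(1)])
  have "\<not> trivial_chart a" using z a(1,2) unfolding regular_points_def by blast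
  then have "z \<in> singular_set X" unfolding singular_set_def using a(1,2) by blast
  then have sd: "stratum_dim a < n - 1" using sing a(1,2) H(3) unfolding singular_codim_gt_1_def by force
  obtain w :: "'e \<Rightarrow> 'e" and N' where w: "linear w" "dim (range w) \<le> stratum_dim a" and N': "open N'" "0 \<in> N'"
    and est: "\<And>x y. x \<in> N' \<Longrightarrow> y \<in> N' \<Longrightarrow> x \<in> cmodel a \<Longrightarrow> y \<in> cmodel a \<Longrightarrow>
       \<forall>g\<in>carrier (cgroup a). caction a g x = x \<and> caction a g y = y \<Longrightarrow> norm (x - y) \<le> 2 * norm (w x - w y)"
    using chart_fixed_points_estimate[OF cha] by blast
  \<comment> \<open>A point \<open>v\<close> with \<open>cproj b v = f x\<close> equals the lifted
    value only up to the group of \<open>b\<close>, so the lift is followed by each of the finitely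
    many group elements.\<close>
  define kg where "kg g y = caction b g (k y)" for g y
  have C1kg: "C1_near (cmodel a) (kg g) 0" if g: "g \<in> carrier (cgroup b)" for g
    unfolding kg_def
  proof (rule C1_near_compose[OF k(1) _ za k(2,3)])
    show "C1_near (cmodel b) (caction b g) (k 0)"
      using smooth_on_imp_C1_near[OF chart_onD(6)[OF chb g]] kN[OF k(3) za] HM by blast
    show "k y \<in> cmodel b" if "y \<in> N" "y \<in> cmodel a" for y using kN that HM by blast
  qed
  define good where "good g L C \<longleftrightarrow> open L \<and> 0 \<in> L \<and> 0 \<le> C \<and>
    (\<forall>y\<in>L \<inter> cmodel a. \<forall>x\<in>L \<inter> cmodel a. norm (kg g y - kg g x) \<le> C * norm (y - x))" for g L and C :: real
  have "\<exists>L C. good g L C" if "g \<in> carrier (cgroup b)" for g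
    using C1_near_Lipschitz[OF C1kg[OF that]] unfolding good_def .
  then obtain L C where "\<And>g. g \<in> carrier (cgroup b) \<Longrightarrow> good g (L g) (C g)" by metis
  then have L: "\<And>g. g \<in> carrier (cgroup b) \<Longrightarrow> open (L g) \<and> 0 \<in> L g \<and> 0 \<le> C g"
    and lip: "\<And>g y x. g \<in> carrier (cgroup b) \<Longrightarrow> y \<in> L g \<inter> cmodel a \<Longrightarrow> x \<in> L g \<inter> cmodel a \<Longrightarrow> norm (kg g y - kg g x) \<le> C g * norm (y - x)"
    unfolding good_def by blast+
  have finb: "finite (carrier (cgroup b))" by (rule chart_onD(4)[OF chb])
  define A where "A = N \<inter> N' \<inter> (\<Inter>g\<in>carrier (cgroup b). L g)"
  have A: "open A" "0 \<in> A" unfolding A_def using k(2,3) N' L finb by auto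
  define Fx where "Fx = {y \<in> A \<inter> cmodel a. \<forall>g\<in>carrier (cgroup a). caction a g y = y}"
  have null: "null_in ?H (kg g ` Fx)" if g: "g \<in> carrier (cgroup b)" for g
  proof (rule null_in_Lipschitz_lowdim[OF H(1) w(1)])
    show "dim (range w) < dim ?H" using w(2) sd H(2) by simp
    show "kg g x \<in> ?H" if "x \<in> Fx" for x
    proof -
      have kx: "k x \<in> ?H" using kN that unfolding Fx_def A_def by blast
      then have "caction b g (k x) \<in> cmodel b" using chart_action_closed[OF chb g] HM by blast
      moreover have "caction b g (k x) \<notin> rel_interior (cmodel b)"
        using smooth_embedding_rel_interior_iff[OF chart_action_smooth_embedding[OF chb g] atlas_model[OF b(1)] atlas_model[OF b(1)], of "k x"]
          kx rel_frontier_model[OF atlas_model[OF b(1)]] by auto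
      ultimately show ?thesis unfolding kg_def using rel_frontier_model[OF atlas_model[OF b(1)]] by simp
    qed
    show "norm (kg g x - kg g y) \<le> (C g * 2) * norm (w x - w y)" if xy: "x \<in> Fx" "y \<in> Fx" for x y
    proof -
      have "norm (kg g x - kg g y) \<le> C g * norm (x - y)"
        using lip[OF g, of x y] xy g unfolding Fx_def A_def by blast
      also have "\<dots> \<le> C g * (2 * norm (w x - w y))"
        using est[of x y] xy L[OF g] unfolding Fx_def A_def by (intro mult_left_mono) auto
      finally show ?thesis by simp
    qed
  qed
  define V' where "V' = cproj a ` (cmodel a \<inter> A)"
  have V': "openin TX V'" "z \<in> V'"
    unfolding V'_def using chart_open_map[OF cha openin_open_Int[OF A(1)]] A(2) za atlas_center(1)[OF a(1)] a(2)
    by (auto simp: image_iff intro!: bexI[of _ 0])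
  have "{v \<in> ?H. cproj b v \<in> f ` {x \<in> V'. min_isotropy x = min_isotropy z}} \<subseteq> (\<Union>g\<in>carrier (cgroup b). kg g ` Fx)"
  proof clarify
    fix v x assume v: "v \<in> ?H" and x: "cproj b v = f x" "x \<in> V'" "min_isotropy x = min_isotropy z"
    obtain y where y: "y \<in> cmodel a" "y \<in> A" "x = cproj a y" using x(2) unfolding V'_def by blast
    have "\<forall>g\<in>carrier (cgroup a). caction a g y = y"
      using equal_isotropy_fixed[OF a(1) _ y(1) y(3)[symmetric]] a(4) x(3) by simp
    then have yF: "y \<in> Fx" unfolding Fx_def using y by blast
    have "k y \<in> ?H" "cproj b (k y) = cproj b v" using kN[of y] y x(1) unfolding A_def by auto
    then obtain g where "g \<in> carrier (cgroup b)" "v = caction b g (k y)"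
      using chart_onD(9)[OF chb, of "k y" v] v HM by blast
    then show "v \<in> (\<Union>g\<in>carrier (cgroup b). kg g ` Fx)" unfolding kg_def using yF by blast
  qed
  moreover have "null_in ?H (\<Union>g\<in>carrier (cgroup b). kg g ` Fx)"
    using finb null by (intro null_in_UN countable_finite)
  ultimately show ?thesis using V' null_in_subset by blast
qed

text \<open>Points that are not regular are sorted by their isotropy order \<open>m\<close>. For
  each \<open>m\<close> countably many neighbourhoods suffice, and there are countably many orders,
  so the bad values form a null set, which cannot contain a ball of the hyperplane.\<close>

lemma regular_fibre_exists:
  assumes sing: "singular_codim_gt_1 n X" and cpt: "compact_space TX" and ne: "topspace TX \<inter> BX \<noteq> {}"
  obtains p where "p \<in> BX" "p \<in> topspace TX" "\<And>x. x \<in> topspace TX \<Longrightarrow> f x = p \<Longrightarrow> x \<in> regular_points"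
proof -
  obtain x0 b where b: "x0 \<in> topspace TX" "b \<in> AX" "halfspace_model n (cmodel b)" "ccenter b = x0"
    using ne unfolding boundary_points_def by blast
  let ?H = "rel_frontier (cmodel b)"
  have H: "subspace ?H" using halfspace_model_structure[OF b(3)] by metis
  have HM: "?H \<subseteq> cmodel b" using rel_frontier_model[OF atlas_model[OF b(2)]] by blast
  have chb: "chart_on n TX b" by (rule atlas_chart[OF b(2)])
  define bad where "bad m = {v \<in> ?H. cproj b v \<in> f ` {x \<in> topspace TX - regular_points. min_isotropy x = m}}" for m
  have "null_in ?H (bad m)" for m
  proof -
    define Z where "Z = {x \<in> topspace TX - regular_points. min_isotropy x = m \<and> f x \<in> cnbhd b}"
    define good where "good z V \<longleftrightarrow> openin TX V \<and> z \<in> V \<and>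
      null_in ?H {v \<in> ?H. cproj b v \<in> f ` {x \<in> V. min_isotropy x = m}}" for z V
    have "\<exists>V. good z V" if z: "z \<in> Z" for z
      using singular_stratum_image_null[OF sing _ _ b(2,3), of z] z unfolding Z_def good_def by auto
    then obtain V where "\<And>z. z \<in> Z \<Longrightarrow> good z (V z)" by metis
    then have V: "\<And>z. z \<in> Z \<Longrightarrow> openin TX (V z) \<and> z \<in> V z"
      and null: "\<And>z. z \<in> Z \<Longrightarrow> null_in ?H {v \<in> ?H. cproj b v \<in> f ` {x \<in> V z. min_isotropy x = m}}"
      unfolding good_def by blast+
    obtain Z' where Z': "countable Z'" "Z' \<subseteq> Z" "Z \<subseteq> (\<Union>z\<in>Z'. V z)"
      using countable_subcover[OF cpt _ V, of Z] unfolding Z_def by blast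
    have "bad m \<subseteq> (\<Union>z\<in>Z'. {v \<in> ?H. cproj b v \<in> f ` {x \<in> V z. min_isotropy x = m}})"
    proof
      fix v assume v: "v \<in> bad m"
      then obtain x where x: "x \<in> topspace TX - regular_points" "min_isotropy x = m" "cproj b v = f x" and vH: "v \<in> ?H"
        unfolding bad_def by blast
      have "f x \<in> cnbhd b" unfolding x(3)[symmetric] using vH HM chart_image(1)[OF chb] by blast
      then have "x \<in> Z" unfolding Z_def using x by blast
      then obtain z where "z \<in> Z'" "x \<in> V z" using Z'(3) by blast
      then show "v \<in> (\<Union>z\<in>Z'. {v \<in> ?H. cproj b v \<in> f ` {x \<in> V z. min_isotropy x = m}})"
        using vH x(2,3) by blast
    qed
    then show ?thesis using null_in_UN[OF Z'(1)] null Z'(2) null_in_subset by (meson subsetD)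
  qed
  then have nullbad: "null_in ?H (\<Union>m. bad m)" by (intro null_in_UN) auto
  have "0 \<in> ?H" using zero_rel_frontier_halfspace[OF b(3)] .
  then have "\<not> null_in ?H (?H \<inter> ball 0 1)" by (intro not_null_in_ball[OF H]) auto
  then have "\<not> ?H \<subseteq> (\<Union>m. bad m)" using null_in_subset[OF nullbad, of "?H \<inter> ball 0 1"] by blast
  then obtain v where v: "v \<in> ?H" "\<And>m. v \<notin> bad m" by blast
  have vM: "v \<in> cmodel b" using v(1) HM by blast
  show ?thesis
  proof (rule that[of "cproj b v"])
    show "cproj b v \<in> BX" using boundary_point_iff_rel_frontier[OF b(2) vM] v(1) by simp
    show "cproj b v \<in> topspace TX"
      using vM chart_image(1)[OF chb] openin_subset[OF chart_onD(1)[OF chb]] by blast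
    show "x \<in> regular_points" if "x \<in> topspace TX" "f x = cproj b v" for x
      using v that unfolding bad_def by force
  qed
qed

end

section \<open>Bump functions and parity of fibres\<close>

lemma derivative_fixes_subspace:
  assumes "subspace H" "(k has_derivative K) (at 0)" "open N" "0 \<in> N" "\<And>v. v \<in> N \<Longrightarrow> v \<in> H \<Longrightarrow> k v = v" "h \<in> H"
  shows "K h = h"
proof -
  have "((\<lambda>t::real. t *\<^sub>R h) has_derivative (\<lambda>t. t *\<^sub>R h)) (at 0)" by (auto intro!: derivative_eq_intros)
  moreover have "(k has_derivative K) (at (0 *\<^sub>R h))" using assms(2) by simp
  ultimately have "((\<lambda>t. k (t *\<^sub>R h)) has_derivative (\<lambda>t. K (t *\<^sub>R h))) (at 0)" by (rule has_derivative_compose)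
  moreover have "open ((\<lambda>t::real. t *\<^sub>R h) -` N)"
    using assms(3) by (intro open_vimage continuous_intros)
  ultimately have "((\<lambda>t. t *\<^sub>R h) has_derivative (\<lambda>t. K (t *\<^sub>R h))) (at 0)"
    using assms by (elim has_derivative_transform_within_open) (auto simp: subspace_scale)
  moreover have "((\<lambda>t::real. t *\<^sub>R h) has_derivative (\<lambda>t. t *\<^sub>R h)) (at 0)" by (auto intro!: derivative_eq_intros)
  ultimately have "(\<lambda>t. K (t *\<^sub>R h)) = (\<lambda>t::real. t *\<^sub>R h)" by (rule has_derivative_unique)
  then show ?thesis by (metis scaleR_one)
qed

text \<open>A retraction onto the bounding hyperplane becomes the orthogonal projection in suitable
  coordinates \<open>G\<close> near \<open>0\<close>.\<close>

lemma straighten_retraction: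
  fixes M :: "'e::euclidean_space set"
  assumes Q: "subspace Q" and b: "b \<in> Q" "norm b = 1" and M: "M = {v \<in> Q. 0 \<le> b \<bullet> v}" and H: "H = {v \<in> Q. b \<bullet> v = 0}"
    and k: "C1_near M k 0" "open N" "0 \<in> N" "\<And>y. y \<in> N \<Longrightarrow> y \<in> M \<Longrightarrow> k y \<in> H" "\<And>y. y \<in> N \<Longrightarrow> y \<in> H \<Longrightarrow> k y = y"
  obtains G g U r where "open U" "0 \<in> U" "U \<subseteq> N" "C1_on G U" "0 < r"
    "\<And>y. y \<in> U \<Longrightarrow> y \<in> M \<Longrightarrow> G y = k y + (b \<bullet> y) *\<^sub>R b"
    "\<And>w. w \<in> ball 0 (2 * r) \<Longrightarrow> g w \<in> U \<and> G (g w) = w \<and> b \<bullet> g w = b \<bullet> w"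
    "\<And>w. w \<in> ball 0 (2 * r) \<Longrightarrow> w \<in> Q \<Longrightarrow> g w \<in> Q"
    "\<And>u. u \<in> U \<Longrightarrow> g (G u) = u" "continuous_on (ball 0 (2 * r)) g"
proof -
  have bb: "b \<bullet> b = 1" using b(2) by (simp add: dot_square_norm)
  have sH: "subspace H" unfolding H using Q by (auto simp: subspace_def inner_add_right)
  have HM: "H \<subseteq> M" unfolding H M by auto
  have HQ: "H \<subseteq> Q" unfolding H by auto
  let ?P = "oproj Q" and ?R = "oproj H"
  have bR: "b \<bullet> ?R u = 0" for u using oproj_in[OF sH, of u] unfolding H by auto
  have Rb: "?R b = 0"
  proof -
    have "(b - ?R b) \<bullet> ?R b = 0" using oproj_orth[OF sH, of "?R b" b] oproj_in[OF sH] by simp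
    then show ?thesis using bR[of b] by (simp add: inner_diff_left)
  qed
  have RQ: "u - ?R u = (b \<bullet> u) *\<^sub>R b" if u: "u \<in> Q" for u
  proof -
    have "u - (b \<bullet> u) *\<^sub>R b \<in> H" unfolding H using u b(1) Q bb by (simp add: subspace_diff subspace_scale inner_diff_right)
    then have "?R (u - (b \<bullet> u) *\<^sub>R b) = u - (b \<bullet> u) *\<^sub>R b" by (rule oproj_id[OF sH])
    then show ?thesis using Rb by (simp add: linear_diff[OF linear_oproj[OF sH]] linear_scale[OF linear_oproj[OF sH]])
  qed
  obtain N0 k0 where k0: "open N0" "0 \<in> N0" "C1_on k0 N0" "\<And>y. y \<in> N0 \<Longrightarrow> y \<in> M \<Longrightarrow> k0 y = k y"
    using k(1) unfolding C1_near_def by blast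
  define U0 where "U0 = (?P -` N0) \<inter> N"
  have U0: "open U0" unfolding U0_def using k0(1) k(2) continuous_on_oproj[OF Q, of UNIV] by (simp add: open_Int open_vimage)
  have zU0: "0 \<in> U0" unfolding U0_def using k0(2) k(3) linear_0[OF linear_oproj[OF Q]] by simp
  \<comment> \<open>The component in \<open>H\<close> is replaced by the retraction and the residual
    is kept. On \<open>M\<close> near \<open>0\<close> this is
    \<open>k y + (b \<bullet> y) b\<close>, as residuals of points of \<open>Q\<close> are multiples
    of \<open>b\<close>; the projections make it a map on an open set of the ambient space.\<close>
  define G where "G u = ?R (k0 (?P u)) + (u - ?R u)" for u
  have C1G: "C1_on G U0" unfolding G_def
    by (intro C1_on_add C1_on_diff C1_on_id C1_on_linear[OF linear_oproj[OF sH]] C1_on_linear_compose[OF linear_oproj[OF sH]]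
        C1_on_compose[OF C1_on_linear[OF linear_oproj[OF Q]] k0(3)]) (auto simp: U0_def)
  have GM: "G y = k y + (b \<bullet> y) *\<^sub>R b" if y: "y \<in> U0" "y \<in> M" for y
  proof -
    have yQ: "y \<in> Q" using y(2) M by auto
    then have "?P y = y" by (rule oproj_id[OF Q])
    then have "k0 (?P y) = k y" "k y \<in> H" using y k0(4) k(4) unfolding U0_def by auto
    then show ?thesis unfolding G_def using RQ[OF yQ] oproj_id[OF sH] by simp
  qed
  have GR: "G u - ?R (G u) = u - ?R u" for u
    unfolding G_def by (simp add: linear_add[OF linear_oproj[OF sH]] oproj_id[OF sH oproj_in[OF sH]] oproj_residual[OF sH])
  have bG: "b \<bullet> G u = b \<bullet> u" for u
    unfolding G_def by (simp add: inner_add_right inner_diff_right bR)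
  \<comment> \<open>\<open>G\<close> does not change the residual with respect to \<open>H\<close>,
    so it cannot bring a point from outside \<open>Q\<close> into \<open>Q\<close>. Hence the local
    inverse of \<open>G\<close> preserves \<open>Q\<close>.\<close>
  have GQ: "u \<in> Q" if "G u \<in> Q" for u
  proof -
    have "u = (G u - ?R (G u)) + ?R u" using GR[of u] by simp
    then show ?thesis using that oproj_in[OF sH] HQ Q by (metis subspace_add subspace_diff subsetD)
  qed
  obtain G' where G': "\<And>x. x \<in> U0 \<Longrightarrow> (G has_derivative blinfun_apply (G' x)) (at x)" "continuous_on U0 G'"
    using C1G unfolding C1_on_def by blast
  obtain K where K: "(k0 has_derivative K) (at 0)" using C1_on_imp_differentiable[OF k0(3,2)] unfolding differentiable_def by blast
  have P0: "?P 0 = 0" "?R 0 = 0" using linear_0[OF linear_oproj[OF Q]] linear_0[OF linear_oproj[OF sH]] by auto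
  have KH: "K h = h" if "h \<in> H" for h
    by (rule derivative_fixes_subspace[OF sH K, of "N0 \<inter> N"])
      (use k0 k HM that in \<open>auto simp: open_Int subset_iff\<close>)
  have dG: "blinfun_apply (G' 0) = (\<lambda>h. ?R (K (?P h)) + (h - ?R h))"
  proof -
    have lin: "(oproj S has_derivative oproj S) F" if "subspace S" for S :: "'e set" and F
      using linear_oproj[OF that] by (simp add: linear_conv_bounded_linear bounded_linear_imp_has_derivative)
    have "(k0 has_derivative K) (at (?P 0))" using K P0 by simp
    from has_derivative_compose[OF lin[OF Q] this]
    have "((\<lambda>u. k0 (?P u)) has_derivative (\<lambda>h. K (?P h))) (at 0)" .
    from has_derivative_compose[OF this lin[OF sH]]
    have "((\<lambda>u. ?R (k0 (?P u))) has_derivative (\<lambda>h. ?R (K (?P h)))) (at 0)" .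
    then have "(G has_derivative (\<lambda>h. ?R (K (?P h)) + (h - ?R h))) (at 0)"
      unfolding G_def by (intro derivative_intros lin[OF sH])
    then show ?thesis using G'(1)[OF zU0] has_derivative_unique by blast
  qed
  have lG: "linear (blinfun_apply (G' 0))" by (simp add: bounded_linear.linear blinfun.bounded_linear_right)
  \<comment> \<open>The derivative \<open>K\<close> of the extended retraction is the identity on
    \<open>H\<close>, because \<open>k\<close> is. A kernel vector has no residual, hence lies in
    \<open>H\<close>, and there the derivative of \<open>G\<close> is the identity.\<close>
  have inj: "inj (blinfun_apply (G' 0))"
  proof (subst linear_injective_0[OF lG], intro allI impI)
    fix h assume h0: "blinfun_apply (G' 0) h = 0"
    then have e: "?R (K (?P h)) + (h - ?R h) = 0" unfolding dG .
    then have "?R (?R (K (?P h)) + (h - ?R h)) = 0" using P0 by simp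
    then have "?R (K (?P h)) = 0"
      by (simp add: linear_add[OF linear_oproj[OF sH]] oproj_id[OF sH oproj_in[OF sH]] oproj_residual[OF sH])
    then have "h = ?R h" using e by simp
    then have hH: "h \<in> H" using oproj_in[OF sH] by metis
    then have "K (?P h) = h" using KH oproj_id[OF Q] HQ by auto
    then show "h = 0" using \<open>?R (K (?P h)) = 0\<close> \<open>h = ?R h\<close> by simp
  qed
  obtain L where L: "linear L" "L \<circ> blinfun_apply (G' 0) = id" using linear_injective_left_inverse[OF lG inj] by blast
  have "blinfun_apply (Blinfun L) = L" using L(1) by (simp add: bounded_linear_Blinfun_apply linear_conv_bounded_linear)
  then have inv: "Blinfun L o\<^sub>L G' 0 = id_blinfun"
    using L(2) by (intro blinfun_eqI) (simp add: fun_eq_iff)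
  obtain U V g where U: "open U" "U \<subseteq> U0" "0 \<in> U" "open V" "G 0 \<in> V" "homeomorphism U V G g"
    using inverse_function_theorem[OF U0 G' zU0 inv] by metis
  have zH: "0 \<in> H" using sH subspace_0 by blast
  then have "G 0 = 0" using GM[OF zU0] HM k(3,5) by auto
  then obtain s where s: "0 < s" "ball 0 s \<subseteq> V" using U(4,5) openE by metis
  have hg: "\<And>u. u \<in> U \<Longrightarrow> g (G u) = u" "\<And>w. w \<in> V \<Longrightarrow> G (g w) = w" "\<And>w. w \<in> V \<Longrightarrow> g w \<in> U" "continuous_on V g"
    using U(6) unfolding homeomorphism_def by blast+
  show ?thesis
  proof (rule that[of U G "s/2" g])
    show "U \<subseteq> N" using U(2) unfolding U0_def by blast
    show "C1_on G U" by (rule C1_on_subset[OF C1G U(2)])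
    show "G y = k y + (b \<bullet> y) *\<^sub>R b" if "y \<in> U" "y \<in> M" for y using GM that U(2) by blast
    show "g w \<in> U \<and> G (g w) = w \<and> b \<bullet> g w = b \<bullet> w" if "w \<in> ball 0 (2 * (s/2))" for w
    proof -
      have "w \<in> V" using that s(2) by auto
      then show ?thesis using hg(2,3) bG[of "g w"] by simp
    qed
    show "g w \<in> Q" if "w \<in> ball 0 (2 * (s/2))" "w \<in> Q" for w
    proof -
      have "w \<in> V" using that s(2) by auto
      then show ?thesis using hg(2) that(2) GQ by simp
    qed
    show "continuous_on (ball 0 (2 * (s/2))) g" using hg(4) s(2) by (auto intro: continuous_on_subset)
  qed (use U s hg in auto)
qed

text \<open>A function of the chart coordinate, extended by zero off the image of \<open>L\<close>.
  It is used for charts with trivial group, whose projection can be inverted.\<close>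

definition bump_fun :: "('p, 'e::euclidean_space, 'g) ochart \<Rightarrow> 'e set \<Rightarrow> ('e \<Rightarrow> real) \<Rightarrow> 'p \<Rightarrow> real" where
  "bump_fun c L \<eta> x = (if x \<in> cproj c ` L then \<eta> (inv_into (cmodel c) (cproj c) x) else 0)"

section \<open>Bumps on the orbifold and their effect on the parity\<close>

context bordered_orbifold
begin

text \<open>Differentiability is asked only at interior points of charts with trivial group. Bumps
  are supported there, so the parity argument never looks at singular or boundary points.\<close>

definition C1_regular :: "('p \<Rightarrow> real) \<Rightarrow> bool" where
  "C1_regular \<rho> \<longleftrightarrow> (\<forall>a\<in>AX. trivial_chart a \<longrightarrow>
     (\<forall>z\<in>rel_interior (cmodel a). C1_near (cmodel a) (\<lambda>y. \<rho> (cproj a y)) z))"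

text \<open>Two sets are recorded because the degree argument compares maps on an open set
  \<open>D\<close> that agree outside a compact set \<open>L\<close>. As \<open>D\<close> lies in
  the relative interior, a bump never reaches the boundary.\<close>

definition bump_datum :: "('p, 'e, 'g) ochart \<Rightarrow> 'e set \<Rightarrow> 'e set \<Rightarrow> ('e \<Rightarrow> real) \<Rightarrow> bool" where
  "bump_datum c D L \<eta> \<longleftrightarrow> c \<in> AX \<and> trivial_chart c \<and> openin (top_of_set (span (cmodel c))) D \<and>
     D \<subseteq> rel_interior (cmodel c) \<and> compact L \<and> L \<subseteq> D \<and> (\<forall>y\<in>D. C1_near D \<eta> y) \<and>
     (\<forall>y\<in>D - L. \<eta> y = 0) \<and> (\<forall>y\<in>D. 0 \<le> \<eta> y)"

lemma bump_datumD:
  assumes "bump_datum c D L \<eta>"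
  shows "c \<in> AX" "trivial_chart c" "openin (top_of_set (span (cmodel c))) D" "D \<subseteq> rel_interior (cmodel c)"
    "compact L" "L \<subseteq> D" "\<And>y. y \<in> D \<Longrightarrow> C1_near D \<eta> y" "\<And>y. y \<in> D \<Longrightarrow> y \<notin> L \<Longrightarrow> \<eta> y = 0" "\<And>y. y \<in> D \<Longrightarrow> 0 \<le> \<eta> y"
    "D \<subseteq> cmodel c" "inj_on (cproj c) (cmodel c)" "chart_on n TX c"
proof -
  show c: "c \<in> AX" "trivial_chart c" using assms unfolding bump_datum_def by auto
  show "chart_on n TX c" by (rule atlas_chart[OF c(1)])
  then show "inj_on (cproj c) (cmodel c)" by (rule trivial_chart_inj[OF _ c(2)])
qed (use assms rel_interior_subset[of "cmodel c"] in \<open>auto simp: bump_datum_def\<close>)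

lemma bump_fun_eq:
  assumes d: "bump_datum c D L \<eta>" and y: "y \<in> D"
  shows "bump_fun c L \<eta> (cproj c y) = \<eta> y"
proof (cases "y \<in> L")
  case True
  then show ?thesis using bump_datumD(10,11)[OF d] y unfolding bump_fun_def by (auto simp: subset_iff)
next
  case False
  have "cproj c y \<notin> cproj c ` L"

  proof
    assume "cproj c y \<in> cproj c ` L"
    then obtain l where l: "l \<in> L" "cproj c y = cproj c l" by blast
    then have "l \<in> cmodel c" "y \<in> cmodel c" using bump_datumD(6,10)[OF d] y by blast+
    then have "y = l" using inj_onD[OF bump_datumD(11)[OF d] l(2)] by blast
    then show False using False l(1) by simp
  qed
  then show ?thesis using bump_datumD(8)[OF d y False] unfolding bump_fun_def by simp
qed

lemma bump_fun_nonneg: "bump_datum c D L \<eta> \<Longrightarrow> 0 \<le> bump_fun c L \<eta> x"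
proof (cases "x \<in> cproj c ` L")
  case True
  assume d: "bump_datum c D L \<eta>"
  then obtain y where "y \<in> D" "x = cproj c y" using True bump_datumD(6) by blast
  then show ?thesis using bump_fun_eq[OF d] bump_datumD(9)[OF d] by simp
qed (simp add: bump_fun_def)

lemma closedin_bump_support:
  assumes d: "bump_datum c D L \<eta>" shows "closedin TX (cproj c ` L)"
proof -
  have "compactin (top_of_set (cmodel c)) L"
    using bump_datumD(5,6,10)[OF d] by (simp add: compactin_subtopology)
  then have "compactin TX (cproj c ` L)" by (rule image_compactin[OF _ chart_image(2)[OF bump_datumD(12)[OF d]]])
  then show ?thesis using Hausdorff_TX compactin_imp_closedin by blast
qed

lemma openin_model_of_span:
  assumes "openin (top_of_set (span M)) D" "D \<subseteq> M" shows "openin (top_of_set M) D"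
  using assms openin_subset_trans span_superset by blast

text \<open>Continuity of \<open>\<eta>\<close> and openness of the chart projection give a
  neighbourhood with a positive lower bound. Since bumps are nonnegative, such a bound passes to
  sums, which suits the compactness arguments.\<close>

lemma bump_fun_lower_bound:
  assumes d: "bump_datum c D L \<eta>" and x: "0 < bump_fun c L \<eta> x"
  shows "\<exists>V \<epsilon>. openin TX V \<and> x \<in> V \<and> 0 < \<epsilon> \<and> (\<forall>x'\<in>V. \<epsilon> \<le> bump_fun c L \<eta> x')"
proof -
  have "x \<in> cproj c ` L" using x unfolding bump_fun_def by (auto split: if_splits)
  then obtain y where y: "y \<in> D" "x = cproj c y" using bump_datumD(6)[OF d] by blast
  have pos: "0 < \<eta> y" using x y bump_fun_eq[OF d] by simp
  define E where "E = {y' \<in> D. \<eta> y / 2 < \<eta> y'}"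
  have "continuous_on D \<eta>" using bump_datumD(7)[OF d] by (rule C1_near_imp_continuous_on)
  then have "openin (top_of_set D) (D \<inter> \<eta> -` {\<eta> y / 2<..})" by (rule continuous_openin_preimage_gen) simp
  moreover have "D \<inter> \<eta> -` {\<eta> y / 2<..} = E" unfolding E_def by auto
  ultimately have "openin (top_of_set (cmodel c)) E"
    using openin_trans openin_model_of_span[OF bump_datumD(3,10)[OF d]] by metis
  then have "openin TX (cproj c ` E)" by (rule chart_open_map[OF bump_datumD(12)[OF d]])
  moreover have "x \<in> cproj c ` E" unfolding E_def using y pos by auto
  moreover have "\<eta> y / 2 \<le> bump_fun c L \<eta> x'" if "x' \<in> cproj c ` E" for x'
    using that bump_fun_eq[OF d] unfolding E_def by auto
  ultimately show ?thesis using pos by (intro exI[of _ "cproj c ` E"] exI[of _ "\<eta> y / 2"]) auto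
qed

text \<open>Over the image of \<open>D\<close> the bump is \<open>\<eta>\<close> after a transition
  map. Elsewhere it vanishes nearby, because its support is compact and hence closed in the
  Hausdorff space.\<close>

lemma C1_regular_bump:
  assumes d: "bump_datum c D L \<eta>" shows "C1_regular (bump_fun c L \<eta>)"
  unfolding C1_regular_def
proof (intro ballI impI)
  fix a z assume a: "a \<in> AX" "trivial_chart a" and z: "z \<in> rel_interior (cmodel a)"
  have zM: "z \<in> cmodel a" using z rel_interior_subset by blast
  have cha: "chart_on n TX a" by (rule atlas_chart[OF a(1)])
  show "C1_near (cmodel a) (\<lambda>y. bump_fun c L \<eta> (cproj a y)) z"
  proof (cases "cproj a z \<in> cproj c ` D")
    case True
    then obtain y where y: "y \<in> D" "cproj a z = cproj c y" by blast
    have yM: "y \<in> cmodel c" using y(1) bump_datumD(10)[OF d] by blast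
    obtain t N where t: "C1_near (cmodel a) t z" "open N" "z \<in> N"
      "\<And>y'. y' \<in> N \<Longrightarrow> y' \<in> cmodel a \<Longrightarrow> t y' \<in> cmodel c \<and> cproj c (t y') = cproj a y'"
      using transition_C1[OF a bump_datumD(1,2)[OF d] zM yM y(2)] by blast
    have "t z \<in> cmodel c" "cproj c (t z) = cproj c y" using t(4)[OF t(3) zM] y(2) by auto
    then have tz: "t z = y" using bump_datumD(11)[OF d] yM by (meson inj_onD)
    obtain S where S: "open S" "D = span (cmodel c) \<inter> S" using bump_datumD(3)[OF d] unfolding openin_open by auto
    have "t z \<in> S" using tz y(1) S(2) by auto
    then obtain N' where N': "open N'" "z \<in> N'" "\<And>y'. y' \<in> N' \<Longrightarrow> y' \<in> cmodel a \<Longrightarrow> t y' \<in> S"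
      using C1_near_eventually_in_open[OF t(1) zM S(1)] by blast
    have tD: "t y' \<in> D" if "y' \<in> N \<inter> N'" "y' \<in> cmodel a" for y'
      using t(4)[of y'] N'(3)[of y'] that S(2) span_base by blast
    have "C1_near (cmodel a) (\<lambda>y. \<eta> (t y)) z"
    proof (rule C1_near_compose[OF t(1) _ zM])
      show "C1_near D \<eta> (t z)" unfolding tz by (rule bump_datumD(7)[OF d y(1)])
      show "open (N \<inter> N')" "z \<in> N \<inter> N'" using t N' by auto
    qed (rule tD)
    then show ?thesis
    proof (rule C1_near_mono[of _ _ _ "N \<inter> N'"])
      show "y' \<in> cmodel a \<and> \<eta> (t y') = bump_fun c L \<eta> (cproj a y')" if "y' \<in> N \<inter> N'" "y' \<in> cmodel a" for y'
        using bump_fun_eq[OF d tD[OF that]] t(4)[of y'] that by simp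
    qed (use t N' in auto)
  next
    case False
    define S where "S = {y \<in> cmodel a. cproj a y \<in> topspace TX - cproj c ` L}"
    have "openin TX (topspace TX - cproj c ` L)" using closedin_bump_support[OF d] by blast
    then have "openin (top_of_set (cmodel a)) S"
      unfolding S_def using openin_continuous_map_preimage[OF chart_image(2)[OF cha]] by fastforce
    then obtain N where N: "open N" "S = cmodel a \<inter> N" unfolding openin_open by auto
    have top: "cproj a y \<in> topspace TX" if "y \<in> cmodel a" for y
      using that chart_image(1)[OF cha] openin_subset[OF chart_onD(1)[OF cha]] by blast
    have "z \<in> N" using False bump_datumD(6)[OF d] zM N(2) top[OF zM] unfolding S_def by blast
    with C1_near_const[of "cmodel a" 0 z] N(1) show ?thesis
    proof (rule C1_near_mono)
      fix y assume "y \<in> N" "y \<in> cmodel a"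
      then have "y \<in> S" using N(2) by blast
      then show "y \<in> cmodel a \<and> 0 = bump_fun c L \<eta> (cproj a y)" unfolding S_def bump_fun_def by auto
    qed
  qed
qed

lemma C1_regular_add: "C1_regular \<rho> \<Longrightarrow> C1_regular \<sigma> \<Longrightarrow> C1_regular (\<lambda>x. \<rho> x + \<sigma> x)"
  unfolding C1_regular_def by (auto intro: C1_near_add)

lemma C1_regular_zero: "C1_regular (\<lambda>_. 0)"
  unfolding C1_regular_def by (auto intro: C1_near_const)

text \<open>The pair \<open>(\<phi>, \<rho>)\<close> is coded as the vector
  \<open>\<phi> x + \<rho> x b\<close> of \<open>Q\<close>. The isometry \<open>J\<close> identifies
  \<open>Q\<close> with the span of the chart model; in the chart the pair becomes a map from an
  open subset of \<open>Q\<close> to \<open>Q\<close>, altered by the bump only on the compact set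
  \<open>L'\<close>. As the group is trivial, solutions in the chart correspond one to one to
  solutions in the orbifold.\<close>

lemma bump_parity_step:
  fixes Q :: "'e set" and \<phi> :: "'p \<Rightarrow> 'e"
  assumes d: "bump_datum c D L \<eta>" and rho: "C1_regular \<rho>" and Q: "subspace Q" "dim Q = n" "b \<in> Q"
    and \<phi>: "\<And>y. y \<in> D \<Longrightarrow> C1_near D (\<lambda>y. \<phi> (cproj c y)) y" "\<And>y. y \<in> D \<Longrightarrow> \<phi> (cproj c y) \<in> Q"
  shows "\<exists>B. null_in Q B \<and> (\<forall>q. q \<in> Q \<longrightarrow> q \<notin> B \<longrightarrow>
     finite {x \<in> cproj c ` L. \<phi> x + \<rho> x *\<^sub>R b = q} \<and>
     finite {x \<in> cproj c ` L. \<phi> x + (\<rho> x + bump_fun c L \<eta> x) *\<^sub>R b = q} \<and>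
     (even (card {x \<in> cproj c ` L. \<phi> x + \<rho> x *\<^sub>R b = q}) \<longleftrightarrow>
      even (card {x \<in> cproj c ` L. \<phi> x + (\<rho> x + bump_fun c L \<eta> x) *\<^sub>R b = q})))"
proof -
  let ?S = "span (cmodel c)"
  have dimS: "dim ?S = n" by (rule chart_model_dim[OF atlas_model[OF bump_datumD(1)[OF d]]])
  obtain J where J: "linear J" "J ` Q = ?S" "\<And>x. x \<in> Q \<Longrightarrow> norm (J x) = norm x"
    using isometry_subspaces[OF Q(1) subspace_span] dimS Q(2) by metis
  have contJ: "continuous_on A J" for A using J(1) by (auto intro: linear_continuous_on simp: linear_conv_bounded_linear)
  have injJ: "inj_on J Q"
  proof (rule inj_onI)
    fix x y assume xy: "x \<in> Q" "y \<in> Q" "J x = J y"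
    then have "norm (J (x - y)) = 0" by (simp add: linear_diff[OF J(1)])
    then show "x = y" using J(3)[of "x - y"] xy Q(1) by (simp add: subspace_diff)
  qed
  define D' where "D' = Q \<inter> J -` D"
  define L' where "L' = Q \<inter> J -` L"
  have D': "openin (top_of_set Q) D'"
    unfolding D'_def using continuous_openin_preimage[OF contJ[of Q] _ bump_datumD(3)[OF d]] J(2) by blast
  have JL: "J ` L' = L"

  proof (intro equalityI subsetI)
    fix x assume x: "x \<in> L"
    then have "x \<in> J ` Q" unfolding J(2) using bump_datumD(6)[OF d] openin_imp_subset[OF bump_datumD(3)[OF d]] by blast
    then show "x \<in> J ` L'" using x unfolding L'_def by blast
  qed (auto simp: L'_def)
  have cL': "compact L'"
  proof -
    have "closed L'" unfolding L'_def
      by (rule continuous_closed_preimage[OF contJ closed_subspace[OF Q(1)] compact_imp_closed[OF bump_datumD(5)[OF d]]])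
    moreover obtain e where e: "\<And>x. x \<in> L \<Longrightarrow> norm x \<le> e"
      using compact_imp_bounded[OF bump_datumD(5)[OF d]] unfolding bounded_iff by blast
    have "bounded L'" unfolding bounded_iff L'_def using e J(3) by (metis IntE vimageE)
    ultimately show ?thesis by (simp add: compact_eq_bounded_closed)
  qed
  have LD': "L' \<subseteq> D'" unfolding L'_def D'_def using bump_datumD(6)[OF d] by blast
  have C1J: "C1_near D' (\<lambda>x. F (J x)) x" if F: "\<And>y. y \<in> D \<Longrightarrow> C1_near D F y" and x: "x \<in> D'" for F :: "'e \<Rightarrow> 'e" and x
  proof (rule C1_near_compose[where f=J and g=F and M'=D and N=UNIV])
    show "C1_near D' J x" by (rule C1_nearI[OF open_UNIV UNIV_I C1_on_linear[OF J(1)]]) simp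
    show "C1_near D F (J x)" using F x unfolding D'_def by auto
  qed (use x in \<open>auto simp: D'_def\<close>)
  have C1comp: "C1_near D (\<lambda>y. \<phi> (cproj c y) + \<sigma> (cproj c y) *\<^sub>R b) y" if s: "C1_regular \<sigma>" and y: "y \<in> D" for \<sigma> y
  proof -
    have "C1_near (cmodel c) (\<lambda>y. \<sigma> (cproj c y)) y"
      using s y bump_datumD(1,2,4)[OF d] unfolding C1_regular_def by blast
    then have "C1_near D (\<lambda>y. \<sigma> (cproj c y)) y"
      by (rule C1_near_mono[OF _ open_UNIV]) (use bump_datumD(10)[OF d] in auto)
    then show ?thesis using \<phi>(1)[OF y] by (intro C1_near_add C1_near_scaleR_const)
  qed
  define v where "v \<sigma> y = \<phi> (cproj c y) + \<sigma> (cproj c y) *\<^sub>R b" for \<sigma> y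
  define \<rho>' where "\<rho>' x = \<rho> x + bump_fun c L \<eta> x" for x
  have r': "C1_regular \<rho>'" unfolding \<rho>'_def by (intro C1_regular_add rho C1_regular_bump[OF d])
  have inQ: "v \<sigma> (J x) \<in> Q" if "x \<in> D'" for \<sigma> x
    unfolding v_def using \<phi>(2) that Q unfolding D'_def by (auto intro: subspace_add subspace_scale)
  have eq: "v \<rho> (J x) = v \<rho>' (J x)" if "x \<in> D'" "x \<notin> L'" for x
  proof -
    have "J x \<in> D" "J x \<notin> L" using that unfolding D'_def L'_def by auto
    then have "bump_fun c L \<eta> (cproj c (J x)) = 0" using bump_fun_eq[OF d] bump_datumD(8)[OF d] by simp
    then show ?thesis unfolding v_def \<rho>'_def by simp
  qed
  have "\<exists>B. null_in Q B \<and> (\<forall>q. q \<in> Q \<longrightarrow> q \<notin> B \<longrightarrow> finite {x\<in>L'. v \<rho> (J x) = q} \<and> finite {x\<in>L'. v \<rho>' (J x) = q} \<and>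
           (even (card {x\<in>L'. v \<rho> (J x) = q}) \<longleftrightarrow> even (card {x\<in>L'. v \<rho>' (J x) = q})))"
  proof (rule degree_parity_subspace[OF Q(1) D' cL' LD'])
    show "C1_near D' (\<lambda>x. v \<rho> (J x)) x" "C1_near D' (\<lambda>x. v \<rho>' (J x)) x" if "x \<in> D'" for x
      by (rule C1J[OF _ that]; simp add: v_def C1comp[OF rho] C1comp[OF r'])+
  qed (use inQ eq in auto)
  then obtain B where B: "null_in Q B" and par: "\<And>q. q \<in> Q \<Longrightarrow> q \<notin> B \<Longrightarrow> finite {x\<in>L'. v \<rho> (J x) = q} \<and> finite {x\<in>L'. v \<rho>' (J x) = q} \<and>
           (even (card {x\<in>L'. v \<rho> (J x) = q}) \<longleftrightarrow> even (card {x\<in>L'. v \<rho>' (J x) = q}))" by blast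
  have L'Q: "L' \<subseteq> Q" unfolding L'_def by blast
  have LM: "L \<subseteq> cmodel c" using bump_datumD(6,10)[OF d] by blast
  have inj: "inj_on (\<lambda>x. cproj c (J x)) L'"
  proof (rule inj_onI)
    fix x y assume xy: "x \<in> L'" "y \<in> L'" "cproj c (J x) = cproj c (J y)"
    then have "J x \<in> cmodel c" "J y \<in> cmodel c" using LM unfolding L'_def by auto
    then have "J x = J y" using bump_datumD(11)[OF d] xy(3) by (meson inj_onD)
    then show "x = y" using injJ xy(1,2) L'Q by (meson inj_onD subsetD)
  qed
  have im: "{x \<in> cproj c ` L. \<phi> x + \<sigma> x *\<^sub>R b = q} = (\<lambda>x. cproj c (J x)) ` {x \<in> L'. v \<sigma> (J x) = q}" for \<sigma> q
    unfolding JL[symmetric] v_def by auto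
  have inj': "inj_on (\<lambda>x. cproj c (J x)) {x \<in> L'. v \<sigma> (J x) = q}" for \<sigma> q
    by (rule inj_on_subset[OF inj]) auto
  show ?thesis
    unfolding \<rho>'_def[symmetric] im using B par by (auto simp: card_image[OF inj'] finite_image_iff[OF inj'])
qed

text \<open>The condition that \<open>b \<bullet> q\<close> is nonzero excludes solutions in the
  base case, as \<open>\<phi>\<close> has no component along \<open>b\<close>. In the induction
  step, solutions off the support of the new bump are the same before and after; they form
  \<open>?O\<close>.\<close>

lemma bump_sum_parity:
  fixes Q :: "'e set" and \<phi> :: "'p \<Rightarrow> 'e"
  assumes fin: "finite I" and d: "\<And>i. i \<in> I \<Longrightarrow> bump_datum (c i) (D i) (L i) (\<eta> i)"
    and Q: "subspace Q" "dim Q = n" "b \<in> Q"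
    and \<phi>: "\<And>i y. i \<in> I \<Longrightarrow> y \<in> D i \<Longrightarrow> C1_near (D i) (\<lambda>y. \<phi> (cproj (c i) y)) y"
      "\<And>x. x \<in> E \<Longrightarrow> \<phi> x \<in> Q \<and> b \<bullet> \<phi> x = 0" "\<And>i. i \<in> I \<Longrightarrow> cproj (c i) ` D i \<subseteq> E"
  shows "C1_regular (\<lambda>x. \<Sum>i\<in>I. bump_fun (c i) (L i) (\<eta> i) x) \<and>
    (\<exists>B. null_in Q B \<and> (\<forall>q. q \<in> Q \<longrightarrow> q \<notin> B \<longrightarrow> b \<bullet> q \<noteq> 0 \<longrightarrow>
     finite {x \<in> E. \<phi> x + (\<Sum>i\<in>I. bump_fun (c i) (L i) (\<eta> i) x) *\<^sub>R b = q} \<and>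
     even (card {x \<in> E. \<phi> x + (\<Sum>i\<in>I. bump_fun (c i) (L i) (\<eta> i) x) *\<^sub>R b = q})))"
  using fin d \<phi>(1,3)
proof (induction I rule: finite_induct)
  case empty
  have e: "{x \<in> E. \<phi> x = q} = {}" if "b \<bullet> q \<noteq> 0" for q using \<phi>(2) that by auto
  have "null_in Q {}" unfolding null_in_def by simp
  then show ?case using C1_regular_zero by (intro conjI exI[of _ "{}"]) (simp_all add: e)
next
  case (insert j I)
  define \<rho> where "\<rho> x = (\<Sum>i\<in>I. bump_fun (c i) (L i) (\<eta> i) x)" for x
  have dj: "bump_datum (c j) (D j) (L j) (\<eta> j)" using insert.prems(1) by simp
  have IH: "C1_regular \<rho>" "\<exists>B. null_in Q B \<and> (\<forall>q. q \<in> Q \<longrightarrow> q \<notin> B \<longrightarrow> b \<bullet> q \<noteq> 0 \<longrightarrow>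
     finite {x \<in> E. \<phi> x + \<rho> x *\<^sub>R b = q} \<and> even (card {x \<in> E. \<phi> x + \<rho> x *\<^sub>R b = q}))"
    using insert.IH insert.prems unfolding \<rho>_def by simp_all
  obtain B1 where B1: "null_in Q B1" "\<And>q. q \<in> Q \<Longrightarrow> q \<notin> B1 \<Longrightarrow> b \<bullet> q \<noteq> 0 \<Longrightarrow>
     finite {x \<in> E. \<phi> x + \<rho> x *\<^sub>R b = q} \<and> even (card {x \<in> E. \<phi> x + \<rho> x *\<^sub>R b = q})" using IH(2) by blast
  have jE: "cproj (c j) ` D j \<subseteq> E" using insert.prems(3) by simp
  let ?S = "cproj (c j) ` L j" and ?r = "\<lambda>x. \<rho> x + bump_fun (c j) (L j) (\<eta> j) x"
  have SE: "?S \<subseteq> E" using jE bump_datumD(6)[OF dj] by blast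
  obtain B2 where B2: "null_in Q B2" "\<And>q. q \<in> Q \<Longrightarrow> q \<notin> B2 \<Longrightarrow>
     finite {x \<in> ?S. \<phi> x + \<rho> x *\<^sub>R b = q} \<and> finite {x \<in> ?S. \<phi> x + ?r x *\<^sub>R b = q} \<and>
     (even (card {x \<in> ?S. \<phi> x + \<rho> x *\<^sub>R b = q}) \<longleftrightarrow> even (card {x \<in> ?S. \<phi> x + ?r x *\<^sub>R b = q}))"
    using bump_parity_step[OF dj IH(1) Q, of \<phi>] insert.prems(2)[of j] \<phi>(2) jE by blast
  have "finite {x \<in> E. \<phi> x + ?r x *\<^sub>R b = q} \<and> even (card {x \<in> E. \<phi> x + ?r x *\<^sub>R b = q})"
    if q: "q \<in> Q" "q \<notin> B1 \<union> B2" "b \<bullet> q \<noteq> 0" for q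
  proof -
    let ?O = "{x \<in> E - ?S. \<phi> x + \<rho> x *\<^sub>R b = q}"
    have s1: "{x \<in> E. \<phi> x + \<rho> x *\<^sub>R b = q} = {x \<in> ?S. \<phi> x + \<rho> x *\<^sub>R b = q} \<union> ?O" using SE by auto
    have s2: "{x \<in> E. \<phi> x + ?r x *\<^sub>R b = q} = {x \<in> ?S. \<phi> x + ?r x *\<^sub>R b = q} \<union> ?O"
      using SE by (auto simp: bump_fun_def)
    have f1: "finite {x \<in> E. \<phi> x + \<rho> x *\<^sub>R b = q}" "even (card {x \<in> E. \<phi> x + \<rho> x *\<^sub>R b = q})"
      using B1(2)[of q] q by auto
    have f2: "finite {x \<in> ?S. \<phi> x + \<rho> x *\<^sub>R b = q}" "finite {x \<in> ?S. \<phi> x + ?r x *\<^sub>R b = q}"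
      "even (card {x \<in> ?S. \<phi> x + \<rho> x *\<^sub>R b = q}) \<longleftrightarrow> even (card {x \<in> ?S. \<phi> x + ?r x *\<^sub>R b = q})"
      using B2(2)[of q] q by auto
    have fO: "finite ?O" using f1(1) by (rule finite_subset[rotated]) auto
    have "card {x \<in> E. \<phi> x + \<rho> x *\<^sub>R b = q} = card {x \<in> ?S. \<phi> x + \<rho> x *\<^sub>R b = q} + card ?O"
      unfolding s1 by (rule card_Un_disjoint[OF f2(1) fO]) auto
    moreover have "card {x \<in> E. \<phi> x + ?r x *\<^sub>R b = q} = card {x \<in> ?S. \<phi> x + ?r x *\<^sub>R b = q} + card ?O"
      unfolding s2 by (rule card_Un_disjoint[OF f2(2) fO]) auto
    ultimately have "even (card {x \<in> E. \<phi> x + ?r x *\<^sub>R b = q})"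
      using f1(2) f2(3) by (simp only: even_add)
    moreover have "finite {x \<in> E. \<phi> x + ?r x *\<^sub>R b = q}" unfolding s2 using f2(2) fO by simp
    ultimately show ?thesis by blast
  qed
  moreover have "null_in Q (B1 \<union> B2)" by (rule null_in_Un[OF B1(1) B2(1)])
  moreover have "C1_regular ?r" by (rule C1_regular_add[OF IH(1) C1_regular_bump[OF dj]])
  moreover have "(\<Sum>i\<in>insert j I. bump_fun (c i) (L i) (\<eta> i) x) = ?r x" for x
    unfolding \<rho>_def using insert.hyps by (simp add: add.commute)
  ultimately show ?case by auto
qed

end

section \<open>Contradiction\<close>

context boundary_retraction
begin

lemma no_smooth_retraction:
  assumes sing: "singular_codim_gt_1 n X" and cpt: "compact_space TX" and ne: "topspace TX \<inter> BX \<noteq> {}"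
  shows False
proof -

  \<comment> \<open>The point \<open>p\<close> and straightened coordinates near it\<close>
  obtain p where p: "p \<in> BX" "p \<in> topspace TX" and reg: "\<And>x. x \<in> topspace TX \<Longrightarrow> f x = p \<Longrightarrow> x \<in> regular_points"
    using regular_fibre_exists[OF sing cpt ne] by blast
  have fp: "f p = p" by (rule f_boundary[OF p])
  have "p \<in> regular_points" using reg p(2) fp by blast
  then obtain c0 where c0: "c0 \<in> AX" "ccenter c0 = p" "trivial_chart c0" unfolding regular_points_def by blast
  obtain V W where VW: "openin TX V" "p \<in> V" "openin TX W" "f p \<in> W" and lift:
    "\<And>a b. a \<in> AX \<Longrightarrow> ccenter a = p \<Longrightarrow> cnbhd a \<subseteq> V \<Longrightarrow> b \<in> AX \<Longrightarrow> ccenter b = f p \<Longrightarrow> cnbhd b \<subseteq> W \<Longrightarrow>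
      \<exists>k N. C1_near (cmodel a) k 0 \<and> k 0 = 0 \<and> open N \<and> 0 \<in> N \<and>
        (\<forall>y\<in>N \<inter> cmodel a. k y \<in> rel_frontier (cmodel b) \<and> cproj b (k y) = f (cproj a y))"
    using local_lift[OF p(2)] by blast
  have "openin TX (V \<inter> W \<inter> cnbhd c0)" "p \<in> V \<inter> W \<inter> cnbhd c0"
    using VW chart_onD(1,2)[OF atlas_chart[OF c0(1)]] c0(2) fp by (simp_all add: openin_Int)
  \<comment> \<open>\<open>V\<close> and \<open>W\<close> make the chart small enough for the lift,
    and \<open>c0\<close> forces its group to be trivial. Since \<open>f p = p\<close>, the same
    chart serves as source and target.\<close>
  then obtain b where b: "b \<in> AX" "ccenter b = p" and bs: "cnbhd b \<subseteq> V \<inter> W \<inter> cnbhd c0" using atlas_small by blast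
  have bsub: "cnbhd b \<subseteq> V" "cnbhd b \<subseteq> W" "cnbhd b \<subseteq> cnbhd c0" using bs by auto
  have chb: "chart_on n TX b" by (rule atlas_chart[OF b(1)])
  have trb: "trivial_chart b"
    by (rule trivial_chart_embeds[OF atlas_embeds[OF b(1) c0(1) bsub(3)] c0(3) chart_group[OF chb]])
  have hb: "halfspace_model n (cmodel b)" by (rule halfspace_at_boundary_point[OF p(1) b])
  have injb: "inj_on (cproj b) (cmodel b)" by (rule trivial_chart_inj[OF chb trb])
  define M where "M = cmodel b"
  define Q where "Q = span M"
  define H where "H = rel_frontier M"
  have "\<exists>k N. C1_near (cmodel b) k 0 \<and> k 0 = 0 \<and> open N \<and> 0 \<in> N \<and>
        (\<forall>y\<in>N \<inter> cmodel b. k y \<in> rel_frontier (cmodel b) \<and> cproj b (k y) = f (cproj b y))"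
    by (rule lift[OF b bsub(1) b(1) _ bsub(2)]) (simp add: b(2) fp)
  then obtain k N where k: "C1_near M k 0" "open N" "0 \<in> N"
    and kN: "\<And>y. y \<in> N \<Longrightarrow> y \<in> M \<Longrightarrow> k y \<in> H \<and> cproj b (k y) = f (cproj b y)"
    unfolding M_def H_def by blast
  have hM: "halfspace_model n M" using hb unfolding M_def .
  obtain \<beta> where struct: "\<beta> \<in> span M" "norm \<beta> = 1" "M = {v \<in> span M. 0 \<le> \<beta> \<bullet> v}" "dim (span M) = n"
    "rel_interior M = {v \<in> span M. 0 < \<beta> \<bullet> v}" "rel_frontier M = {v \<in> span M. \<beta> \<bullet> v = 0}"
    "subspace (rel_frontier M)" "dim (rel_frontier M) = n - 1" "0 < n"
    by (rule halfspace_model_structure[OF hM]) (rule that)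
  have \<beta>: "\<beta> \<in> Q" "norm \<beta> = 1" and Meq: "M = {v \<in> Q. 0 \<le> \<beta> \<bullet> v}" and dimQ: "dim Q = n"
    and int: "rel_interior M = {v \<in> Q. 0 < \<beta> \<bullet> v}" and Heq: "H = {v \<in> Q. \<beta> \<bullet> v = 0}"
    using struct(1-6) unfolding Q_def H_def by blast+
  have sQ: "subspace Q" unfolding Q_def by simp
  have memM: "y \<in> M \<longleftrightarrow> y \<in> Q \<and> 0 \<le> \<beta> \<bullet> y" for y unfolding Meq by simp
  have memH: "y \<in> H \<longleftrightarrow> y \<in> Q \<and> \<beta> \<bullet> y = 0" for y unfolding Heq by simp
  have meml: "y \<in> rel_interior M \<longleftrightarrow> y \<in> Q \<and> 0 < \<beta> \<bullet> y" for y unfolding int by simp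
  have HM: "H \<subseteq> M" using memM memH by auto
  have bb: "\<beta> \<bullet> \<beta> = 1" using \<beta>(2) by (simp add: dot_square_norm)
  have injM: "inj_on (cproj b) M" unfolding M_def by (rule injb)
  have imM: "cproj b ` M = cnbhd b" unfolding M_def by (rule chart_image(1)[OF chb])
  have topb: "cproj b y \<in> topspace TX" if "y \<in> M" for y
    using that imM openin_subset[OF chart_onD(1)[OF chb]] by blast
  have zM: "0 \<in> M" "cproj b 0 = p" unfolding M_def using atlas_center[OF b(1)] b(2) by auto
  have bdM: "cproj b y \<in> BX \<longleftrightarrow> y \<in> H" if "y \<in> M" for y
    using boundary_point_iff_rel_frontier[OF b(1)] that unfolding M_def H_def by blast
  \<comment> \<open>\<open>f\<close> fixes boundary points and \<open>cproj b\<close> is injective,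
    so the lift is the identity on the bounding hyperplane, as \<open>straighten_retraction\<close>
    requires.\<close>
  have kH: "k y = y" if y: "y \<in> N" "y \<in> H" for y
  proof -
    have yM: "y \<in> M" using y HM by blast
    have "cproj b (k y) = cproj b y" using kN[OF y(1) yM] f_boundary[OF _ topb[OF yM]] bdM[OF yM] y(2) by simp
    then show ?thesis using injM kN[OF y(1) yM] HM yM by (meson inj_onD subsetD)
  qed
  obtain G g U r where U: "open U" "0 \<in> U" "U \<subseteq> N" "C1_on G U" and r: "0 < r"
    and GM: "\<And>y. y \<in> U \<Longrightarrow> y \<in> M \<Longrightarrow> G y = k y + (\<beta> \<bullet> y) *\<^sub>R \<beta>"
    and g: "\<And>w. w \<in> ball 0 (2 * r) \<Longrightarrow> g w \<in> U \<and> G (g w) = w \<and> \<beta> \<bullet> g w = \<beta> \<bullet> w"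
    and gQ: "\<And>w. w \<in> ball 0 (2 * r) \<Longrightarrow> w \<in> Q \<Longrightarrow> g w \<in> Q"
    and gG: "\<And>u. u \<in> U \<Longrightarrow> g (G u) = u" and contg: "continuous_on (ball 0 (2 * r)) g"
  proof (rule straighten_retraction[OF sQ \<beta> Meq Heq k(1-3)])
    show "k y \<in> H" if "y \<in> N" "y \<in> M" for y using kN[OF that] by blast
    show "k y = y" if "y \<in> N" "y \<in> H" for y by (rule kH[OF that])
  qed (rule that)
  have kU: "k y \<in> H" "cproj b (k y) = f (cproj b y)" if "y \<in> U" "y \<in> M" for y
    using kN U(3) that by blast+
  have GQ: "G y \<in> Q" "\<beta> \<bullet> G y = \<beta> \<bullet> y" "G y - (\<beta> \<bullet> y) *\<^sub>R \<beta> = k y" if "y \<in> U" "y \<in> M" for y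
    using GM[OF that] kU(1)[OF that] memH \<beta>(1) sQ bb by (auto simp: subspace_add subspace_scale inner_add_right)
  have gM: "g w \<in> M" if "w \<in> ball 0 (2 * r)" "w \<in> Q" "0 \<le> \<beta> \<bullet> w" for w
    using g[OF that(1)] gQ[OF that(1,2)] that(3) memM by simp
  have contG: "continuous_on U G" by (rule C1_on_imp_continuous_on[OF U(4)])

  \<comment> \<open>The boundary coordinate \<open>\<phi>\<close> of the retraction\<close>
  define E where "E = {x \<in> topspace TX. f x \<in> cnbhd b}"
  define \<phi> where "\<phi> x = inv_into H (cproj b) (f x)" for x
  have phi: "\<phi> x \<in> H" "cproj b (\<phi> x) = f x" if x: "x \<in> E" for x
  proof -
    have "f x \<in> cproj b ` M" using x imM unfolding E_def by simp
    then obtain y where y: "y \<in> M" "f x = cproj b y" by blast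
    have "f x \<in> BX" using f_in x unfolding E_def by blast
    then have "f x \<in> cproj b ` H" using bdM[OF y(1)] y(2) by simp
    then show "\<phi> x \<in> H" "cproj b (\<phi> x) = f x" unfolding \<phi>_def by (rule inv_into_into, rule f_inv_into_f)
  qed
  have phi_eq: "\<phi> x = v" if v: "v \<in> H" "cproj b v = f x" for x v
    unfolding \<phi>_def v(2)[symmetric] by (rule inv_into_f_f[OF inj_on_subset[OF injM HM] v(1)])
  have EI: "x \<in> E" if "x \<in> topspace TX" "v \<in> H" "cproj b v = f x" for x v
  proof -
    have "cproj b v \<in> cnbhd b" using that(2) HM imM by blast
    then show ?thesis using that unfolding E_def by simp
  qed

  \<comment> \<open>The bump in the collar\<close>
  define D0 where "D0 = {y \<in> U \<inter> rel_interior M. G y \<in> ball 0 (2 * r)}"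
  define L0 where "L0 = g ` (cball (r *\<^sub>R \<beta>) (r/2) \<inter> Q)"
  \<comment> \<open>In straightened coordinates, a bump about \<open>r \<beta>\<close> of radius
    \<open>r/2\<close>. On the ray from \<open>0\<close> in direction \<open>\<beta>\<close>, on
    which the fibre of \<open>p\<close> lies there, it is positive exactly for heights strictly
    between \<open>r/2\<close> and \<open>3 r/2\<close>, and it increases from height
    \<open>r/2\<close> to height \<open>r\<close>.\<close>
  define \<eta>0 where "\<eta>0 y = ramp_sq ((r/2)\<^sup>2 - (G y - r *\<^sub>R \<beta>) \<bullet> (G y - r *\<^sub>R \<beta>))" for y
  have eta0_0: "\<eta>0 y = 0" if "r/2 \<le> norm (G y - r *\<^sub>R \<beta>)" for y
  proof -
    have "(r/2)\<^sup>2 \<le> (norm (G y - r *\<^sub>R \<beta>))\<^sup>2" using that r by (intro power_mono) auto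
    then show ?thesis unfolding \<eta>0_def by (simp add: dot_square_norm)
  qed
  have cb: "w \<in> ball 0 (2 * r)" "0 < \<beta> \<bullet> w" if w: "w \<in> cball (r *\<^sub>R \<beta>) (r/2)" for w
  proof -
    have d: "norm (w - r *\<^sub>R \<beta>) \<le> r/2" using w by (simp add: dist_norm norm_minus_commute)
    have "norm w \<le> norm (w - r *\<^sub>R \<beta>) + norm (r *\<^sub>R \<beta>)" using norm_triangle_ineq[of "w - r *\<^sub>R \<beta>" "r *\<^sub>R \<beta>"] by simp
    then show "w \<in> ball 0 (2 * r)" using d \<beta>(2) r by simp
    have "\<bar>\<beta> \<bullet> (w - r *\<^sub>R \<beta>)\<bar> \<le> norm \<beta> * norm (w - r *\<^sub>R \<beta>)" by (rule Cauchy_Schwarz_ineq2)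
    then have "\<bar>\<beta> \<bullet> w - r\<bar> \<le> r/2" using d \<beta>(2) bb by (simp add: inner_diff_right)
    then show "0 < \<beta> \<bullet> w" using r by linarith
  qed
  have L0D0: "L0 \<subseteq> D0"
  proof
    fix y assume "y \<in> L0"
    then obtain w where w: "w \<in> cball (r *\<^sub>R \<beta>) (r/2)" "w \<in> Q" "y = g w" unfolding L0_def by blast
    then show "y \<in> D0" unfolding D0_def using g[OF cb(1)[OF w(1)]] gQ[OF cb(1)[OF w(1)] w(2)] cb[OF w(1)] meml by simp
  qed
  have D0M: "D0 \<subseteq> M" unfolding D0_def using memM meml by auto
  have datum0: "bump_datum b D0 L0 \<eta>0"
    unfolding bump_datum_def M_def[symmetric] Q_def[symmetric]
  proof (intro conjI ballI)
    show "openin (top_of_set Q) D0"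
    proof -
      have "open (U \<inter> G -` ball 0 (2 * r))" by (rule continuous_open_preimage[OF contG U(1) open_ball])
      moreover have "openin (top_of_set Q) (rel_interior M)"
        unfolding Q_def by (rule openin_rel_interior_model[of n]) (simp add: M_def atlas_model b(1))
      ultimately have "openin (top_of_set Q) (rel_interior M \<inter> (U \<inter> G -` ball 0 (2 * r)))" by (rule openin_Int_open[rotated])
      moreover have "rel_interior M \<inter> (U \<inter> G -` ball 0 (2 * r)) = D0" unfolding D0_def by auto
      ultimately show ?thesis by simp
    qed
    have "compact (cball (r *\<^sub>R \<beta>) (r/2) \<inter> Q)" by (intro compact_Int_closed compact_cball closed_subspace sQ)
    then show "compact L0" unfolding L0_def
      by (rule compact_continuous_image[OF continuous_on_subset[OF contg], rotated]) (use cb in blast)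
    show "C1_near D0 \<eta>0 y" if "y \<in> D0" for y
    proof (rule C1_nearI[OF U(1)])
      show "y \<in> U" using that unfolding D0_def by blast
      show "C1_on \<eta>0 U" unfolding \<eta>0_def
        by (intro C1_on_ramp_sq_compose C1_on_diff C1_on_inner C1_on_const U(4))
    qed simp
    show "\<eta>0 y = 0" if y: "y \<in> D0 - L0" for y
    proof (rule eta0_0, rule ccontr)
      assume "\<not> r/2 \<le> norm (G y - r *\<^sub>R \<beta>)"
      moreover have yU: "y \<in> U" "y \<in> M" using y D0M unfolding D0_def by auto
      ultimately have "G y \<in> cball (r *\<^sub>R \<beta>) (r/2) \<inter> Q" using GQ(1) by (simp add: dist_norm norm_minus_commute)
      then have "g (G y) \<in> L0" unfolding L0_def by blast
      then show False using gG[OF yU(1)] y by simp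
    qed
  qed (use b(1) trb L0D0 in \<open>auto simp: D0_def \<eta>0_def\<close>)
  have bump0: "bump_fun b L0 \<eta>0 (cproj b y) = \<eta>0 y" if y: "y \<in> U" "y \<in> M" for y
  proof (cases "y \<in> D0")
    case True
    then show ?thesis by (rule bump_fun_eq[OF datum0])
  next
    case False
    have "y \<notin> L0" using False L0D0 by blast
    have "cproj b y \<notin> cproj b ` L0"
    proof
      assume "cproj b y \<in> cproj b ` L0"
      then obtain l where l: "l \<in> L0" "cproj b y = cproj b l" by blast
      then have "y = l" using inj_onD[OF injM l(2) y(2)] L0D0 D0M by blast
      then show False using l(1) \<open>y \<notin> L0\<close> by simp
    qed
    then have 1: "bump_fun b L0 \<eta>0 (cproj b y) = 0" unfolding bump_fun_def by simp
    \<comment> \<open>A point of the chart in \<open>U\<close> but off \<open>D0\<close> either is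
      on the boundary, at normal distance \<open>r\<close> from \<open>r \<beta>\<close>, or has
      \<open>G y\<close> of norm at least \<open>2 r\<close>, at distance at least \<open>r\<close>.
      Both exceed the radius of the bump.\<close>
    have "r/2 \<le> norm (G y - r *\<^sub>R \<beta>)"
    proof (cases "G y \<in> ball 0 (2 * r)")
      case True
      then have "y \<notin> rel_interior M" using False y unfolding D0_def by blast
      then have "\<beta> \<bullet> G y = 0" using GQ(2)[OF y] memM meml y(2) by force
      then have "\<beta> \<bullet> (G y - r *\<^sub>R \<beta>) = - r" using bb by (simp add: inner_diff_right)
      then show ?thesis using Cauchy_Schwarz_ineq2[of \<beta> "G y - r *\<^sub>R \<beta>"] \<beta>(2) r by simp
    next
      case False
      then have "2 * r \<le> norm (G y)" by simp
      moreover have "norm (G y) \<le> norm (G y - r *\<^sub>R \<beta>) + norm (r *\<^sub>R \<beta>)" using norm_triangle_ineq[of "G y - r *\<^sub>R \<beta>" "r *\<^sub>R \<beta>"] by simp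
      ultimately show ?thesis using \<beta>(2) r by simp
    qed
    then show ?thesis using eta0_0 1 by simp
  qed

  \<comment> \<open>Collar neighbourhoods of \<open>p\<close>\<close>
  define Box where "Box s = cproj b ` {y \<in> M. y \<in> U \<and> norm (k y) < r/4 \<and> \<beta> \<bullet> y < s}" for s
  have openBox: "openin TX (Box s)" for s
  proof -
    have "continuous_on U (\<lambda>y. norm (G y - (\<beta> \<bullet> y) *\<^sub>R \<beta>))" by (intro continuous_intros contG)
    then have o1: "open (U \<inter> (\<lambda>y. norm (G y - (\<beta> \<bullet> y) *\<^sub>R \<beta>)) -` {..<r/4})" by (rule continuous_open_preimage[OF _ U(1) open_lessThan])
    have o2: "open {y. \<beta> \<bullet> y < s}" by (intro open_Collect_less continuous_intros)
    have "openin (top_of_set M) (M \<inter> ((U \<inter> (\<lambda>y. norm (G y - (\<beta> \<bullet> y) *\<^sub>R \<beta>)) -` {..<r/4}) \<inter> {y. \<beta> \<bullet> y < s}))"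
      by (rule openin_open_Int[OF open_Int[OF o1 o2]])
    moreover have "M \<inter> ((U \<inter> (\<lambda>y. norm (G y - (\<beta> \<bullet> y) *\<^sub>R \<beta>)) -` {..<r/4}) \<inter> {y. \<beta> \<bullet> y < s}) = {y \<in> M. y \<in> U \<and> norm (k y) < r/4 \<and> \<beta> \<bullet> y < s}"
      using GQ(3) by auto
    ultimately show ?thesis unfolding Box_def using chart_open_map[OF chb] unfolding M_def by simp
  qed
  \<comment> \<open>The closed counterpart of \<open>Box r\<close> in straightened coordinates. All
    bumps but the one in the collar will be chosen to vanish on its image \<open>R1\<close>, so that
    \<open>\<rho>\<close> is explicit there.\<close>
  define T1 where "T1 = {w \<in> Q. 0 \<le> \<beta> \<bullet> w \<and> \<beta> \<bullet> w \<le> r \<and> norm (w - (\<beta> \<bullet> w) *\<^sub>R \<beta>) \<le> r/4}"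
  define R1 where "R1 = cproj b ` (g ` T1)"
  have T1: "w \<in> ball 0 (2 * r)" if "w \<in> T1" for w
  proof -
    have "norm w \<le> norm (w - (\<beta> \<bullet> w) *\<^sub>R \<beta>) + norm ((\<beta> \<bullet> w) *\<^sub>R \<beta>)"
      using norm_triangle_ineq[of "w - (\<beta> \<bullet> w) *\<^sub>R \<beta>" "(\<beta> \<bullet> w) *\<^sub>R \<beta>"] by simp
    also have "\<dots> \<le> r/4 + r" using that \<beta>(2) unfolding T1_def by simp
    finally show ?thesis using r by simp
  qed
  have "closedin TX R1"
  proof -
    have "T1 = Q \<inter> ({w. 0 \<le> \<beta> \<bullet> w} \<inter> {w. \<beta> \<bullet> w \<le> r} \<inter> {w. norm (w - (\<beta> \<bullet> w) *\<^sub>R \<beta>) \<le> r/4})" unfolding T1_def by auto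
    then have "closed T1" by (simp only:) (intro closed_Int closed_subspace sQ closed_Collect_le continuous_intros)
    moreover have "bounded T1" by (rule bounded_subset[OF bounded_ball[of 0 "2 * r"]]) (use T1 in blast)
    ultimately have "compact T1" by (simp add: compact_eq_bounded_closed)
    then have "compact (g ` T1)"
      by (rule compact_continuous_image[OF continuous_on_subset[OF contg], rotated]) (use T1 in blast)
    moreover have "g ` T1 \<subseteq> M" using gM T1 unfolding T1_def by blast
    ultimately have "compactin (top_of_set (cmodel b)) (g ` T1)" unfolding M_def by (simp add: compactin_subtopology)
    then have "compactin TX R1" unfolding R1_def by (rule image_compactin[OF _ chart_image(2)[OF chb]])
    then show ?thesis using Hausdorff_TX compactin_imp_closedin by blast
  qed
  then have openR1: "openin TX (topspace TX - R1)" by blast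
  have memR1: "cproj b y \<in> R1" if y: "y \<in> U" "y \<in> M" "norm (k y) \<le> r/4" "\<beta> \<bullet> y \<le> r" for y
  proof -
    have "G y \<in> T1" unfolding T1_def using GQ[OF y(1,2)] y memM by simp
    then have "y \<in> g ` T1" using gG[OF y(1)] by (metis imageI)
    then show ?thesis unfolding R1_def by blast
  qed

  \<comment> \<open>The fibre of \<open>p\<close> outside the collar and the bumps along it\<close>
  define K where "K = {x \<in> topspace TX. f x = p}"
  have "closedin TX {x \<in> topspace TX. f x \<in> {p}}"
    by (rule closedin_continuous_map_preimage[OF continuous_f']) (use Hausdorff_TX p(2) in \<open>simp add: closedin_Hausdorff_singleton\<close>)
  then have clK: "closedin TX K" unfolding K_def by simp
  have Kk: "k y = 0" if "y \<in> U" "y \<in> M" "cproj b y \<in> K" for y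
  proof -
    have "cproj b (k y) = cproj b 0" using kU(2)[OF that(1,2)] that(3) zM(2) unfolding K_def by simp
    then show ?thesis using injM kU(1)[OF that(1,2)] HM zM(1) by (meson inj_onD subsetD)
  qed
  \<comment> \<open>The height \<open>5 r / 4\<close> lies between \<open>r\<close> and
    \<open>3 r / 2\<close>. So \<open>K'\<close> is disjoint from \<open>R1\<close>, whose heights
    are at most \<open>r\<close>, and can be covered by bumps vanishing on \<open>R1\<close>; the
    gap between heights \<open>r\<close> and \<open>5 r / 4\<close> is left to the collar
    bump.\<close>
  define K' where "K' = K - Box (5 * r / 4)"
  have clK': "closedin TX K'" unfolding K'_def by (rule closedin_diff[OF clK openBox])
  have pK': "p \<notin> K'"
  proof -
    have "k 0 = 0" using Kk[OF U(2) zM(1)] zM(2) p fp unfolding K_def by simp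
    then have "0 \<in> {y \<in> M. y \<in> U \<and> norm (k y) < r/4 \<and> \<beta> \<bullet> y < 5 * r / 4}" using zM(1) U(2) r by simp
    then have "p \<in> Box (5 * r / 4)" unfolding Box_def using zM(2) by (metis (no_types, lifting) imageI)
    then show ?thesis unfolding K'_def by blast
  qed
  define good where "good x a D L \<eta> \<longleftrightarrow> bump_datum a D L \<eta> \<and> cproj a ` D \<subseteq> E \<and>
     (\<forall>y\<in>D. C1_near D (\<lambda>y. \<phi> (cproj a y)) y) \<and> 0 < bump_fun a L \<eta> x \<and> (\<forall>x'\<in>R1. bump_fun a L \<eta> x' = 0)" for x and a :: "('p, 'e, 'g) ochart" and D L \<eta>
  have bump_at: "\<exists>a D L \<eta>. good x a D L \<eta>" if x: "x \<in> K'" for x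
  proof -
    have xK: "x \<in> topspace TX" "f x = p" "x \<in> K" using x unfolding K'_def K_def by auto
    have "x \<noteq> p" using x pK' by blast
    then have xB: "x \<notin> BX" using f_boundary[OF _ xK(1)] xK(2) by auto
    have xR1: "x \<notin> R1"
    proof
      assume "x \<in> R1"
      then obtain w where w: "w \<in> T1" "x = cproj b (g w)" unfolding R1_def by blast
      have gw: "g w \<in> U" "g w \<in> M" "\<beta> \<bullet> g w \<le> r" using g[OF T1[OF w(1)]] gM[OF T1[OF w(1)]] w(1) unfolding T1_def by auto
      then have "k (g w) = 0" using Kk xK(3) w(2) by simp
      then have "x \<in> Box (5 * r / 4)" unfolding Box_def w(2) using gw r by (intro imageI) simp
      then show False using x unfolding K'_def by blast
    qed
    have "x \<in> regular_points" using reg xK by blast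
    then obtain c1 where c1: "c1 \<in> AX" "ccenter c1 = x" "trivial_chart c1" unfolding regular_points_def by blast
    have "f x \<in> cnbhd b" using xK(2) chart_onD(2)[OF chb] b(2) by simp
    then obtain V1 where V1: "openin TX V1" "x \<in> V1" and lift1:
      "\<And>a. a \<in> AX \<Longrightarrow> ccenter a = x \<Longrightarrow> cnbhd a \<subseteq> V1 \<Longrightarrow>
      \<exists>k N. C1_near (cmodel a) k 0 \<and> open N \<and> 0 \<in> N \<and>
        (\<forall>y\<in>N \<inter> cmodel a. k y \<in> rel_frontier (cmodel b) \<and> cproj b (k y) = f (cproj a y))"
      using local_lift_into_chart[OF xK(1) b(1) hb] by blast
    have "openin TX (V1 \<inter> (topspace TX - R1) \<inter> cnbhd c1)" "x \<in> V1 \<inter> (topspace TX - R1) \<inter> cnbhd c1"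
      using V1 openR1 xR1 xK(1) chart_onD(1,2)[OF atlas_chart[OF c1(1)]] c1(2) by (auto simp: openin_Int)
    \<comment> \<open>The chart is small enough for the lift, avoids \<open>R1\<close> and has
      trivial group; its centre is off the boundary, so its model is Euclidean.\<close>
    then obtain a where a: "a \<in> AX" "ccenter a = x" and as: "cnbhd a \<subseteq> V1 \<inter> (topspace TX - R1) \<inter> cnbhd c1"
      using atlas_small by blast
    have asub: "cnbhd a \<subseteq> V1" "cnbhd a \<inter> R1 = {}" "cnbhd a \<subseteq> cnbhd c1" using as by auto
    have cha: "chart_on n TX a" by (rule atlas_chart[OF a(1)])
    have tra: "trivial_chart a" by (rule trivial_chart_embeds[OF atlas_embeds[OF a(1) c1(1) asub(3)] c1(3) chart_group[OF cha]])
    have "euclidean_model n (cmodel a)"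
      using atlas_model[OF a(1)] xB a unfolding chart_model_def boundary_points_def by blast
    then have ea: "rel_interior (cmodel a) = cmodel a" "span (cmodel a) = cmodel a" "subspace (cmodel a)"
      using rel_interior_euclidean euclidean_model_span unfolding euclidean_model_def by blast+
    have ima: "cproj a ` cmodel a = cnbhd a" by (rule chart_image(1)[OF cha])
    have za: "0 \<in> cmodel a" "cproj a 0 = x" using atlas_center[OF a(1)] a(2) by auto
    obtain k1 N1 where k1: "C1_near (cmodel a) k1 0" "open N1" "0 \<in> N1"
      and k1N: "\<And>y. y \<in> N1 \<Longrightarrow> y \<in> cmodel a \<Longrightarrow> k1 y \<in> H \<and> cproj b (k1 y) = f (cproj a y)"
      using lift1[OF a asub(1)] unfolding H_def M_def by blast
    obtain N2 k2 where k2: "open N2" "0 \<in> N2" "C1_on k2 N2" "\<And>y. y \<in> N2 \<Longrightarrow> y \<in> cmodel a \<Longrightarrow> k2 y = k1 y"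
      using k1(1) unfolding C1_near_def by blast
    obtain e where e: "0 < e" "ball 0 e \<subseteq> N1 \<inter> N2" using openE[of "N1 \<inter> N2" 0] k1 k2 by blast
    define d where "d = e / 2"
    define D where "D = cmodel a \<inter> ball 0 e"
    define L where "L = cmodel a \<inter> cball 0 d"
    define \<eta> where "\<eta> y = ramp_sq (d\<^sup>2 - y \<bullet> y)" for y :: 'e
    have LD: "L \<subseteq> D" unfolding L_def D_def d_def using e(1) by auto
    have datum: "bump_datum a D L \<eta>"
      unfolding bump_datum_def ea
    proof (intro conjI ballI)
      show "openin (top_of_set (cmodel a)) D" unfolding D_def by (rule openin_open_Int[OF open_ball])
      show "compact L" unfolding L_def by (rule closed_Int_compact[OF closed_subspace[OF ea(3)] compact_cball])
      show "C1_near D \<eta> y" for y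
      proof (rule C1_nearI[OF open_UNIV UNIV_I])
        show "C1_on \<eta> UNIV" unfolding \<eta>_def
          by (intro C1_on_ramp_sq_compose C1_on_diff C1_on_inner C1_on_const C1_on_id)
      qed simp
      show "\<eta> y = 0" if "y \<in> D - L" for y
      proof -
        have "d < norm y" using that unfolding D_def L_def by auto
        then have "d\<^sup>2 \<le> (norm y)\<^sup>2" using e(1) unfolding d_def by (intro power_mono) auto
        then show ?thesis unfolding \<eta>_def by (simp add: dot_square_norm)
      qed
    qed (use a(1) tra LD in \<open>auto simp: D_def \<eta>_def\<close>)
    have DN: "y \<in> N1" "y \<in> N2" "y \<in> cmodel a" if "y \<in> D" for y using that e(2) unfolding D_def by auto
    have topa: "cproj a y \<in> topspace TX" if "y \<in> cmodel a" for y
      using that ima openin_subset[OF chart_onD(1)[OF cha]] by blast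
    have DE: "cproj a ` D \<subseteq> E"
    proof clarify
      fix y assume "y \<in> D"
      then show "cproj a y \<in> E" using EI[OF topa, of y "k1 y"] k1N DN by blast
    qed
    moreover have "C1_near D (\<lambda>y. \<phi> (cproj a y)) y" if y: "y \<in> D" for y
    proof (rule C1_nearI[OF k2(1) DN(2)[OF y] k2(3)])
      fix y' assume "y' \<in> N2" "y' \<in> D"
      then show "k2 y' = \<phi> (cproj a y')" using phi_eq[of "k1 y'" "cproj a y'"] k1N DN k2(4) by simp
    qed
    moreover have "0 < bump_fun a L \<eta> x"
    proof -
      have "0 \<in> D" unfolding D_def using za(1) e(1) by simp
      then have "bump_fun a L \<eta> x = \<eta> 0" using bump_fun_eq[OF datum] za(2) by metis
      then show ?thesis unfolding \<eta>_def d_def using e(1) by simp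
    qed
    moreover have "bump_fun a L \<eta> x' = 0" if "x' \<in> R1" for x'
    proof -
      have "cproj a ` L \<subseteq> cnbhd a" using ima unfolding L_def by blast
      then show ?thesis using asub(2) that unfolding bump_fun_def by auto
    qed
    ultimately have "good x a D L \<eta>" unfolding good_def using datum by blast
    then show ?thesis by blast
  qed
  then obtain ca Da La \<eta>a where good: "\<And>x. x \<in> K' \<Longrightarrow> good x (ca x) (Da x) (La x) (\<eta>a x)" by metis
  have compact_cover: "\<exists>C. finite C \<and> C \<subseteq> S \<and> S \<subseteq> (\<Union>x\<in>C. O' x)"
    if S: "closedin TX S" and O': "\<And>x. x \<in> S \<Longrightarrow> openin TX (O' x) \<and> x \<in> O' x" for S O'
  proof -
    have "compactin TX S" using closedin_compact_space[OF cpt S] .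
    moreover have "\<And>U. U \<in> O' ` S \<Longrightarrow> openin TX U" "S \<subseteq> \<Union>(O' ` S)" using O' by auto
    ultimately obtain \<F> where F: "finite \<F>" "\<F> \<subseteq> O' ` S" "S \<subseteq> \<Union>\<F>" by (meson compactinD)
    then obtain C where "C \<subseteq> S" "finite C" "\<F> = O' ` C" using finite_subset_image by metis
    then show ?thesis using F(3) by blast
  qed
  define lb where "lb x a L \<eta> V \<epsilon> \<longleftrightarrow> openin TX V \<and> x \<in> V \<and> 0 < \<epsilon> \<and> (\<forall>x'\<in>V. \<epsilon> \<le> bump_fun a L \<eta> x')"
    for x and a :: "('p, 'e, 'g) ochart" and L \<eta> V and \<epsilon> :: real
  have "\<exists>V. \<exists>\<epsilon>. lb x (ca x) (La x) (\<eta>a x) V \<epsilon>" if "x \<in> K'" for x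
    using bump_fun_lower_bound good[OF that] unfolding good_def lb_def by blast
  then obtain O1 \<epsilon>1 where O1: "\<And>x. x \<in> K' \<Longrightarrow> lb x (ca x) (La x) (\<eta>a x) (O1 x) (\<epsilon>1 x)" by metis
  obtain C where C: "finite C" "C \<subseteq> K'" "K' \<subseteq> (\<Union>x\<in>C. O1 x)"
  proof -
    have "\<And>x. x \<in> K' \<Longrightarrow> openin TX (O1 x) \<and> x \<in> O1 x" using O1 unfolding lb_def by blast
    from compact_cover[OF clK' this] show ?thesis using that by blast
  qed

  \<comment> \<open>The sum \<open>\<rho>\<close> of all bumps\<close>
  define I where "I = insert p C"
  \<comment> \<open>The point \<open>p\<close> indexes the collar bump; it is not in
    \<open>K'\<close>, so it cannot clash with the indices from \<open>C\<close>.\<close>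
  define c where "c i = (if i = p then b else ca i)" for i
  define D where "D i = (if i = p then D0 else Da i)" for i
  define L where "L i = (if i = p then L0 else La i)" for i
  define \<eta> where "\<eta> i = (if i = p then \<eta>0 else \<eta>a i)" for i
  have finI: "finite I" unfolding I_def using C(1) by simp
  have Ip: "i = p \<or> i \<in> K' \<and> i \<noteq> p" if "i \<in> I" for i using that C(2) pK' unfolding I_def by blast
  have datum: "bump_datum (c i) (D i) (L i) (\<eta> i)" if "i \<in> I" for i
    using Ip[OF that] datum0 good unfolding c_def D_def L_def \<eta>_def good_def by auto
  have D0E: "cproj b ` D0 \<subseteq> E"
  proof clarify
    fix y assume "y \<in> D0"
    then have "y \<in> U" "y \<in> M" using D0M unfolding D0_def by auto
    then show "cproj b y \<in> E" using EI[OF topb, of y "k y"] kU by blast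
  qed
  have C1phi0: "C1_near D0 (\<lambda>y. \<phi> (cproj b y)) y" if y: "y \<in> D0" for y
  proof (rule C1_nearI[OF U(1)])
    show "y \<in> U" using y unfolding D0_def by blast
    show "C1_on (\<lambda>y. G y - (\<beta> \<bullet> y) *\<^sub>R \<beta>) U"
      by (intro C1_on_diff U(4) C1_on_scaleR C1_on_inner C1_on_const C1_on_id)
    fix y' assume y': "y' \<in> U" "y' \<in> D0"
    then have "y' \<in> M" using D0M by blast
    then show "G y' - (\<beta> \<bullet> y') *\<^sub>R \<beta> = \<phi> (cproj b y')" using GQ(3)[OF y'(1)] phi_eq[OF kU[OF y'(1)]] by simp
  qed
  have C1phi: "C1_near (D i) (\<lambda>y. \<phi> (cproj (c i) y)) y" if "i \<in> I" "y \<in> D i" for i y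
    using Ip[OF that(1)] that(2) C1phi0 good unfolding c_def D_def good_def by auto
  have DE: "cproj (c i) ` D i \<subseteq> E" if "i \<in> I" for i
  proof (cases "i = p")
    case False
    then have "cproj (ca i) ` Da i \<subseteq> E" using Ip[OF that] good[of i] unfolding good_def by blast
    then show ?thesis using False unfolding c_def D_def by simp
  qed (simp add: c_def D_def D0E)
  have phiQ: "\<phi> x \<in> Q \<and> \<beta> \<bullet> \<phi> x = 0" if "x \<in> E" for x using phi(1)[OF that] memH by blast
  define \<rho> where "\<rho> x = (\<Sum>i\<in>I. bump_fun (c i) (L i) (\<eta> i) x)" for x
  have "C1_regular \<rho> \<and> (\<exists>B. null_in Q B \<and> (\<forall>q. q \<in> Q \<longrightarrow> q \<notin> B \<longrightarrow> \<beta> \<bullet> q \<noteq> 0 \<longrightarrow>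
      finite {x \<in> E. \<phi> x + \<rho> x *\<^sub>R \<beta> = q} \<and> even (card {x \<in> E. \<phi> x + \<rho> x *\<^sub>R \<beta> = q})))"
    unfolding \<rho>_def
    by (rule bump_sum_parity[where D=D, OF finI]) (fact datum sQ dimQ \<beta>(1) C1phi phiQ DE)+
  then obtain B where B: "null_in Q B" and parity: "\<And>q. q \<in> Q \<Longrightarrow> q \<notin> B \<Longrightarrow> \<beta> \<bullet> q \<noteq> 0 \<Longrightarrow>
      even (card {x \<in> E. \<phi> x + \<rho> x *\<^sub>R \<beta> = q})"
    by blast

  \<comment> \<open>Where small values of \<open>\<rho>\<close> can be attained\<close>
  have rho_ge: "bump_fun (c i) (L i) (\<eta> i) x \<le> \<rho> x" if "i \<in> I" for i x
    unfolding \<rho>_def by (rule member_le_sum[OF that _ finI]) (use bump_fun_nonneg[OF datum] in auto)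
  have rho_R1: "\<rho> x = bump_fun b L0 \<eta>0 x" if x: "x \<in> R1" for x
  proof -
    have "\<rho> x = bump_fun (c p) (L p) (\<eta> p) x + (\<Sum>i\<in>I - {p}. bump_fun (c i) (L i) (\<eta> i) x)"
      unfolding \<rho>_def by (rule sum.remove[OF finI]) (simp add: I_def)
    moreover have "(\<Sum>i\<in>I - {p}. bump_fun (c i) (L i) (\<eta> i) x) = 0"
    proof (rule sum.neutral, rule ballI)
      fix i assume "i \<in> I - {p}"
      then have "i \<in> K'" "i \<noteq> p" using Ip by blast+
      then show "bump_fun (c i) (L i) (\<eta> i) x = 0" using good[of i] x unfolding c_def L_def \<eta>_def good_def by simp
    qed
    ultimately show ?thesis unfolding c_def L_def \<eta>_def by simp
  qed
  \<comment> \<open>The part of the fibre outside the open collar of height \<open>r\<close>. Some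
    bump is positive at each of its points: one of the covering bumps if the point is in
    \<open>K'\<close>, and otherwise the collar bump, as the height is at least \<open>r\<close> and
    less than \<open>5 r / 4\<close>.\<close>
  define K0 where "K0 = K - Box r"
  have clK0: "closedin TX K0" unfolding K0_def by (rule closedin_diff[OF clK openBox])
  have pos: "\<exists>i\<in>I. 0 < bump_fun (c i) (L i) (\<eta> i) x" if x: "x \<in> K0" for x
  proof (cases "x \<in> K'")
    case True
    then obtain i where i: "i \<in> C" "x \<in> O1 i" using C(3) by blast
    have iK: "i \<in> K'" "i \<noteq> p" using i(1) C(2) pK' by blast+
    have "\<epsilon>1 i \<le> bump_fun (ca i) (La i) (\<eta>a i) x" "0 < \<epsilon>1 i" using O1[OF iK(1)] i(2) unfolding lb_def by blast+
    then have "0 < bump_fun (c i) (L i) (\<eta> i) x" using iK(2) unfolding c_def L_def \<eta>_def by simp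
    then show ?thesis using i(1) unfolding I_def by blast
  next
    case False
    then have xBox: "x \<in> Box (5 * r / 4)" "x \<in> K" "x \<notin> Box r" using x unfolding K0_def K'_def by auto
    then obtain y where y: "y \<in> M" "y \<in> U" "\<beta> \<bullet> y < 5 * r / 4" "x = cproj b y" unfolding Box_def by blast
    have ky: "k y = 0" using Kk[OF y(2,1)] xBox(2) y(4) by simp
    have "\<not> \<beta> \<bullet> y < r"
    proof
      assume "\<beta> \<bullet> y < r"
      then have "x \<in> Box r" unfolding Box_def y(4) using y(1,2) ky r by (intro imageI) simp
      then show False using xBox(3) by simp
    qed
    then have "\<bar>\<beta> \<bullet> y - r\<bar> < r/2" using y(3) r by linarith
    then have "(\<beta> \<bullet> y - r)\<^sup>2 < (r/2)\<^sup>2" using r by (metis abs_ge_zero power2_abs power_strict_mono zero_less_numeral)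
    moreover have "G y - r *\<^sub>R \<beta> = (\<beta> \<bullet> y - r) *\<^sub>R \<beta>" using GM[OF y(2,1)] ky by (simp add: scaleR_diff_left)
    then have "(G y - r *\<^sub>R \<beta>) \<bullet> (G y - r *\<^sub>R \<beta>) = (\<beta> \<bullet> y - r)\<^sup>2" using bb by (simp add: power2_eq_square)
    ultimately have "0 < \<eta>0 y" unfolding \<eta>0_def by simp
    then have "0 < bump_fun (c p) (L p) (\<eta> p) x" using bump0[OF y(2,1)] y(4) unfolding c_def L_def \<eta>_def by simp
    then show ?thesis unfolding I_def by blast
  qed
  have "\<exists>V. \<exists>\<epsilon>. openin TX V \<and> x \<in> V \<and> 0 < \<epsilon> \<and> (\<forall>x'\<in>V. \<epsilon> \<le> \<rho> x')" if x: "x \<in> K0" for x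
  proof -
    obtain i where i: "i \<in> I" "0 < bump_fun (c i) (L i) (\<eta> i) x" using pos[OF x] by blast
    obtain V \<epsilon> where "openin TX V" "x \<in> V" "0 < \<epsilon>" "\<forall>x'\<in>V. \<epsilon> \<le> bump_fun (c i) (L i) (\<eta> i) x'"
      using bump_fun_lower_bound[OF datum[OF i(1)] i(2)] by blast
    then show ?thesis using rho_ge[OF i(1)] by (meson order_trans)
  qed
  then obtain O2 \<epsilon>2 where O2: "\<And>x. x \<in> K0 \<Longrightarrow> openin TX (O2 x) \<and> x \<in> O2 x \<and> 0 < \<epsilon>2 x \<and> (\<forall>x'\<in>O2 x. \<epsilon>2 x \<le> \<rho> x')" by metis
  obtain C2 where C2: "finite C2" "C2 \<subseteq> K0" "K0 \<subseteq> (\<Union>x\<in>C2. O2 x)"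
  proof -
    have "\<And>x. x \<in> K0 \<Longrightarrow> openin TX (O2 x) \<and> x \<in> O2 x" using O2 by blast
    from compact_cover[OF clK0 this] show ?thesis using that by blast
  qed
  define O3 where "O3 = (\<Union>x\<in>C2. O2 x)"
  have openO3: "openin TX O3" unfolding O3_def using C2(2) O2 by (intro openin_Union) auto
  define \<delta>0 where "\<delta>0 = Min (insert 1 (\<epsilon>2 ` C2))"
  have "\<delta>0 \<in> insert 1 (\<epsilon>2 ` C2)" unfolding \<delta>0_def using C2(1) by (intro Min_in) auto
  then have \<delta>0: "0 < \<delta>0" using C2(2) O2 by auto
  have rhoO3: "\<delta>0 \<le> \<rho> x" if xO: "x \<in> O3" for x
  proof -
    obtain z where z: "z \<in> C2" "x \<in> O2 z" using xO unfolding O3_def by blast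
    have "\<delta>0 \<le> \<epsilon>2 z" unfolding \<delta>0_def using C2(1) z(1) by (intro Min_le) auto
    also have "\<dots> \<le> \<rho> x" using O2 C2(2) z by blast
    finally show ?thesis .
  qed
  \<comment> \<open>\<open>R\<close> is compact and misses the fibre of \<open>p\<close>, so its
    image stays away from \<open>p\<close>. Hence a point whose value under \<open>f\<close> is
    close to \<open>p\<close> and where \<open>\<rho>\<close> is below \<open>\<delta>0\<close> must
    lie in \<open>Box r\<close>.\<close>
  define R where "R = topspace TX - Box r - O3"
  have "closedin TX R" unfolding R_def by (intro closedin_diff closedin_topspace openBox openO3)
  then have "compactin TX (f ` R)" by (intro image_compactin[OF closedin_compact_space[OF cpt] continuous_f'])
  then have "closedin TX (f ` R)" using Hausdorff_TX compactin_imp_closedin by blast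
  then have "openin TX (topspace TX - f ` R)" by blast
  then have "openin (top_of_set M) {y \<in> M. cproj b y \<in> topspace TX - f ` R}"
    using openin_continuous_map_preimage[OF chart_image(2)[OF chb]] unfolding M_def by fastforce
  moreover have "p \<notin> f ` R"
  proof
    assume "p \<in> f ` R"
    then obtain x where "x \<in> R" "f x = p" by blast
    then have "x \<in> K0" unfolding K0_def K_def R_def by blast
    then show False using C2(3) \<open>x \<in> R\<close> unfolding R_def O3_def by blast
  qed
  then have "0 \<in> {y \<in> M. cproj b y \<in> topspace TX - f ` R}" using zM p(2) by simp
  ultimately obtain \<delta>1 where \<delta>1: "0 < \<delta>1" and "ball 0 \<delta>1 \<inter> M \<subseteq> {y \<in> M. cproj b y \<in> topspace TX - f ` R}"
    unfolding openin_contains_ball by blast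
  then have fR: "cproj b v \<notin> f ` R" if "v \<in> M" "norm v < \<delta>1" for v using that by auto

  \<comment> \<open>Exactly one solution for small values\<close>
  have single: "card {x \<in> E. \<phi> x + \<rho> x *\<^sub>R \<beta> = q} = 1"
    if q: "q \<in> Q" and v: "norm (q - (\<beta> \<bullet> q) *\<^sub>R \<beta>) < \<delta>1" "norm (q - (\<beta> \<bullet> q) *\<^sub>R \<beta>) < r/4"
      and t: "0 < \<beta> \<bullet> q" "\<beta> \<bullet> q < \<delta>0" "\<beta> \<bullet> q < (3 * r\<^sup>2 / 16)\<^sup>2" for q
  proof -
    define t where "t = \<beta> \<bullet> q"
    define v where "v = q - t *\<^sub>R \<beta>"
    have vH: "v \<in> H" using q \<beta>(1) sQ bb unfolding v_def t_def memH by (simp add: subspace_diff subspace_scale inner_diff_right)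
    have vM: "v \<in> M" using vH HM by blast
    have bv: "\<beta> \<bullet> v = 0" "v \<in> Q" using vH memH by auto
    \<comment> \<open>On the fibre of \<open>v\<close> in the collar, \<open>\<rho> = t\<close>
      reads \<open>(r/2)^2 - v \<bullet> v - (h - r)^2 = sqrt t\<close> for the height
      \<open>h\<close>, that is \<open>(h - r)^2 = m\<close>. The bound
      \<open>3 r^2 / 16 = (r/2)^2 - (r/4)^2\<close> on \<open>sqrt t\<close> makes \<open>m\<close>
      positive.\<close>
    define m where "m = (r/2)\<^sup>2 - v \<bullet> v - sqrt t"
    have "v \<bullet> v < (r/4)\<^sup>2"
      using v(2) unfolding v_def t_def dot_square_norm by (intro power_strict_mono) auto
    moreover have "sqrt t < 3 * r\<^sup>2 / 16" using t(3) unfolding t_def by (intro real_less_lsqrt) auto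
    ultimately have m: "0 < m" unfolding m_def by (simp add: power2_eq_square field_simps)
    have "m \<le> (r/2)\<^sup>2" unfolding m_def t_def using inner_ge_zero[of v] real_sqrt_ge_zero[of "\<beta> \<bullet> q"] t(1) by linarith
    then have sm: "sqrt m \<le> r/2" using r by (intro real_le_lsqrt) auto
    \<comment> \<open>The smaller root, because solutions lie below height \<open>r\<close>;
      \<open>sqrt m \<le> r/2\<close> keeps it off the boundary.\<close>
    define s where "s = r - sqrt m"
    have s: "0 < s" "s < r" unfolding s_def using sm r real_sqrt_gt_zero[OF m] by linarith+
    define w where "w = v + s *\<^sub>R \<beta>"
    have bw: "\<beta> \<bullet> w = s" unfolding w_def using bv bb by (simp add: inner_add_right)
    have wQ: "w \<in> Q" unfolding w_def using bv(2) \<beta>(1) sQ by (simp add: subspace_add subspace_scale)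
    have wb: "w \<in> ball 0 (2 * r)"
    proof -
      have "norm w \<le> norm v + norm (s *\<^sub>R \<beta>)" unfolding w_def by (rule norm_triangle_ineq)
      also have "\<dots> < r/4 + r" using v(2) s \<beta>(2) unfolding v_def t_def by simp
      finally show ?thesis using r by simp
    qed
    define y where "y = g w"
    have y: "y \<in> U" "G y = w" "\<beta> \<bullet> y = s" using g[OF wb] bw unfolding y_def by auto
    have yM: "y \<in> M" unfolding y_def using gM[OF wb wQ] bw s by simp
    have ky: "k y = v" using GQ(3)[OF y(1) yM] y(2,3) unfolding w_def by simp
    have eta: "\<eta>0 z = ramp_sq ((r/2)\<^sup>2 - (v \<bullet> v + (\<beta> \<bullet> z - r)\<^sup>2))" if z: "z \<in> U" "z \<in> M" "k z = v" for z
    proof -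
      have "G z - r *\<^sub>R \<beta> = v + (\<beta> \<bullet> z - r) *\<^sub>R \<beta>" using GM[OF z(1,2)] z(3) by (simp add: scaleR_diff_left)
      then have "(G z - r *\<^sub>R \<beta>) \<bullet> (G z - r *\<^sub>R \<beta>) = v \<bullet> v + (\<beta> \<bullet> z - r)\<^sup>2"
        using bv bb by (simp add: inner_add_left inner_add_right inner_commute power2_eq_square)
      then show ?thesis unfolding \<eta>0_def by simp
    qed
    have nv: "norm v < r/4" "norm v < \<delta>1" using v unfolding v_def t_def by auto
    have t0: "0 < t" "t < \<delta>0" using t unfolding t_def by auto
    have "{x \<in> E. \<phi> x + \<rho> x *\<^sub>R \<beta> = q} = {cproj b y}"
    proof (intro equalityI subsetI)
      fix x assume "x \<in> {cproj b y}"
      then have x: "x = cproj b y" by simp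
      have fx: "cproj b v = f x" using kU(2)[OF y(1) yM] ky x by simp
      have xE: "x \<in> E" using EI[OF topb[OF yM] vH] fx x by simp
      have "x \<in> R1" unfolding x using memR1[OF y(1) yM] ky nv(1) y(3) s by simp
      then have "\<rho> x = \<eta>0 y" using rho_R1 bump0[OF y(1) yM] x by simp
      also have "\<dots> = ramp_sq (sqrt t)"
      proof -
        have "(s - r)\<^sup>2 = m" unfolding s_def using m by simp
        then have "(r/2)\<^sup>2 - (v \<bullet> v + (s - r)\<^sup>2) = sqrt t" unfolding m_def by linarith
        then show ?thesis using eta[OF y(1) yM ky] y(3) by simp
      qed
      also have "\<dots> = t" using t0(1) by simp
      finally have "\<phi> x + \<rho> x *\<^sub>R \<beta> = q" using phi_eq[OF vH fx] unfolding v_def by simp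
      then show "x \<in> {x \<in> E. \<phi> x + \<rho> x *\<^sub>R \<beta> = q}" using xE by simp
    next
      fix x assume "x \<in> {x \<in> E. \<phi> x + \<rho> x *\<^sub>R \<beta> = q}"
      then have x: "x \<in> E" "\<phi> x + \<rho> x *\<^sub>R \<beta> = q" by auto
      have "\<beta> \<bullet> (\<phi> x + \<rho> x *\<^sub>R \<beta>) = \<rho> x" using phiQ[OF x(1)] bb by (simp add: inner_add_right)
      then have rx: "\<rho> x = t" using x(2) unfolding t_def by simp
      then have px: "\<phi> x = v" using x(2) unfolding v_def by (simp add: algebra_simps)
      have "f x = cproj b v" using phi(2)[OF x(1)] px by simp
      then have "x \<notin> R" using fR[OF vM nv(2)] by (metis imageI)
      moreover have "x \<notin> O3" using rhoO3[of x] rx t0(2) by fastforce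
      moreover have "x \<in> topspace TX" using x(1) unfolding E_def by blast
      ultimately have "x \<in> Box r" unfolding R_def by blast
      then obtain z where z: "z \<in> M" "z \<in> U" "norm (k z) < r/4" "\<beta> \<bullet> z < r" "x = cproj b z" unfolding Box_def by blast
      have kz: "k z = v" using phi_eq[of "k z" x] kU[OF z(2,1)] z(5) px by simp
      have "x \<in> R1" unfolding z(5) using memR1[OF z(2,1)] z(3,4) by simp
      then have "t = \<eta>0 z" using rho_R1 bump0[OF z(2,1)] z(5) rx by simp
      then have tA: "t = ramp_sq ((r/2)\<^sup>2 - (v \<bullet> v + (\<beta> \<bullet> z - r)\<^sup>2))" using eta[OF z(2,1) kz] by simp
      define A where "A = (r/2)\<^sup>2 - (v \<bullet> v + (\<beta> \<bullet> z - r)\<^sup>2)"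
      have "0 < A" using tA t0(1) unfolding A_def[symmetric] by simp
      then have "sqrt t = A" using tA unfolding A_def[symmetric] by simp
      then have "(\<beta> \<bullet> z - r)\<^sup>2 = m" unfolding m_def A_def by simp
      then have "\<bar>\<beta> \<bullet> z - r\<bar> = sqrt m" by (metis real_sqrt_abs)
      \<comment> \<open>Membership in \<open>Box r\<close> gives
        \<open>\<beta> \<bullet> z < r\<close>, which excludes the larger root.\<close>
      then have "\<beta> \<bullet> z = s" unfolding s_def using z(4) by simp
      then have "G z = w" using GM[OF z(2,1)] kz unfolding w_def by simp
      then have "z = y" using gG[OF z(2)] unfolding y_def by simp
      then show "x \<in> {cproj b y}" using z(5) by simp
    qed
    then show ?thesis by simp
  qed

  \<comment> \<open>A small value outside the null set\<close>
  define \<delta> where "\<delta> = min (min \<delta>0 \<delta>1) (min (r/4) ((3 * r\<^sup>2 / 16)\<^sup>2))"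
  have \<delta>: "0 < \<delta>" "\<delta> \<le> \<delta>0" "\<delta> \<le> \<delta>1" "\<delta> \<le> r/4" "\<delta> \<le> (3 * r\<^sup>2 / 16)\<^sup>2"
    unfolding \<delta>_def using \<delta>0 \<delta>1 r by auto
  \<comment> \<open>In the ball of radius \<open>\<delta>/2\<close> about
    \<open>(\<delta>/2) \<beta>\<close> the height of \<open>q\<close> is strictly between
    \<open>0\<close> and \<open>\<delta>\<close>, and its tangential part is shorter than
    \<open>\<delta>\<close>. The ball is not null in \<open>Q\<close>, so it contains a value to
    which the parity statement applies.\<close>
  define q0 where "q0 = (\<delta>/2) *\<^sub>R \<beta>"
  have "q0 \<in> Q" unfolding q0_def using \<beta>(1) sQ by (rule subspace_scale[rotated])
  then have "\<not> null_in Q (Q \<inter> ball q0 (\<delta>/2))" using \<delta>(1) by (intro not_null_in_ball[OF sQ]) auto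
  then have "\<not> Q \<inter> ball q0 (\<delta>/2) \<subseteq> B" using null_in_subset[OF B] by blast
  then obtain q where q: "q \<in> Q" "q \<in> ball q0 (\<delta>/2)" "q \<notin> B" by blast
  have dq: "norm (q - q0) < \<delta>/2" using q(2) by (simp add: dist_norm norm_minus_commute)
  have "\<bar>\<beta> \<bullet> (q - q0)\<bar> \<le> norm \<beta> * norm (q - q0)" by (rule Cauchy_Schwarz_ineq2)
  then have bq: "\<bar>\<beta> \<bullet> q - \<delta>/2\<bar> < \<delta>/2" using dq \<beta>(2) bb unfolding q0_def by (simp add: inner_diff_right)
  have nq: "norm (q - (\<beta> \<bullet> q) *\<^sub>R \<beta>) < \<delta>"
  proof -
    have eq: "q - (\<beta> \<bullet> q) *\<^sub>R \<beta> = (q - q0) - (\<beta> \<bullet> q - \<delta>/2) *\<^sub>R \<beta>" unfolding q0_def by (simp add: algebra_simps)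
    have "norm (q - (\<beta> \<bullet> q) *\<^sub>R \<beta>) \<le> norm (q - q0) + \<bar>\<beta> \<bullet> q - \<delta>/2\<bar>"
      unfolding eq using norm_triangle_ineq4[of "q - q0" "(\<beta> \<bullet> q - \<delta>/2) *\<^sub>R \<beta>"] \<beta>(2) by simp
    then show ?thesis using dq bq by linarith
  qed
  have "card {x \<in> E. \<phi> x + \<rho> x *\<^sub>R \<beta> = q} = 1"
    by (rule single[OF q(1)]) (use bq nq \<delta> in linarith)+
  moreover have "even (card {x \<in> E. \<phi> x + \<rho> x *\<^sub>R \<beta> = q})"
    by (rule parity[OF q(1,3)]) (use bq in linarith)
  ultimately show False by simp
qed

end

theorem corollary26:
  fixes X :: "('p, 'e::euclidean_space, 'g) orbifold" and n :: nat
  assumes "orbifold_with_boundary n X"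
    and "compact_space (ospace X)"
    and "topspace (ospace (boundary n X)) \<noteq> {}"
    and "singular_codim_gt_1 n X"
  shows "\<not> boundary_is_smooth_retract n X"
proof
  assume "boundary_is_smooth_retract n X"
  then obtain F :: "('p, 'e, 'g, 'p, 'e, 'g) omap" and e where "smooth_complete_map n X (n - 1) (boundary n X) F"
    "same_complete_map (boundary n X) (restrict_to_boundary n X F) (identity_map e)"
    unfolding boundary_is_smooth_retract_def by blast
  then interpret boundary_retraction n X F e
    using assms(1) by unfold_locales
  show False
    by (rule no_smooth_retraction[OF assms(4,2)]) (use assms(3) in \<open>simp add: boundary_def\<close>)
qed

end
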